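(* For all integers $n\geq 1$ and $i\geq 0$, the mapping $\phi$ is a bijection between plane bipolar orientations with $n$ edges and $i$ non-special vertices, and $N$-avoiding plane bipolar posets with $n$ non-special vertices and $i$ inner faces. The inverse mapping of $\phi$ is $\psi$.
   Context: **Maps.** A planar map (map) is a connected graph (loops and multiple edges allowed) embedded in the plane without edge-crossings, considered up to continuous deformation. The unbounded face is the outer face; the others are inner faces. A vertex or edge is outer if incident to the outer face, inner otherwise. **Plane bipolar orientations.** A bipolar orientation of a connected graph is an acyclic orientation with a unique source $s$ (vertex with only outgoing edges) and a unique sink $t$ (vertex with only ingoing edges). A plane bipolar orientation is a bipolar orientation on a planar map such that $s$ and $t$ are outer vertices. The vertices $s,t$ are called special, the others non-special. One draws half-lines from $s$ and from $t$ into the outer face, splitting it into two unbounded special faces; looking from $s$ to $t$, the left one is the left special face and the right one is the right special face. It is classical that around each non-special vertex the edges form a nonempty interval of outgoing edges and a nonempty interval of ingoing edges, and that the contour of each inner face $f$ is made of two oriented paths with the same origin $s_f$ (the source of $f$) and the same end $t_f$ (the sink of $f$); the special faces are each bordered by a path from $s$ to $t$. The left lateral path $P_\ell(f)$ (resp. right lateral path $P_{\mathrm r}(f)$) is the path from $s_f$ to $t_f$ with the exterior of $f$ on its left (resp. right). The last edge of $P_\ell(f)$ is the topleft edge of $f$; the first edge of $P_{\mathrm r}(f)$ is the bottomright edge of $f$. For a non-special vertex $v$, its left lateral face is the face in the corner between the last ingoing edge and the first outgoing edge in clockwise order around $v$; its right lateral face is the face in the corner between the last outgoing edge and the first ingoing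 edge in clockwise order around $v$. **Plane bipolar posets.** A transitive edge is an edge whose two extremities are connected by an oriented path of length at least 2. A plane bipolar poset is a plane bipolar orientation with at least 3 vertices, no multiple edges and no transitive edges. An $N$-pattern is a triple $(e_1,e_2,e_3)$ of edges such that $e_1,e_2$ have the same origin $v$, $e_2,e_3$ have the same end $v'$, $e_1$ follows $e_2$ in clockwise order around $v$, and $e_3$ follows $e_2$ in clockwise order around $v'$. A plane bipolar poset is $N$-avoiding if it has no $N$-pattern. **The mapping $\phi$.** Let $O$ be a plane bipolar orientation. Add two edges $\ell$ and $r$ from the source to the sink of $O$ so that the whole map is contained in the 2-cycle delimited on the left by $\ell$ and on the right by $r$; call the result $\widetilde O$. Insert a vertex of $P=\phi(O)$ in the middle of each edge of $\widetilde O$; the vertex on $\ell$ is called $s_P$, the vertex on $r$ is called $t_P$. Inside each inner face $f$ of $\widetilde O$, insert edges of $P$ in a planar way so that the vertices of $P$ in the left lateral path of $f$ are connected to the vertex of $P$ in the bottomright edge of $f$, and the vertices of $P$ in the right lateral path of $f$ are connected to the vertex of $P$ in the topleft edge of $f$ (the edge between the topleft and bottomright vertices being inserted once); these edges are directed from the left lateral path to the right lateral path. The oriented planar map $P=\phi(O)$ consists of the inserted vertices and edges. **The mapping $\psi$.** Let $P$ be a plane bipolar poset. Insert one vertex of $O=\psi(P)$ in each face of $P$; the one in the right special face is denoted $s$, the one in the left special face is denoted $t$. Each non-special vertex $v$ of $P$ gives rise to an edge of $O$ (drawn through $v$) going from the vertex of $O$ in the right lateral face of $v$ to the vertex of $O$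 in the left lateral face of $v$. *)

theory Defs
  imports "HOL-Combinatorics.Permutations" "HOL-Combinatorics.Orbits"
begin
text \<open>
  An oriented map is encoded by its rotation system. An edge \<open>e\<close> consists of the two half-edges
  \<open>(e, True)\<close>, at the origin of \<open>e\<close>, and \<open>(e, False)\<close>, at the end of \<open>e\<close>. The field \<open>rot\<close> sends
  a half-edge to the next one in clockwise order around the same vertex, so that the vertices
  are the cycles of \<open>rot\<close>. A half-edge \<open>h\<close> also stands for the corner between \<open>h\<close> and \<open>rot h\<close>;
  faces are represented by their sets of corners. The map with one vertex and no edge
  is not represented.
\<close>

type_synonym 'e half_edge = "'e \<times> bool"

record 'e oriented_map =
  edges :: "'e set"
  rot :: "'e half_edge \<Rightarrow> 'e half_edge"
  outer :: "'e half_edge set"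

definition half_edges :: "'e oriented_map \<Rightarrow> 'e half_edge set" where
  "half_edges M = edges M \<times> UNIV"

definition opposite :: "'e half_edge \<Rightarrow> 'e half_edge" where
  "opposite h = (fst h, \<not> snd h)"

definition vertex_of :: "'e oriented_map \<Rightarrow> 'e half_edge \<Rightarrow> 'e half_edge set" where
  "vertex_of M h = orbit (rot M) h"

definition vertices :: "'e oriented_map \<Rightarrow> 'e half_edge set set" where
  "vertices M = vertex_of M ` half_edges M"

text \<open>
  The corner of \<open>h\<close> lies to the right of \<open>h\<close> when leaving the vertex along \<open>h\<close>.
  Following \<open>h\<close> with the face on the right, the next corner is the one that precedes
  \<open>opposite h\<close> in clockwise order. Thus \<open>face_step\<close> turns clockwise around a point
  inside an inner face.
\<close>

definition face_step :: "'e oriented_map \<Rightarrow> 'e half_edge \<Rightarrow> 'e half_edge" where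
  "face_step M h = inv (rot M) (opposite h)"

definition face_of :: "'e oriented_map \<Rightarrow> 'e half_edge \<Rightarrow> 'e half_edge set" where
  "face_of M h = orbit (face_step M) h"

definition faces :: "'e oriented_map \<Rightarrow> 'e half_edge set set" where
  "faces M = face_of M ` half_edges M"

definition inner_faces :: "'e oriented_map \<Rightarrow> 'e half_edge set set" where
  "inner_faces M = faces M - {outer M}"

definition edge_origin :: "'e oriented_map \<Rightarrow> 'e \<Rightarrow> 'e half_edge set" where
  "edge_origin M e = vertex_of M (e, True)"

definition edge_end :: "'e oriented_map \<Rightarrow> 'e \<Rightarrow> 'e half_edge set" where
  "edge_end M e = vertex_of M (e, False)"

definition arcs :: "'e oriented_map \<Rightarrow> ('e half_edge set \<times> 'e half_edge set) set" where
  "arcs M = {(edge_origin M e, edge_end M e) | e. e \<in> edges M}"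

definition connected_map :: "'e oriented_map \<Rightarrow> bool" where
  "connected_map M \<longleftrightarrow>
     (\<forall>u \<in> vertices M. \<forall>v \<in> vertices M. (u, v) \<in> (arcs M \<union> (arcs M)\<inverse>)\<^sup>*)"

text \<open>A connected map has genus 0 iff Euler's relation holds.\<close>

definition planar_map :: "'e oriented_map \<Rightarrow> bool" where
  "planar_map M \<longleftrightarrow>
     finite (edges M) \<and> edges M \<noteq> {} \<and> rot M permutes half_edges M \<and> connected_map M \<and>
     card (vertices M) + card (faces M) = card (edges M) + 2 \<and> outer M \<in> faces M"

text \<open>
  Equality up to continuous deformation: bijections of the edges that preserve the
  orientations, the clockwise orders and the outer face. Requiring \<open>planar_map\<close> also excludes
  encodings in which \<open>rot\<close> has arbitrary values outside the half-edges.
\<close>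

definition map_iso :: "'e oriented_map \<Rightarrow> 'f oriented_map \<Rightarrow> bool" where
  "map_iso M N \<longleftrightarrow>
     planar_map M \<and> planar_map N \<and>
     (\<exists>g. bij_betw g (edges M) (edges N) \<and>
          (\<forall>h \<in> half_edges M. rot N (map_prod g id h) = map_prod g id (rot M h)) \<and>
          outer N = map_prod g id ` outer M)"

definition is_source :: "'e oriented_map \<Rightarrow> 'e half_edge set \<Rightarrow> bool" where
  "is_source M v \<longleftrightarrow> v \<in> vertices M \<and> (\<forall>h \<in> v. snd h)"

definition is_sink :: "'e oriented_map \<Rightarrow> 'e half_edge set \<Rightarrow> bool" where
  "is_sink M v \<longleftrightarrow> v \<in> vertices M \<and> (\<forall>h \<in> v. \<not> snd h)"

definition source :: "'e oriented_map \<Rightarrow> 'e half_edge set" where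
  "source M = (THE s. is_source M s)"

definition sink :: "'e oriented_map \<Rightarrow> 'e half_edge set" where
  "sink M = (THE t. is_sink M t)"

definition bipolar_orientation :: "'e oriented_map \<Rightarrow> bool" where
  "bipolar_orientation M \<longleftrightarrow>
     planar_map M \<and> acyclic (arcs M) \<and> (\<exists>!s. is_source M s) \<and> (\<exists>!t. is_sink M t)"

definition outer_vertex :: "'e oriented_map \<Rightarrow> 'e half_edge set \<Rightarrow> bool" where
  "outer_vertex M v \<longleftrightarrow> v \<in> vertices M \<and> v \<inter> outer M \<noteq> {}"

definition plane_bipolar_orientation :: "'e oriented_map \<Rightarrow> bool" where
  "plane_bipolar_orientation M \<longleftrightarrow>
     bipolar_orientation M \<and> outer_vertex M (source M) \<and> outer_vertex M (sink M)"

definition nonspecial_vertices :: "'e oriented_map \<Rightarrow> 'e half_edge set set" where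
  "nonspecial_vertices M = vertices M - {source M, sink M}"

definition left_lateral_corner :: "'e oriented_map \<Rightarrow> 'e half_edge set \<Rightarrow> 'e half_edge" where
  "left_lateral_corner M v = (THE h. h \<in> v \<and> \<not> snd h \<and> snd (rot M h))"

definition right_lateral_corner :: "'e oriented_map \<Rightarrow> 'e half_edge set \<Rightarrow> 'e half_edge" where
  "right_lateral_corner M v = (THE h. h \<in> v \<and> snd h \<and> \<not> snd (rot M h))"

text \<open>The following four notions are meant for inner faces \<open>f\<close>.\<close>

definition left_lateral_path :: "'e oriented_map \<Rightarrow> 'e half_edge set \<Rightarrow> 'e set" where
  "left_lateral_path M f = {e \<in> edges M. (e, True) \<in> f}"

definition right_lateral_path :: "'e oriented_map \<Rightarrow> 'e half_edge set \<Rightarrow> 'e set" where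
  "right_lateral_path M f = {e \<in> edges M. (e, False) \<in> f}"

text \<open>
  A clockwise turn around \<open>f\<close> goes up its left lateral path and then down its right lateral
  path: the last edge of the former is the one where the direction switches, and similarly
  for the first edge of the latter.
\<close>

definition topleft_edge :: "'e oriented_map \<Rightarrow> 'e half_edge set \<Rightarrow> 'e" where
  "topleft_edge M f =
     (THE e. e \<in> left_lateral_path M f \<and> \<not> snd (face_step M (e, True)))"

definition bottomright_edge :: "'e oriented_map \<Rightarrow> 'e half_edge set \<Rightarrow> 'e" where
  "bottomright_edge M f =
     (THE e. e \<in> right_lateral_path M f \<and> snd (face_step M (e, False)))"

definition transitive_edge :: "'e oriented_map \<Rightarrow> 'e \<Rightarrow> bool" where
  "transitive_edge M e \<longleftrightarrow> (\<exists>k \<ge> 2. (edge_origin M e, edge_end M e) \<in> arcs M ^^ k)"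

definition plane_bipolar_poset :: "'e oriented_map \<Rightarrow> bool" where
  "plane_bipolar_poset M \<longleftrightarrow>
     plane_bipolar_orientation M \<and> card (vertices M) \<ge> 3 \<and>
     inj_on (\<lambda>e. {edge_origin M e, edge_end M e}) (edges M) \<and>
     (\<forall>e \<in> edges M. \<not> transitive_edge M e)"

text \<open>
  In a plane bipolar poset, the edge \<open>e2\<close> of an N-pattern can neither start at the source nor
  end at the sink (it would be a transitive edge), so it does not matter that \<open>rot\<close> also links the two extreme edges at a special vertex.
\<close>

definition N_pattern :: "'e oriented_map \<Rightarrow> 'e \<times> 'e \<times> 'e \<Rightarrow> bool" where
  "N_pattern M = (\<lambda>(e1, e2, e3). {e1, e2, e3} \<subseteq> edges M \<and>
     edge_origin M e1 = edge_origin M e2 \<and> edge_end M e2 = edge_end M e3 \<and>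
     rot M (e2, True) = (e1, True) \<and> rot M (e2, False) = (e3, False))"

definition N_avoiding :: "'e oriented_map \<Rightarrow> bool" where
  "N_avoiding M \<longleftrightarrow> (\<nexists>p. N_pattern M p)"

text \<open>
  \<open>closure_map M\<close> is obtained by adding two edges \<open>Ell\<close> (on the left) and \<open>Arr\<close> (on the right)
  from the source to the sink, drawn in the outer face and enclosing the whole map. The
  two special faces of \<open>M\<close> thereby become the inner faces on the right of \<open>Ell\<close> and on the left
  of \<open>Arr\<close>. Both edges leave from the corner of the source in the outer face (it is unique,
  and so is the one of the sink), where the clockwise order is: last old edge, \<open>Arr\<close>, \<open>Ell\<close>,
  first old edge; at the sink it is: last old edge, \<open>Ell\<close>, \<open>Arr\<close>, first old edge.
\<close>

datatype 'e closure_edge = Old 'e | Ell | Arr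

definition old :: "'e half_edge \<Rightarrow> 'e closure_edge half_edge" where
  "old = map_prod Old id"

definition source_corner :: "'e oriented_map \<Rightarrow> 'e half_edge" where
  "source_corner M = (THE h. h \<in> source M \<inter> outer M)"

definition sink_corner :: "'e oriented_map \<Rightarrow> 'e half_edge" where
  "sink_corner M = (THE h. h \<in> sink M \<inter> outer M)"

definition closure_rot ::
    "'e oriented_map \<Rightarrow> 'e closure_edge half_edge \<Rightarrow> 'e closure_edge half_edge" where
  "closure_rot M h = (case h of
      (Old e, b) \<Rightarrow>
        if (e, b) = source_corner M then (Arr, True)
        else if (e, b) = sink_corner M then (Ell, False)
        else old (rot M (e, b))
    | (Arr, b) \<Rightarrow> if b then (Ell, True) else old (rot M (sink_corner M))
    | (Ell, b) \<Rightarrow> if b then old (rot M (source_corner M)) else (Arr, False))"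

definition closure_map :: "'e oriented_map \<Rightarrow> 'e closure_edge oriented_map" where
  "closure_map M =
     \<lparr>edges = Old ` edges M \<union> {Ell, Arr}, rot = closure_rot M,
      outer = {(Ell, False), (Arr, True)}\<rparr>"

text \<open>
  The vertex of \<open>phi M\<close> in the middle of an edge \<open>a\<close> of \<open>closure_map M\<close> is represented by \<open>a\<close>,
  and the edges of \<open>phi M\<close> by the pairs (origin, end). This loses nothing: an edge from
  \<open>a\<close> to \<open>b\<close> is drawn in the face on the right of \<open>a\<close>, which is the face on the left of \<open>b\<close>.
\<close>

definition phi_edges :: "'e oriented_map \<Rightarrow> ('e closure_edge \<times> 'e closure_edge) set" where
  "phi_edges M = (let C = closure_map M in
     \<Union>f \<in> inner_faces C.
       {(a, bottomright_edge C f) | a. a \<in> left_lateral_path C f} \<union>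
       {(topleft_edge C f, b) | b. b \<in> right_lateral_path C f})"

text \<open>
  Clockwise around the midpoint of \<open>a\<close>, starting upwards, one sees the outgoing edges
  (drawn in the face on the right of \<open>a\<close>) and then the ingoing edges (drawn in the face on the
  left of \<open>a\<close>). If \<open>a\<close> is the topleft edge of the face on its right, then its outgoing edges
  lead to the right lateral path, from top to bottom; otherwise its only outgoing edge leads to
  the bottomright edge. If \<open>b\<close> is the bottomright edge of the face on its left, then its ingoing
  edges come from the left lateral path, from bottom to top; otherwise its only
  ingoing edge comes from the topleft edge. In both cases several edges are
  listed in the order given by \<open>face_step\<close>.
\<close>

definition first_outgoing ::
    "'e oriented_map \<Rightarrow> 'e \<Rightarrow> ('e \<times> 'e) half_edge" where
  "first_outgoing C a = (let f = face_of C (a, True) in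
     ((a, if a = topleft_edge C f then fst (face_step C (a, True)) else bottomright_edge C f), True))"

definition first_ingoing ::
    "'e oriented_map \<Rightarrow> 'e \<Rightarrow> ('e \<times> 'e) half_edge" where
  "first_ingoing C b = (let f = face_of C (b, False) in
     ((if b = bottomright_edge C f then fst (face_step C (b, False)) else topleft_edge C f, b), False))"

definition phi_rot ::
    "'e oriented_map \<Rightarrow> ('e closure_edge \<times> 'e closure_edge) half_edge
       \<Rightarrow> ('e closure_edge \<times> 'e closure_edge) half_edge" where
  "phi_rot M h = (let C = closure_map M; ((a, b), out) = h; f = face_of C (a, True) in
     if (a, b) \<notin> phi_edges M then h
     else if out then
       (if b \<noteq> bottomright_edge C f then ((a, fst (face_step C (b, False))), True)
        else if a = Ell then first_outgoing C a
        else first_ingoing C a)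
     else
       (if a \<noteq> topleft_edge C f then ((fst (face_step C (a, True)), b), False)
        else if b = Arr then first_ingoing C b
        else first_outgoing C b))"

text \<open>
  The source of \<open>phi M\<close> is on \<open>Ell\<close>, and its corner in the outer face is the one that follows
  its last outgoing edge.
\<close>

definition phi :: "'e oriented_map \<Rightarrow> ('e closure_edge \<times> 'e closure_edge) oriented_map" where
  "phi M = (let
      C = closure_map M;
      P = \<lparr>edges = phi_edges M, rot = phi_rot M, outer = {}\<rparr>
    in P\<lparr>outer := face_of P ((Ell, bottomright_edge C (face_of C (Ell, True))), True)\<rparr>)"

text \<open>
  The faces of \<open>P\<close>, with the outer face split into the two special faces, are the inner faces of
  \<open>closure_map P\<close>. The edge of \<open>psi P\<close> through a non-special vertex \<open>v\<close> is represented by \<open>v\<close>. Its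
  half-edge \<open>(v, True)\<close> enters the face in the right lateral corner of \<open>v\<close>, and
  \<open>(v, False)\<close> in the left lateral corner. Hence the clockwise order around the vertex of \<open>psi P\<close>
  in a face is the clockwise order of the lateral corners in that face.
\<close>

definition lateral_corner :: "'e oriented_map \<Rightarrow> 'e half_edge set half_edge \<Rightarrow> 'e half_edge" where
  "lateral_corner P = (\<lambda>(v, b). if b then right_lateral_corner P v else left_lateral_corner P v)"

definition lateral_corners :: "'e oriented_map \<Rightarrow> 'e half_edge set" where
  "lateral_corners P = lateral_corner P ` (nonspecial_vertices P \<times> UNIV)"

text \<open>Inverse of \<open>old \<circ> lateral_corner P\<close> on lateral corners of non-special vertices.\<close>

definition psi_half_edge ::
    "'e oriented_map \<Rightarrow> 'e closure_edge half_edge \<Rightarrow> 'e half_edge set half_edge" where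
  "psi_half_edge P c =
     (THE x. x \<in> nonspecial_vertices P \<times> UNIV \<and> old (lateral_corner P x) = c)"

definition first_hit :: "('a \<Rightarrow> 'a) \<Rightarrow> 'a set \<Rightarrow> 'a \<Rightarrow> 'a" where
  "first_hit f A x = (f ^^ (LEAST k. k > 0 \<and> (f ^^ k) x \<in> A)) x"

definition psi_rot ::
    "'e oriented_map \<Rightarrow> 'e half_edge set half_edge \<Rightarrow> 'e half_edge set half_edge" where
  "psi_rot P x =
     (if fst x \<in> nonspecial_vertices P
      then psi_half_edge P (first_hit (face_step (closure_map P)) (old ` lateral_corners P)
             (old (lateral_corner P x)))
      else x)"

text \<open>
  The vertex \<open>t\<close> of \<open>psi P\<close> lies in the left special face, on the right of \<open>Ell\<close>, and
  \<open>psi P\<close> does not cross \<open>Ell\<close>. So the corner of \<open>t\<close> that faces \<open>Ell\<close> belongs to the outer face.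
  It follows the last half-edge before \<open>Ell\<close> in clockwise order around \<open>t\<close>.
\<close>

definition psi :: "'e oriented_map \<Rightarrow> 'e half_edge set oriented_map" where
  "psi P = (let
      Q = \<lparr>edges = nonspecial_vertices P, rot = psi_rot P, outer = {}\<rparr>;
      c = first_hit (inv (face_step (closure_map P))) (old ` lateral_corners P) (Ell, True)
    in Q\<lparr>outer := face_of Q (psi_half_edge P c)\<rparr>)"

text \<open>
  Maps are considered up to deformation. Every finite map is isomorphic to one whose edges are
  natural numbers, so the classes of such maps stand for all maps.
\<close>

type_synonym map_class = "nat oriented_map set"

definition iso_rel :: "(nat oriented_map \<times> nat oriented_map) set" where
  "iso_rel = {(M, N). map_iso M N}"

definition bipolar_orientation_classes :: "nat \<Rightarrow> nat \<Rightarrow> map_class set" where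
  "bipolar_orientation_classes n i =
     {M. plane_bipolar_orientation M \<and> card (edges M) = n \<and>
         card (nonspecial_vertices M) = i} // iso_rel"

definition N_avoiding_poset_classes :: "nat \<Rightarrow> nat \<Rightarrow> map_class set" where
  "N_avoiding_poset_classes n i =
     {P. plane_bipolar_poset P \<and> N_avoiding P \<and> card (nonspecial_vertices P) = n \<and>
         card (inner_faces P) = i} // iso_rel"

definition phi_class :: "map_class \<Rightarrow> map_class" where
  "phi_class X = {P. \<exists>M \<in> X. map_iso (phi M) P}"

definition psi_class :: "map_class \<Rightarrow> map_class" where
  "psi_class Y = {M. \<exists>P \<in> Y. map_iso (psi P) M}"

end

theory Submission
  imports Defs
begin

text \<open>
  Let \<open>C\<close> be the closure of a plane bipolar orientation \<open>M\<close>. Every non-special vertex has a corner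
  where the directions switch from ingoing to outgoing and one where they switch back, and every
  face has a source and a sink. Counting half-edges, Euler's relation says exactly that there are
  no further switches. Hence planarity of an acyclic orientation with one source and one sink is a
  local condition, which can be checked for \<open>phi M\<close> and \<open>psi P\<close> without counting faces.

  The dual orientation of \<open>C\<close> (from left to right) is acyclic. An arc \<open>(a, b)\<close> of \<open>phi M\<close> crosses
  the face on the right of \<open>a\<close> and on the left of \<open>b\<close>, so ranking edges by their left face makes
  \<open>phi M\<close> acyclic, and shows that it has no transitive edge: all arcs from \<open>a\<close> increase the rank by
  the same amount.

  The half-edges of \<open>M\<close> correspond to the lateral corners of \<open>phi M\<close>, and those of \<open>psi P\<close> to the
  lateral corners of \<open>P\<close>. In an N-avoiding poset every edge is next to a lateral corner at one of
  its ends, so that the poset and its dual map \<open>M\<close> determine each other through this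
  correspondence.
\<close>

section \<open>Rotation systems and bipolar orientations\<close>

definition fin_perm :: "('a \<Rightarrow> 'a) \<Rightarrow> 'a set \<Rightarrow> bool" where
  "fin_perm f S \<longleftrightarrow> finite S \<and> inj_on f S \<and> f ` S \<subseteq> S"

lemma fin_perm_surj: "fin_perm f S \<Longrightarrow> f ` S = S"
  unfolding fin_perm_def by (simp add: endo_inj_surj)

lemma fin_perm_in: "fin_perm f S \<Longrightarrow> x \<in> S \<Longrightarrow> f x \<in> S"
  unfolding fin_perm_def by blast

lemma fin_perm_orbit_subset: "fin_perm f S \<Longrightarrow> x \<in> S \<Longrightarrow> orbit f x \<subseteq> S"
proof
  fix y assume "fin_perm f S" "x \<in> S" "y \<in> orbit f x"
  from this(3) show "y \<in> S"
    by induct (use \<open>fin_perm f S\<close> \<open>x \<in> S\<close> fin_perm_in in fast)+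
qed

lemma fin_perm_self_in_orbit: assumes "fin_perm f S" "x \<in> S" shows "x \<in> orbit f x"
proof -
  let ?g = "restrict_id f S"
  have "bij_betw f S S" using assms(1) fin_perm_surj unfolding fin_perm_def bij_betw_def by blast
  then have "?g permutes S" by (rule permutes_restrict_id)
  then have "permutation ?g" using assms(1) unfolding fin_perm_def by (meson permutes_imp_permutation)
  then have "x \<in> orbit ?g x" by (rule permutation_self_in_orbit)
  moreover have "orbit f x = orbit ?g x"
    by (rule orbit_cong0[where A = S]) (use assms fin_perm_in in \<open>auto simp: restrict_id_def\<close>)
  ultimately show ?thesis by simp
qed

lemma fin_perm_orbit_eq: assumes "fin_perm f S" "x \<in> S" "y \<in> orbit f x" shows "orbit f y = orbit f x"
proof -
  have "y \<in> S" using assms fin_perm_orbit_subset by fast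
  then have "x \<in> orbit f y" using assms fin_perm_self_in_orbit orbit_swap by metis
  then show ?thesis using assms(3) by (blast intro: orbit_trans)
qed

lemma fin_perm_orbit_step: "fin_perm f S \<Longrightarrow> x \<in> S \<Longrightarrow> orbit f (f x) = orbit f x"
  by (meson fin_perm_orbit_eq orbit.base)

lemma fin_perm_orbit_induct:
  assumes "fin_perm f S" "x \<in> S" "y \<in> orbit f x" "Q x"
    and "\<And>z. z \<in> orbit f x \<Longrightarrow> Q z \<Longrightarrow> Q (f z)"
  shows "Q y"
  using assms(3)
  by induct (use assms fin_perm_self_in_orbit in fast)+

lemma fin_perm_orbit_back_induct:
  assumes "fin_perm f S" "x \<in> S" "y \<in> orbit f x" "Q x"
    and "\<And>z. z \<in> orbit f x \<Longrightarrow> Q (f z) \<Longrightarrow> Q z"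
  shows "Q y"
proof (rule ccontr)
  assume nQ: "\<not> Q y"
  have y: "y \<in> S" "orbit f y = orbit f x"
    using assms fin_perm_orbit_subset fin_perm_orbit_eq by fast+
  have "\<not> Q x"
    by (rule fin_perm_orbit_induct[where x = y and Q = "\<lambda>z. \<not> Q z", OF assms(1) y(1) _ nQ])
      (use assms y fin_perm_self_in_orbit in auto)
  with assms(4) show False by simp
qed

lemma fin_perm_orbit_const:
  assumes "fin_perm f S" "x \<in> S" "y \<in> orbit f x"
    and "\<And>z. z \<in> S \<Longrightarrow> F (f z) = F z"
  shows "F y = F x"
  by (rule fin_perm_orbit_induct[where Q = "\<lambda>z. F z = F x", OF assms(1-3)])
    (use assms(1,2,4) fin_perm_orbit_subset in fastforce)+

lemma fin_perm_switch:
  assumes "fin_perm f S" "x \<in> S" "y \<in> orbit f x" "Q x" "\<not> Q y"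
  obtains z where "z \<in> orbit f x" "Q z" "\<not> Q (f z)"
  using fin_perm_orbit_induct[where Q = Q, OF assms(1-4)] assms(5) by blast

lemma relpow_map_prod:
  assumes "inj_on f A" "r \<subseteq> A \<times> A" "x \<in> A" "(f x, v) \<in> (map_prod f f ` r) ^^ n"
  shows "\<exists>y \<in> A. v = f y \<and> (x, y) \<in> r ^^ n"
  using assms(4)
proof (induction n arbitrary: v)
  case 0
  then show ?case using assms(3) by auto
next
  case (Suc n)
  then obtain w where w: "(f x, w) \<in> (map_prod f f ` r) ^^ n" "(w, v) \<in> map_prod f f ` r" by auto
  obtain y where y: "y \<in> A" "w = f y" "(x, y) \<in> r ^^ n" using Suc.IH[OF w(1)] by blast
  obtain c d where cd: "(c, d) \<in> r" "w = f c" "v = f d" using w(2) by auto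
  have "c = y" using inj_onD[OF assms(1), of c y] cd y assms(2) by auto
  then show ?case using cd y assms(2) by (auto intro!: bexI[of _ d])
qed

lemma acyclic_map_prod:
  assumes "inj_on f A" "r \<subseteq> A \<times> A" "acyclic r"
  shows "acyclic (map_prod f f ` r)"
proof (rule acyclicI, intro allI notI)
  fix u assume "(u, u) \<in> (map_prod f f ` r)\<^sup>+"
  then obtain n where n: "n > 0" "(u, u) \<in> (map_prod f f ` r) ^^ n" by (auto simp: trancl_power)
  obtain w where "(u, w) \<in> map_prod f f ` r"
    using \<open>(u, u) \<in> (map_prod f f ` r)\<^sup>+\<close> by (meson converse_tranclE)
  then obtain x where x: "x \<in> A" "u = f x" using assms(2) by auto
  then obtain y where "y \<in> A" "f x = f y" "(x, y) \<in> r ^^ n" using relpow_map_prod[OF assms(1,2)] n by metis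
  then have "(x, x) \<in> r\<^sup>+" using inj_onD[OF assms(1)] x n(1) by (auto simp: trancl_power)
  with assms(3) show False by (simp add: acyclic_def)
qed

lemma opposite_simps [simp]:
  "opposite (e, b) = (e, \<not> b)" "opposite (opposite h) = h" "fst (opposite h) = fst h"
  "snd (opposite h) = (\<not> snd h)"
  by (auto simp: opposite_def)

lemma half_edges_iff [simp]: "h \<in> half_edges M \<longleftrightarrow> fst h \<in> edges M"
  by (cases h) (auto simp: half_edges_def)

definition lateral :: "'e oriented_map \<Rightarrow> 'e half_edge \<Rightarrow> bool" where
  "lateral M h \<longleftrightarrow> snd (rot M h) \<noteq> snd h"

definition precedes :: "'e oriented_map \<Rightarrow> ('e \<times> 'e) set" where
  "precedes M = {(e, e'). e \<in> edges M \<and> e' \<in> edges M \<and> edge_end M e = edge_origin M e'}"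

locale rot_map =
  fixes M :: "'e oriented_map"
  assumes finite_edges: "finite (edges M)"
    and rot_permutes: "rot M permutes half_edges M"
begin

lemma finite_half_edges: "finite (half_edges M)"
  using finite_edges by (simp add: half_edges_def)

lemma rot_in_iff [simp]: "fst (rot M h) \<in> edges M \<longleftrightarrow> fst h \<in> edges M"
  using permutes_in_image[OF rot_permutes, of h] by simp

lemma rot_inj: "rot M h = rot M h' \<longleftrightarrow> h = h'"
  using permutes_inj[OF rot_permutes] by (auto dest: injD)

lemma step_eq_iff: "face_step M h = g \<longleftrightarrow> rot M g = opposite h"
  unfolding face_step_def by (metis permutes_inverses rot_permutes)

lemma rot_step: "rot M (face_step M h) = opposite h"
  using step_eq_iff by blast

lemma step_opposite_rot: "face_step M (opposite (rot M h)) = h"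
  by (simp add: step_eq_iff)

lemma step_inj: "face_step M h = face_step M h' \<longleftrightarrow> h = h'"
  by (metis opposite_simps(2) rot_step)

lemma step_in_iff [simp]: "fst (face_step M h) \<in> edges M \<longleftrightarrow> fst h \<in> edges M"
  using rot_in_iff[of "face_step M h"] by (simp add: rot_step)

lemma fin_perm_rot: "fin_perm (rot M) (half_edges M)"
  unfolding fin_perm_def using finite_half_edges by (auto simp: inj_on_def rot_inj)

lemma fin_perm_step: "fin_perm (face_step M) (half_edges M)"
  unfolding fin_perm_def using finite_half_edges by (auto simp: inj_on_def step_inj)

lemma vertex_self: "fst h \<in> edges M \<Longrightarrow> h \<in> vertex_of M h"
  unfolding vertex_of_def using fin_perm_self_in_orbit[OF fin_perm_rot] by simp

lemma face_self: "fst h \<in> edges M \<Longrightarrow> h \<in> face_of M h"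
  unfolding face_of_def using fin_perm_self_in_orbit[OF fin_perm_step] by simp

lemma vertex_in: "fst h \<in> edges M \<Longrightarrow> g \<in> vertex_of M h \<Longrightarrow> fst g \<in> edges M"
  unfolding vertex_of_def using fin_perm_orbit_subset[OF fin_perm_rot, of h] by auto

lemma face_in: "fst h \<in> edges M \<Longrightarrow> g \<in> face_of M h \<Longrightarrow> fst g \<in> edges M"
  unfolding face_of_def using fin_perm_orbit_subset[OF fin_perm_step, of h] by auto

lemma vertex_eq: "fst h \<in> edges M \<Longrightarrow> g \<in> vertex_of M h \<Longrightarrow> vertex_of M g = vertex_of M h"
  unfolding vertex_of_def using fin_perm_orbit_eq[OF fin_perm_rot, of h] by auto

lemma face_eq: "fst h \<in> edges M \<Longrightarrow> g \<in> face_of M h \<Longrightarrow> face_of M g = face_of M h"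
  unfolding face_of_def using fin_perm_orbit_eq[OF fin_perm_step, of h] by auto

lemma vertex_rot: "fst h \<in> edges M \<Longrightarrow> vertex_of M (rot M h) = vertex_of M h"
  unfolding vertex_of_def using fin_perm_orbit_step[OF fin_perm_rot, of h] by auto

lemma face_step_eq: "fst h \<in> edges M \<Longrightarrow> face_of M (face_step M h) = face_of M h"
  unfolding face_of_def using fin_perm_orbit_step[OF fin_perm_step, of h] by auto

lemma face_opposite_rot: "fst h \<in> edges M \<Longrightarrow> face_of M (opposite (rot M h)) = face_of M h"
  using face_step_eq[of "opposite (rot M h)"] by (simp add: step_opposite_rot)

lemma vertex_iff: "fst h \<in> edges M \<Longrightarrow> fst g \<in> edges M \<Longrightarrow>
    g \<in> vertex_of M h \<longleftrightarrow> vertex_of M g = vertex_of M h"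
  using vertex_eq vertex_self by metis

lemma face_iff: "fst h \<in> edges M \<Longrightarrow> fst g \<in> edges M \<Longrightarrow>
    g \<in> face_of M h \<longleftrightarrow> face_of M g = face_of M h"
  using face_eq face_self by metis

lemma vertices_iff: "v \<in> vertices M \<longleftrightarrow> (\<exists>h. fst h \<in> edges M \<and> v = vertex_of M h)"
  unfolding vertices_def by auto

lemma faces_iff: "f \<in> faces M \<longleftrightarrow> (\<exists>h. fst h \<in> edges M \<and> f = face_of M h)"
  unfolding faces_def by auto

lemma vertex_mem: "v \<in> vertices M \<Longrightarrow> h \<in> v \<Longrightarrow> fst h \<in> edges M \<and> v = vertex_of M h"
  unfolding vertices_iff using vertex_in vertex_eq by blast

lemma face_mem: "f \<in> faces M \<Longrightarrow> h \<in> f \<Longrightarrow> fst h \<in> edges M \<and> f = face_of M h"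
  unfolding faces_iff using face_in face_eq by blast

lemma arcs_iff: "(u, v) \<in> arcs M \<longleftrightarrow> (\<exists>e \<in> edges M. u = vertex_of M (e, True) \<and> v = vertex_of M (e, False))"
  unfolding arcs_def edge_origin_def edge_end_def by auto

lemma finite_vertices: "finite (vertices M)" and finite_faces: "finite (faces M)"
  using finite_half_edges by (simp_all add: vertices_def faces_def)

lemma finite_arcs: "finite (arcs M)"
  unfolding arcs_def using finite_edges by simp

lemma N_avoiding_iff:
  "N_avoiding M \<longleftrightarrow> (\<forall>e \<in> edges M. lateral M (e, True) \<or> lateral M (e, False))"
proof
  assume av: "N_avoiding M"
  show "\<forall>e \<in> edges M. lateral M (e, True) \<or> lateral M (e, False)"
  proof (rule ccontr)
    assume "\<not> ?thesis"
    then obtain e where e: "e \<in> edges M" "\<not> lateral M (e, True)" "\<not> lateral M (e, False)" by blast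
    obtain e1 e3 where r: "rot M (e, True) = (e1, True)" "rot M (e, False) = (e3, False)"
      using e by (cases "rot M (e, True)"; cases "rot M (e, False)") (auto simp: lateral_def)
    have "e1 \<in> edges M" "e3 \<in> edges M"
      using rot_in_iff[of "(e, True)"] rot_in_iff[of "(e, False)"] r e by (simp_all del: rot_in_iff)
    then have "N_pattern M (e1, e, e3)"
      using r e vertex_rot[of "(e, True)"] vertex_rot[of "(e, False)"]
      by (simp add: N_pattern_def edge_origin_def edge_end_def)
    with av show False unfolding N_avoiding_def by blast
  qed
next
  assume "\<forall>e \<in> edges M. lateral M (e, True) \<or> lateral M (e, False)"
  then show "N_avoiding M" by (force simp: N_avoiding_def N_pattern_def lateral_def)
qed

lemma precedes_step_up:
  "fst h \<in> edges M \<Longrightarrow> snd h \<Longrightarrow> snd (face_step M h) \<Longrightarrow> (fst h, fst (face_step M h)) \<in> precedes M"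
  using rot_step[of h] vertex_rot[of "face_step M h"] step_in_iff[of h]
  by (cases h; cases "face_step M h")
    (auto simp: precedes_def edge_origin_def edge_end_def simp del: step_in_iff)

lemma precedes_step_down:
  "fst h \<in> edges M \<Longrightarrow> \<not> snd h \<Longrightarrow> \<not> snd (face_step M h) \<Longrightarrow> (fst (face_step M h), fst h) \<in> precedes M"
  using rot_step[of h] vertex_rot[of "face_step M h"] step_in_iff[of h]
  by (cases h; cases "face_step M h")
    (auto simp: precedes_def edge_origin_def edge_end_def simp del: step_in_iff)

lemma acyclic_precedes: assumes "acyclic (arcs M)" shows "acyclic (precedes M)"
proof -
  have "(e, e') \<in> (precedes M)\<^sup>+ \<Longrightarrow> (edge_origin M e, edge_origin M e') \<in> (arcs M)\<^sup>+" for e e'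
  proof (induct rule: trancl_induct)
    case (base y)
    then show ?case by (auto simp: precedes_def arcs_def intro!: r_into_trancl exI[of _ e])
  next
    case (step y z)
    then have "(edge_origin M y, edge_origin M z) \<in> arcs M" by (auto simp: precedes_def arcs_def)
    with step(3) show ?case by (rule trancl_into_trancl)
  qed
  with assms show ?thesis unfolding acyclic_def by blast
qed

lemma finite_precedes: "finite (precedes M)"
  by (rule finite_subset[of _ "edges M \<times> edges M"]) (auto simp: precedes_def finite_edges)

lemma wf_precedes: "acyclic (arcs M) \<Longrightarrow> wf (precedes M)"
  by (intro finite_acyclic_wf finite_precedes acyclic_precedes)

lemma wf_precedes_converse: "acyclic (arcs M) \<Longrightarrow> wf ((precedes M)\<inverse>)"
  by (intro finite_acyclic_wf_converse finite_precedes acyclic_precedes)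

end

locale bipolar_rot = rot_map +
  assumes edges_nonempty: "edges M \<noteq> {}"
    and acyclic_arcs: "acyclic (arcs M)"
    and source_ex1: "\<exists>!s. is_source M s"
    and sink_ex1: "\<exists>!t. is_sink M t"
begin

lemma source: "is_source M (source M)" and sink: "is_sink M (sink M)"
  unfolding source_def sink_def using theI'[OF source_ex1] theI'[OF sink_ex1] by auto

lemma source_eq: "is_source M v \<Longrightarrow> v = source M" and sink_eq: "is_sink M v \<Longrightarrow> v = sink M"
  using source sink source_ex1 sink_ex1 by auto

lemma source_in: "source M \<in> vertices M" and sink_in: "sink M \<in> vertices M"
  using source sink by (auto simp: is_source_def is_sink_def)

lemma source_snd: "h \<in> source M \<Longrightarrow> snd h" and sink_snd: "h \<in> sink M \<Longrightarrow> \<not> snd h"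
  using source sink by (auto simp: is_source_def is_sink_def)

lemma source_neq_sink: "source M \<noteq> sink M"
  using source_in source_snd sink_snd vertex_self by (metis vertices_iff)

lemma nonspecial_both:
  assumes "v \<in> nonspecial_vertices M"
  shows "\<exists>h \<in> v. snd h = b"
proof (cases b)
  case True
  have "v \<in> vertices M" "\<not> is_sink M v" using assms sink_eq by (auto simp: nonspecial_vertices_def)
  with True show ?thesis by (auto simp: is_sink_def)
next
  case False
  have "v \<in> vertices M" "\<not> is_source M v" using assms source_eq by (auto simp: nonspecial_vertices_def)
  with False show ?thesis by (auto simp: is_source_def)
qed

lemma nonspecialI:
  assumes "h \<in> v" "v \<in> vertices M" "g \<in> v" "snd h" "\<not> snd g"
  shows "v \<in> nonspecial_vertices M"
  using assms source_snd[of g] sink_snd[of h] by (auto simp: nonspecial_vertices_def)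

lemma face_not_const:
  assumes "fst h \<in> edges M"
  shows "\<exists>g \<in> face_of M h. snd g = b"
proof (rule ccontr)
  assume neg: "\<not> ?thesis"
  then have all: "\<And>g. g \<in> face_of M h \<Longrightarrow> snd g = (\<not> b)" by blast
  let ?A = "fst ` face_of M h"
  have "fst h \<in> ?A" using face_self[OF assms] by blast
  then obtain e where e: "e \<in> ?A" and min: "\<And>y. (y, e) \<in> precedes M \<Longrightarrow> y \<notin> ?A"
    using wf_precedes[OF acyclic_arcs] by (metis wfE_min)
  from e obtain g where g: "g \<in> face_of M h" "fst g = e" by blast
  have gE: "fst g \<in> edges M" using g assms face_in by blast
  show False
  proof (cases b)
    case True
    have s: "face_step M g \<in> face_of M h"
      using g by (simp add: face_of_def orbit.step)
    then have "(fst (face_step M g), e) \<in> precedes M"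
      using precedes_step_down[OF gE] all[OF g(1)] all[OF s] True g by simp
    with min s show False by blast
  next
    case False
    let ?g = "opposite (rot M g)"
    have s: "?g \<in> face_of M h"
      using face_opposite_rot[OF gE] face_eq[OF assms g(1)] gE face_self[of ?g] by simp
    have "(fst ?g, e) \<in> precedes M"
      using precedes_step_up[of ?g] all[OF g(1)] all[OF s] False g gE by (simp add: step_opposite_rot)
    with min s show False by blast
  qed
qed

definition laterals :: "bool \<Rightarrow> 'a half_edge set" where
  "laterals b = {h \<in> half_edges M. snd h = b \<and> lateral M h}"

definition extremals :: "bool \<Rightarrow> 'a half_edge set" where
  "extremals b = {h \<in> half_edges M. snd h = b \<and> \<not> lateral M h}"

lemma left_path_induct [consumes 1, case_names first step]:
  assumes "x \<in> edges M"
    and "\<And>e. e \<in> edges M \<Longrightarrow> face_of M (e, True) = face_of M (x, True) \<Longrightarrow> \<not> lateral M (e, True) \<Longrightarrow> Q e"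
    and "\<And>e e'. e \<in> edges M \<Longrightarrow> e' \<in> edges M \<Longrightarrow> face_of M (e, True) = face_of M (x, True) \<Longrightarrow>
      face_of M (e', True) = face_of M (x, True) \<Longrightarrow>
      face_step M (e, True) = (e', True) \<Longrightarrow> (e, e') \<in> precedes M \<Longrightarrow> Q e \<Longrightarrow> Q e'"
  shows "Q x"
proof -
  have "e \<in> edges M \<Longrightarrow> face_of M (e, True) = face_of M (x, True) \<Longrightarrow> Q e" for e
  proof (induction e rule: wf_induct[OF wf_precedes[OF acyclic_arcs]])
    case (1 e)
    show ?case
    proof (cases "lateral M (e, True)")
      case True
      then obtain y where y: "rot M (e, True) = (y, False)"
        by (cases "rot M (e, True)") (auto simp: lateral_def)
      have yE: "y \<in> edges M" using 1(2) rot_in_iff[of "(e, True)"] y by (simp del: rot_in_iff)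
      have st: "face_step M (y, True) = (e, True)" using y by (simp add: step_eq_iff)
      have pr: "(y, e) \<in> precedes M" using precedes_step_up[of "(y, True)"] yE st by simp
      have f: "face_of M (y, True) = face_of M (x, True)"
        using face_step_eq[of "(y, True)"] yE st 1(3) by simp
      show ?thesis using assms(3)[OF yE 1(2) f 1(3) st pr] 1(1) pr yE f by blast
    qed (use 1 assms(2) in blast)
  qed
  with assms(1) show ?thesis by blast
qed

lemma left_path_back_induct [consumes 1, case_names last step]:
  assumes "x \<in> edges M"
    and "\<And>e. e \<in> edges M \<Longrightarrow> face_of M (e, True) = face_of M (x, True) \<Longrightarrow> \<not> snd (face_step M (e, True)) \<Longrightarrow> Q e"
    and "\<And>e e'. e \<in> edges M \<Longrightarrow> e' \<in> edges M \<Longrightarrow> face_of M (e, True) = face_of M (x, True) \<Longrightarrow>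
      face_of M (e', True) = face_of M (x, True) \<Longrightarrow>
      face_step M (e, True) = (e', True) \<Longrightarrow> (e, e') \<in> precedes M \<Longrightarrow> Q e' \<Longrightarrow> Q e"
  shows "Q x"
proof -
  have "e \<in> edges M \<Longrightarrow> face_of M (e, True) = face_of M (x, True) \<Longrightarrow> Q e" for e
  proof (induction e rule: wf_induct[OF wf_precedes_converse[OF acyclic_arcs]])
    case (1 e)
    show ?case
    proof (cases "snd (face_step M (e, True))")
      case True
      then obtain y where y: "face_step M (e, True) = (y, True)"
        by (cases "face_step M (e, True)") auto
      have yE: "y \<in> edges M" using 1(2) step_in_iff[of "(e, True)"] y by (simp del: step_in_iff)
      have pr: "(e, y) \<in> precedes M" using precedes_step_up[of "(e, True)"] 1(2) y by simp
      have f: "face_of M (y, True) = face_of M (x, True)"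
        using face_step_eq[of "(e, True)"] y 1(2,3) by simp
      show ?thesis using assms(3)[OF 1(2) yE 1(3) f y pr] 1(1) pr yE f by blast
    qed (use 1 assms(2) in blast)
  qed
  with assms(1) show ?thesis by blast
qed

lemma right_path_induct [consumes 1, case_names first step]:
  assumes "x \<in> edges M"
    and "\<And>e. e \<in> edges M \<Longrightarrow> face_of M (e, False) = face_of M (x, False) \<Longrightarrow> snd (face_step M (e, False)) \<Longrightarrow> Q e"
    and "\<And>e e'. e \<in> edges M \<Longrightarrow> e' \<in> edges M \<Longrightarrow> face_of M (e, False) = face_of M (x, False) \<Longrightarrow>
      face_of M (e', False) = face_of M (x, False) \<Longrightarrow>
      face_step M (e', False) = (e, False) \<Longrightarrow> (e, e') \<in> precedes M \<Longrightarrow> Q e \<Longrightarrow> Q e'"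
  shows "Q x"
proof -
  have "e \<in> edges M \<Longrightarrow> face_of M (e, False) = face_of M (x, False) \<Longrightarrow> Q e" for e
  proof (induction e rule: wf_induct[OF wf_precedes[OF acyclic_arcs]])
    case (1 e)
    show ?case
    proof (cases "snd (face_step M (e, False))")
      case False
      then obtain y where y: "face_step M (e, False) = (y, False)"
        by (cases "face_step M (e, False)") auto
      have yE: "y \<in> edges M" using 1(2) step_in_iff[of "(e, False)"] y by (simp del: step_in_iff)
      have pr: "(y, e) \<in> precedes M" using precedes_step_down[of "(e, False)"] 1(2) y by simp
      have f: "face_of M (y, False) = face_of M (x, False)"
        using face_step_eq[of "(e, False)"] y 1(2,3) by simp
      show ?thesis using assms(3)[OF yE 1(2) f 1(3) y pr] 1(1) pr yE f by blast
    qed (use 1 assms(2) in blast)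
  qed
  with assms(1) show ?thesis by blast
qed

lemma finite_laterals: "finite (laterals b)" and finite_extremals: "finite (extremals b)"
  unfolding laterals_def extremals_def
  by (rule finite_subset[OF _ finite_half_edges]; force)+

lemma card_laterals_extremals: "card (laterals b) + card (extremals b) = card (edges M)"
proof -
  have "card (laterals b) + card (extremals b) = card (laterals b \<union> extremals b)"
    by (rule card_Un_disjoint[OF finite_laterals finite_extremals, symmetric])
      (auto simp: laterals_def extremals_def)
  also have "laterals b \<union> extremals b = edges M \<times> {b}"
    by (auto simp: laterals_def extremals_def)
  finally show ?thesis by (simp add: card_cartesian_product)
qed

lemma laterals_image: "vertex_of M ` laterals b = nonspecial_vertices M"
proof
  show "vertex_of M ` laterals b \<subseteq> nonspecial_vertices M"
  proof safe
    fix h assume "h \<in> laterals b"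
    then have h: "fst h \<in> edges M" "snd (rot M h) \<noteq> snd h" by (auto simp: laterals_def lateral_def)
    have "rot M h \<in> vertex_of M h" using vertex_rot[OF h(1)] vertex_self[of "rot M h"] h by simp
    with h vertex_self[OF h(1)] show "vertex_of M h \<in> nonspecial_vertices M"
      by (metis nonspecialI vertices_iff)
  qed
  show "nonspecial_vertices M \<subseteq> vertex_of M ` laterals b"
  proof
    fix v assume v: "v \<in> nonspecial_vertices M"
    then obtain x y where xy: "x \<in> v" "y \<in> v" "snd x = b" "snd y \<noteq> b"
      using nonspecial_both[OF v, of b] nonspecial_both[OF v, of "\<not> b"] by auto
    have vx: "v = vertex_of M x" "fst x \<in> edges M"
      using v vertex_mem[OF _ xy(1)] unfolding nonspecial_vertices_def by blast+
    then obtain z where z: "z \<in> vertex_of M x" "snd z = b" "snd (rot M z) \<noteq> b"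
      using fin_perm_switch[OF fin_perm_rot, of x y "\<lambda>h. snd h = b"] xy by (auto simp: vertex_of_def)
    have "z \<in> laterals b" using z vx vertex_in by (auto simp: laterals_def lateral_def)
    moreover have "vertex_of M z = v" using z vx vertex_eq by simp
    ultimately show "v \<in> vertex_of M ` laterals b" by blast
  qed
qed

lemma extremals_image: "face_of M ` extremals b = faces M"
proof
  show "face_of M ` extremals b \<subseteq> faces M" by (auto simp: extremals_def faces_def)
  show "faces M \<subseteq> face_of M ` extremals b"
  proof
    fix f assume f: "f \<in> faces M"
    then obtain h where h: "fst h \<in> edges M" "f = face_of M h" using faces_iff by blast
    obtain x y where xy: "x \<in> f" "y \<in> f" "snd x \<noteq> b" "snd y = b"
      using face_not_const[OF h(1), of b] face_not_const[OF h(1), of "\<not> b"] h by auto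
    have x: "fst x \<in> edges M" "f = face_of M x" using face_mem[OF f xy(1)] by auto
    then obtain z where z: "z \<in> f" "snd z \<noteq> b" "snd (face_step M z) = b"
      using fin_perm_switch[OF fin_perm_step, of x y "\<lambda>h. snd h \<noteq> b"] xy by (auto simp: face_of_def)
    have zE: "fst z \<in> edges M" "f = face_of M z" using face_mem[OF f z(1)] by auto
    have "face_step M z \<in> extremals b"
      using z zE by (auto simp: extremals_def lateral_def rot_step)
    moreover have "face_of M (face_step M z) = f" using zE face_step_eq by simp
    ultimately show "f \<in> face_of M ` extremals b" by blast
  qed
qed

lemma card_nonspecial: "card (nonspecial_vertices M) + 2 = card (vertices M)"
proof -
  have "card (nonspecial_vertices M) = card (vertices M) - card {source M, sink M}"
    unfolding nonspecial_vertices_def by (rule card_Diff_subset) (use source_in sink_in in auto)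
  moreover have "card {source M, sink M} \<le> card (vertices M)"
    by (rule card_mono) (use finite_vertices source_in sink_in in auto)
  ultimately show ?thesis using source_neq_sink by simp
qed

lemma euler_iff:
  "card (vertices M) + card (faces M) = card (edges M) + 2 \<longleftrightarrow>
     inj_on (vertex_of M) (laterals b) \<and> inj_on (face_of M) (extremals b)"
proof -
  have "card (nonspecial_vertices M) \<le> card (laterals b)"
    using card_image_le[OF finite_laterals, of "vertex_of M" b] by (simp add: laterals_image)
  moreover have "card (faces M) \<le> card (extremals b)"
    using card_image_le[OF finite_extremals, of "face_of M" b] by (simp add: extremals_image)
  moreover have "inj_on (vertex_of M) (laterals b) \<longleftrightarrow> card (nonspecial_vertices M) = card (laterals b)"
    using finite_laterals by (simp add: inj_on_iff_eq_card laterals_image)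
  moreover have "inj_on (face_of M) (extremals b) \<longleftrightarrow> card (faces M) = card (extremals b)"
    using finite_extremals by (simp add: inj_on_iff_eq_card extremals_image)
  ultimately show ?thesis using card_laterals_extremals[of b] card_nonspecial by linarith
qed

lemma vertex_induct:
  assumes "v \<in> vertices M" and base: "Q (source M)"
    and step: "\<And>e. e \<in> edges M \<Longrightarrow> Q (edge_origin M e) \<Longrightarrow> Q (edge_end M e)"
  shows "Q v"
proof -
  have "v \<in> vertices M \<longrightarrow> Q v" for v
  proof (induction v rule: wf_induct[OF finite_acyclic_wf[OF finite_arcs acyclic_arcs]])
    case (1 v)
    show ?case
    proof
      assume v: "v \<in> vertices M"
      show "Q v"
      proof (cases "v = source M")
        case False
        then have "\<not> is_source M v" using source_eq by blast
        then obtain h where h: "h \<in> v" "\<not> snd h" using v by (auto simp: is_source_def)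
        obtain e where e: "h = (e, False)" using h by (cases h) auto
        have eE: "e \<in> edges M" "v = edge_end M e" using vertex_mem[OF v h(1)] e by (auto simp: edge_end_def)
        have "(edge_origin M e, v) \<in> arcs M" using eE by (auto simp: arcs_def)
        moreover have "edge_origin M e \<in> vertices M" using eE by (auto simp: edge_origin_def vertices_iff)
        ultimately have "Q (edge_origin M e)" using 1 by blast
        with step eE show ?thesis by blast
      qed (simp add: base)
    qed
  qed
  with assms(1) show ?thesis by blast
qed

lemma reachable_from_source: "v \<in> vertices M \<Longrightarrow> (source M, v) \<in> (arcs M)\<^sup>*"
  by (rule vertex_induct[where Q = "\<lambda>v. (source M, v) \<in> (arcs M)\<^sup>*"])
    (auto simp: arcs_def intro: rtrancl_into_rtrancl)

lemma connected: "connected_map M"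
  unfolding connected_map_def
proof (intro ballI)
  fix u v assume "u \<in> vertices M" "v \<in> vertices M"
  then have "(source M, u) \<in> (arcs M \<union> (arcs M)\<inverse>)\<^sup>*" "(source M, v) \<in> (arcs M \<union> (arcs M)\<inverse>)\<^sup>*"
    using reachable_from_source by (meson in_rtrancl_UnI)+
  moreover have "sym ((arcs M \<union> (arcs M)\<inverse>)\<^sup>*)"
    by (rule sym_rtrancl) (rule sym_Un_converse)
  ultimately show "(u, v) \<in> (arcs M \<union> (arcs M)\<inverse>)\<^sup>*"
    by (meson rtrancl_trans symD)
qed

lemma bipolar_orientationI:
  assumes "outer M \<in> faces M"
    and "\<And>h h'. \<lbrakk>h \<in> half_edges M; h' \<in> half_edges M; vertex_of M h = vertex_of M h'; \<not> snd h; \<not> snd h';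
      snd (rot M h); snd (rot M h')\<rbrakk> \<Longrightarrow> h = h'"
    and "\<And>h h'. \<lbrakk>h \<in> half_edges M; h' \<in> half_edges M; face_of M h = face_of M h'; \<not> snd h; \<not> snd h';
      \<not> snd (rot M h); \<not> snd (rot M h')\<rbrakk> \<Longrightarrow> h = h'"
  shows "bipolar_orientation M"
proof -
  have "inj_on (vertex_of M) (laterals False)" "inj_on (face_of M) (extremals False)"
    using assms(2,3) by (auto simp: inj_on_def laterals_def extremals_def lateral_def)
  with euler_iff show ?thesis
    unfolding bipolar_orientation_def planar_map_def
    using assms(1) connected finite_edges edges_nonempty rot_permutes acyclic_arcs source_ex1 sink_ex1
    by blast
qed

end

locale bipolar_map =
  fixes M :: "'e oriented_map"
  assumes bipolar: "bipolar_orientation M"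

sublocale bipolar_map \<subseteq> bipolar_rot M
  using bipolar unfolding bipolar_orientation_def planar_map_def by unfold_locales auto

context bipolar_map
begin

lemma outer_in: "outer M \<in> faces M"
  using bipolar unfolding bipolar_orientation_def planar_map_def by blast

lemma euler: "card (vertices M) + card (faces M) = card (edges M) + 2"
  using bipolar unfolding bipolar_orientation_def planar_map_def by blast

lemma lateral_unique:
  assumes "fst h \<in> edges M" "fst h' \<in> edges M" "vertex_of M h = vertex_of M h'" "snd h = snd h'"
    "lateral M h" "lateral M h'"
  shows "h = h'"
proof -
  have "inj_on (vertex_of M) (laterals (snd h))" using euler euler_iff by blast
  then show ?thesis by (rule inj_onD) (use assms in \<open>auto simp: laterals_def\<close>)
qed

lemma extremal_unique:
  assumes "fst h \<in> edges M" "fst h' \<in> edges M" "face_of M h = face_of M h'" "snd h = snd h'"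
    "\<not> lateral M h" "\<not> lateral M h'"
  shows "h = h'"
proof -
  have "inj_on (face_of M) (extremals (snd h))" using euler euler_iff by blast
  then show ?thesis by (rule inj_onD) (use assms in \<open>auto simp: extremals_def\<close>)
qed

lemma lateral_ex:
  assumes "v \<in> nonspecial_vertices M"
  obtains h where "fst h \<in> edges M" "snd h = b" "lateral M h" "v = vertex_of M h"
proof -
  have "v \<in> vertex_of M ` laterals b" using assms laterals_image by simp
  then show ?thesis using that by (auto simp: laterals_def)
qed

lemma extremal_ex:
  assumes "f \<in> faces M"
  obtains h where "fst h \<in> edges M" "snd h = b" "\<not> lateral M h" "f = face_of M h"
proof -
  have "f \<in> face_of M ` extremals b" using assms extremals_image by simp
  then show ?thesis using that by (auto simp: extremals_def)
qed

lemma lateral_nonspecial: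
  "fst h \<in> edges M \<Longrightarrow> lateral M h \<Longrightarrow> vertex_of M h \<in> nonspecial_vertices M"
  using laterals_image[of "snd h"] by (auto simp: laterals_def)

end

section \<open>The closure of a plane bipolar orientation\<close>

lemma old_simps [simp]: "old (e, b) = (Old e, b)" "fst (old h) = Old (fst h)" "snd (old h) = snd h"
  by (auto simp: old_def)

lemma old_inj [simp]: "old h = old h' \<longleftrightarrow> h = h'"
  by (cases h; cases h') (auto simp: old_def)

lemma old_neq [simp]: "old h \<noteq> (Ell, b)" "old h \<noteq> (Arr, b)" "(Ell, b) \<noteq> old h" "(Arr, b) \<noteq> old h"
  by (cases h; simp)+

lemma in_old_image [simp]:
  "old h \<in> old ` S \<longleftrightarrow> h \<in> S" "(Ell, b) \<notin> old ` S" "(Arr, b) \<notin> old ` S"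
  by (auto simp: image_iff)

lemma old_opposite: "old (opposite h) = opposite (old h)"
  by (auto simp: old_def opposite_def)

lemma closure_half_edge_cases:
  obtains h where "x = old h" | b where "x = (Ell, b)" | b where "x = (Arr, b)"
proof (cases x)
  case (Pair e b)
  then show ?thesis using that(1)[of "(case e of Old e' \<Rightarrow> e', b)"] that(2,3)
    by (cases e) auto
qed

lemma closure_half_edge_cases5:
  obtains h where "x = old h" | "x = (Ell, True)" | "x = (Ell, False)" | "x = (Arr, True)" | "x = (Arr, False)"
  using closure_half_edge_cases[of x] by (metis (full_types))

locale plane_map =
  fixes M :: "'e oriented_map"
  assumes plane_bipolar: "plane_bipolar_orientation M"

sublocale plane_map \<subseteq> bipolar_map M
  using plane_bipolar unfolding plane_bipolar_orientation_def by unfold_locales auto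

locale closed_map = bipolar_map C for C :: "'e closure_edge oriented_map" +
  assumes Ell_in [simp]: "Ell \<in> edges C" and Arr_in [simp]: "Arr \<in> edges C"
    and rot_Arr_origin: "rot C (Arr, True) = (Ell, True)"
    and rot_Ell_end: "rot C (Ell, False) = (Arr, False)"
    and outer_eq: "outer C = {(Ell, False), (Arr, True)}"
    and source_Ell: "vertex_of C (Ell, True) = source C"
    and sink_Ell: "vertex_of C (Ell, False) = sink C"
    and step_Ell_neq: "face_step C (Ell, True) \<noteq> (Arr, False)"

context plane_map
begin

abbreviation "cs \<equiv> source_corner M"
abbreviation "ct \<equiv> sink_corner M"

lemma source_corner_unique: "\<exists>!h. h \<in> source M \<inter> outer M"
proof (rule ex_ex1I)
  show "\<exists>h. h \<in> source M \<inter> outer M"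
    using plane_bipolar unfolding plane_bipolar_orientation_def outer_vertex_def by blast
next
  have ext: "fst h \<in> edges M \<and> face_of M h = outer M \<and> snd h \<and> \<not> lateral M h"
    if "h \<in> source M \<inter> outer M" for h
  proof -
    have h: "h \<in> source M" "h \<in> outer M" using that by auto
    then have hE: "fst h \<in> edges M" "source M = vertex_of M h" "outer M = face_of M h"
      using vertex_mem[OF source_in] face_mem[OF outer_in] by auto
    then have "rot M h \<in> source M" using vertex_self[of "rot M h"] vertex_rot by simp
    with h hE source_snd show ?thesis by (simp add: lateral_def)
  qed
  fix h h' assume "h \<in> source M \<inter> outer M" "h' \<in> source M \<inter> outer M"
  then show "h = h'" using ext by (intro extremal_unique) metis+
qed

lemma sink_corner_unique: "\<exists>!h. h \<in> sink M \<inter> outer M"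
proof (rule ex_ex1I)
  show "\<exists>h. h \<in> sink M \<inter> outer M"
    using plane_bipolar unfolding plane_bipolar_orientation_def outer_vertex_def by blast
next
  have ext: "fst h \<in> edges M \<and> face_of M h = outer M \<and> \<not> snd h \<and> \<not> lateral M h"
    if "h \<in> sink M \<inter> outer M" for h
  proof -
    have h: "h \<in> sink M" "h \<in> outer M" using that by auto
    then have hE: "fst h \<in> edges M" "sink M = vertex_of M h" "outer M = face_of M h"
      using vertex_mem[OF sink_in] face_mem[OF outer_in] by auto
    then have "rot M h \<in> sink M" using vertex_self[of "rot M h"] vertex_rot by simp
    with h hE sink_snd show ?thesis by (simp add: lateral_def)
  qed
  fix h h' assume "h \<in> sink M \<inter> outer M" "h' \<in> sink M \<inter> outer M"
  then show "h = h'" using ext by (intro extremal_unique) metis+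
qed

lemma cs: "cs \<in> source M" "cs \<in> outer M" and ct: "ct \<in> sink M" "ct \<in> outer M"
  using theI'[OF source_corner_unique] theI'[OF sink_corner_unique]
  by (auto simp: source_corner_def sink_corner_def)

lemma cs_edge: "fst cs \<in> edges M" and ct_edge: "fst ct \<in> edges M"
  using cs ct vertex_mem source_in sink_in by blast+

lemma cs_vertex: "vertex_of M cs = source M" and ct_vertex: "vertex_of M ct = sink M"
  using cs ct vertex_mem source_in sink_in by metis+

lemma cs_face: "face_of M cs = outer M" and ct_face: "face_of M ct = outer M"
  using cs ct face_mem outer_in by metis+

lemma cs_snd [simp]: "snd cs" "snd (rot M cs)" and ct_snd [simp]: "\<not> snd ct" "\<not> snd (rot M ct)"
  using cs(1) ct(1) source_snd sink_snd vertex_rot[OF cs_edge] vertex_rot[OF ct_edge]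
    vertex_self[of "rot M cs"] vertex_self[of "rot M ct"] cs_edge ct_edge cs_vertex ct_vertex
  by auto

lemma cs_neq_ct [simp]: "cs \<noteq> ct" "ct \<noteq> cs"
  using cs_snd ct_snd by metis+

lemma outer_extremal:
  assumes "h \<in> outer M" "\<not> lateral M h"
  shows "h = (if snd h then cs else ct)"
proof -
  have h: "fst h \<in> edges M" "face_of M h = outer M" using face_mem[OF outer_in assms(1)] by auto
  show ?thesis
    by (rule extremal_unique) (use h assms cs_edge ct_edge cs_face ct_face in \<open>auto simp: lateral_def\<close>)
qed

abbreviation "C \<equiv> closure_map M"

lemma edges_closure: "edges C = Old ` edges M \<union> {Ell, Arr}"
  by (simp add: closure_map_def)

lemma edges_closure_iff [simp]:
  "Old e \<in> edges C \<longleftrightarrow> e \<in> edges M" "Ell \<in> edges C" "Arr \<in> edges C"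
  by (auto simp: edges_closure)

lemma outer_closure: "outer C = {(Ell, False), (Arr, True)}"
  by (simp add: closure_map_def)

lemma rot_closure [simp]:
  "rot C (Arr, True) = (Ell, True)" "rot C (Ell, True) = old (rot M cs)"
  "rot C (Ell, False) = (Arr, False)" "rot C (Arr, False) = old (rot M ct)"
  "rot C (old h) = (if h = cs then (Arr, True) else if h = ct then (Ell, False) else old (rot M h))"
  by (cases h; simp add: closure_map_def closure_rot_def)+

lemma rot_map_closure: "rot_map C"
proof
  show fin: "finite (edges C)" by (simp add: edges_closure finite_edges)
  show "rot C permutes half_edges C"
  proof (rule inj_imp_permutes)
    show "inj_on (rot C) (half_edges C)"
    proof (rule inj_onI)
      fix x y assume "rot C x = rot C y"
      then show "x = y"
        by (cases x rule: closure_half_edge_cases5; cases y rule: closure_half_edge_cases5)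
          (auto simp: rot_inj split: if_splits)
    qed
    show "finite (half_edges C)" using fin by (simp add: half_edges_def)
    fix x
    show "x \<in> half_edges C \<Longrightarrow> rot C x \<in> half_edges C"
      by (cases x rule: closure_half_edge_cases5)
        (use cs_edge ct_edge in auto)
    show "x \<notin> half_edges C \<Longrightarrow> rot C x = x"
      by (cases x rule: closure_half_edge_cases)
        (use cs_edge ct_edge permutes_not_in[OF rot_permutes] in auto)
  qed
qed

end

sublocale plane_map \<subseteq> C: rot_map C
  by (rule rot_map_closure)

context plane_map
begin

lemma step_closure [simp]:
  "face_step C (Ell, True) = old ct" "face_step C (Ell, False) = (Arr, True)"
  "face_step C (Arr, True) = (Ell, False)" "face_step C (Arr, False) = old cs"
  "face_step C (old h) = (if face_step M h = cs then (Ell, True)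
     else if face_step M h = ct then (Arr, False) else old (face_step M h))"
  unfolding C.step_eq_iff using rot_step[of h] by (auto simp: old_opposite)

definition closure_vertex :: "'e half_edge set \<Rightarrow> 'e closure_edge half_edge set" where
  "closure_vertex v = old ` v \<union> (if v = source M then {(Ell, True), (Arr, True)}
     else if v = sink M then {(Ell, False), (Arr, False)} else {})"

lemma Ell_Arr_vertex:
  "vertex_of C (Ell, True) = vertex_of C (old cs)" "vertex_of C (Arr, True) = vertex_of C (old cs)"
  "vertex_of C (Ell, False) = vertex_of C (old ct)" "vertex_of C (Arr, False) = vertex_of C (old ct)"
  using C.vertex_rot[of "old cs"] C.vertex_rot[of "(Arr, True)"]
    C.vertex_rot[of "old ct"] C.vertex_rot[of "(Ell, False)"] cs_edge ct_edge by auto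

lemma vertex_of_old_rot: assumes "fst h \<in> edges M"
  shows "vertex_of C (old (rot M h)) = vertex_of C (old h)"
  using C.vertex_rot[of "old h"] C.vertex_rot[of "(Ell, True)"] C.vertex_rot[of "(Arr, False)"] assms
    Ell_Arr_vertex
  by (cases "h = cs"; cases "h = ct") auto

lemma old_closure_vertex [simp]: "old h \<in> closure_vertex v \<longleftrightarrow> h \<in> v"
  by (simp add: closure_vertex_def)

lemma Ell_Arr_closure_vertex:
  "(Ell, b) \<in> closure_vertex v \<longleftrightarrow> v = (if b then source M else sink M)"
  "(Arr, b) \<in> closure_vertex v \<longleftrightarrow> v = (if b then source M else sink M)"
  using source_neq_sink by (auto simp: closure_vertex_def)

lemma cs_in_iff: "v \<in> vertices M \<Longrightarrow> cs \<in> v \<longleftrightarrow> v = source M"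
  and ct_in_iff: "v \<in> vertices M \<Longrightarrow> ct \<in> v \<longleftrightarrow> v = sink M"
  using cs(1) ct(1) cs_vertex ct_vertex vertex_mem by metis+

lemma rot_in_vertex: "v \<in> vertices M \<Longrightarrow> h \<in> v \<Longrightarrow> rot M h \<in> v"
  by (metis vertex_mem vertex_rot vertex_self rot_in_iff)

lemma closure_vertex_rot:
  assumes v: "v \<in> vertices M" and z: "z \<in> closure_vertex v"
  shows "rot C z \<in> closure_vertex v"
  using v z rot_in_vertex[OF v] cs_in_iff[OF v] ct_in_iff[OF v] rot_in_vertex[OF source_in cs(1)]
    rot_in_vertex[OF sink_in ct(1)]
  by (cases z rule: closure_half_edge_cases5) (simp_all add: Ell_Arr_closure_vertex, metis)

lemma vertex_of_old:
  assumes h: "fst h \<in> edges M"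
  shows "vertex_of C (old h) = closure_vertex (vertex_of M h)"
proof
  have vs: "vertex_of M h \<in> vertices M" using h vertices_iff by blast
  show "vertex_of C (old h) \<subseteq> closure_vertex (vertex_of M h)"
  proof
    fix x assume "x \<in> vertex_of C (old h)"
    then show "x \<in> closure_vertex (vertex_of M h)"
      unfolding vertex_of_def[of C]
      by (rule fin_perm_orbit_induct[OF C.fin_perm_rot, rotated])
        (use h vertex_self closure_vertex_rot[OF vs] in auto)
  qed
  have old: "vertex_of C (old g) = vertex_of C (old h)" if "g \<in> vertex_of M h" for g
    using that unfolding vertex_of_def[of M]
    by (rule fin_perm_orbit_const[OF fin_perm_rot, where F = "\<lambda>g. vertex_of C (old g)", rotated])
      (use h vertex_of_old_rot in auto)
  show "closure_vertex (vertex_of M h) \<subseteq> vertex_of C (old h)"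
  proof
    fix x assume x: "x \<in> closure_vertex (vertex_of M h)"
    have "fst x \<in> edges C" 
      using x vertex_in[OF h] by (cases x rule: closure_half_edge_cases) (auto simp: closure_vertex_def split: if_splits)
    moreover have "vertex_of C x = vertex_of C (old h)"
      using x old cs_in_iff[OF vs] ct_in_iff[OF vs] Ell_Arr_vertex
      by (cases x rule: closure_half_edge_cases5) (simp_all add: Ell_Arr_closure_vertex)
    ultimately show "x \<in> vertex_of C (old h)" using C.vertex_iff h by simp
  qed
qed

lemma closure_vertex_inj: "closure_vertex v = closure_vertex w \<longleftrightarrow> v = w"
  using old_closure_vertex by blast

lemma vertex_of_closure:
  "vertex_of C (Ell, True) = closure_vertex (source M)" "vertex_of C (Arr, True) = closure_vertex (source M)"
  "vertex_of C (Ell, False) = closure_vertex (sink M)" "vertex_of C (Arr, False) = closure_vertex (sink M)"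
  using Ell_Arr_vertex vertex_of_old cs_edge ct_edge cs_vertex ct_vertex by auto

lemma vertices_closure: "vertices C = closure_vertex ` vertices M"
proof -
  have "vertex_of C (old h) \<in> closure_vertex ` vertices M" if "fst h \<in> edges M" for h
    using that vertex_of_old vertices_iff by blast
  then have "vertex_of C x \<in> closure_vertex ` vertices M" if "fst x \<in> edges C" for x
    using that vertex_of_closure source_in sink_in
    by (cases x rule: closure_half_edge_cases5) auto
  moreover have "closure_vertex (vertex_of M h) \<in> vertices C" if "fst h \<in> edges M" for h
    using vertex_of_old[OF that] that C.vertices_iff by (metis edges_closure_iff(1) old_simps(2))
  ultimately show ?thesis by (auto simp: C.vertices_iff vertices_iff)
qed

lemma arcs_closure:
  "arcs C = map_prod closure_vertex closure_vertex ` insert (source M, sink M) (arcs M)"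
proof -
  have "arcs C = (\<lambda>e. (vertex_of C (e, True), vertex_of C (e, False))) ` edges C"
    by (auto simp: arcs_def edge_origin_def edge_end_def)
  also have "\<dots> = insert (closure_vertex (source M), closure_vertex (sink M))
      ((\<lambda>e. (vertex_of C (Old e, True), vertex_of C (Old e, False))) ` edges M)"
    by (simp add: edges_closure vertex_of_closure image_Un image_image insert_commute)
  also have "(\<lambda>e. (vertex_of C (Old e, True), vertex_of C (Old e, False))) ` edges M =
      (\<lambda>e. (closure_vertex (vertex_of M (e, True)), closure_vertex (vertex_of M (e, False)))) ` edges M"
    by (rule image_cong) (use vertex_of_old[where h = "(_, _)"] in auto)
  also have "\<dots> = map_prod closure_vertex closure_vertex ` arcs M"
    by (auto simp: arcs_def edge_origin_def edge_end_def image_iff; force)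
  finally show ?thesis by simp
qed

lemma acyclic_closure: "acyclic (arcs C)"
proof -
  have "(sink M, source M) \<notin> (arcs M)\<^sup>*"
  proof
    assume "(sink M, source M) \<in> (arcs M)\<^sup>*"
    then obtain v where "(sink M, v) \<in> arcs M"
      using source_neq_sink by (metis converse_rtranclE)
    then obtain e where "e \<in> edges M" "sink M = vertex_of M (e, True)" using arcs_iff by blast
    then have "(e, True) \<in> sink M" using vertex_self by simp
    then show False using sink_snd by force
  qed
  then have "acyclic (insert (source M, sink M) (arcs M))" using acyclic_arcs by simp
  then show ?thesis
    unfolding arcs_closure
    by (rule acyclic_map_prod[where A = UNIV, rotated 2]) (auto simp: inj_on_def closure_vertex_inj)
qed

lemma closure_source_iff: "is_source C u \<longleftrightarrow> u = closure_vertex (source M)"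
proof
  assume u: "is_source C u"
  then obtain v where v: "v \<in> vertices M" "u = closure_vertex v"
    unfolding is_source_def vertices_closure by blast
  then have "is_source M v" using u unfolding is_source_def by (metis old_closure_vertex old_simps(3))
  with v source_eq show "u = closure_vertex (source M)" by blast
next
  assume u: "u = closure_vertex (source M)"
  have "snd x = True" if "x \<in> u" for x
    using that source_snd source_neq_sink unfolding u
    by (cases x rule: closure_half_edge_cases) (auto simp: closure_vertex_def split: if_splits)
  then show "is_source C u"
    using source_in unfolding is_source_def vertices_closure u by blast
qed

lemma closure_sink_iff: "is_sink C u \<longleftrightarrow> u = closure_vertex (sink M)"
proof
  assume u: "is_sink C u"
  then obtain v where v: "v \<in> vertices M" "u = closure_vertex v"
    unfolding is_sink_def vertices_closure by blast
  then have "is_sink M v" using u unfolding is_sink_def by (metis old_closure_vertex old_simps(3))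
  with v sink_eq show "u = closure_vertex (sink M)" by blast
next
  assume u: "u = closure_vertex (sink M)"
  have "snd x = False" if "x \<in> u" for x
    using that sink_snd source_neq_sink unfolding u
    by (cases x rule: closure_half_edge_cases) (auto simp: closure_vertex_def split: if_splits)
  then show "is_sink C u"
    using sink_in unfolding is_sink_def vertices_closure u by blast
qed

lemma lateral_closure [simp]:
  "lateral C (old h) \<longleftrightarrow> lateral M h" "\<not> lateral C (Ell, b)" "\<not> lateral C (Arr, b)"
  by (cases b; auto simp: lateral_def)+

text \<open>
  A label of the face of a corner of the closure. The two special faces are labelled by the corners
  on their old boundary, and the outer face by \<open>{}\<close>.
\<close>

definition face_trace :: "'e closure_edge half_edge \<Rightarrow> 'e half_edge set" where
  "face_trace x = (case x of
     (Old e, b) \<Rightarrow> if (e, b) \<in> outer M then {h \<in> outer M. snd h = b} else face_of M (e, b)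
   | (Ell, b) \<Rightarrow> if b then {h \<in> outer M. \<not> snd h} else {}
   | (Arr, b) \<Rightarrow> if b then {} else {h \<in> outer M. snd h})"

lemma face_trace_simps [simp]:
  "face_trace (old h) = (if h \<in> outer M then {g \<in> outer M. snd g = snd h} else face_of M h)"
  "face_trace (Ell, b) = (if b then {h \<in> outer M. \<not> snd h} else {})"
  "face_trace (Arr, b) = (if b then {} else {h \<in> outer M. snd h})"
  by (cases h; auto simp: face_trace_def)+

lemma outer_iff: "fst h \<in> edges M \<Longrightarrow> h \<in> outer M \<longleftrightarrow> face_of M h = outer M"
  by (metis face_mem face_self outer_in)

lemma outer_step_iff: "fst h \<in> edges M \<Longrightarrow> face_step M h \<in> outer M \<longleftrightarrow> h \<in> outer M"
  using outer_iff[of h] outer_iff[of "face_step M h"] face_step_eq[of h] by simp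

lemma face_trace_step:
  assumes "fst x \<in> edges C"
  shows "face_trace (face_step C x) = face_trace x"
proof (cases x rule: closure_half_edge_cases)
  case (1 h)
  then have h: "fst h \<in> edges M" using assms by simp
  have l: "lateral M (face_step M h) \<longleftrightarrow> snd (face_step M h) = snd h"
    by (auto simp: lateral_def rot_step)
  have o: "face_step M h \<in> outer M \<longleftrightarrow> h \<in> outer M" by (rule outer_step_iff[OF h])
  consider "face_step M h = cs" | "face_step M h = ct" | "face_step M h \<noteq> cs" "face_step M h \<noteq> ct" by blast
  then show ?thesis
  proof cases
    case c: 1
    then have "h \<in> outer M" "\<not> snd h" using o cs l cs_snd by (auto simp: lateral_def)
    with c 1 show ?thesis by auto
  next
    case c: 2
    then have "h \<in> outer M" "snd h" using o ct l ct_snd by (auto simp: lateral_def)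
    with c 1 show ?thesis by auto
  next
    case c: 3
    then have "h \<in> outer M \<Longrightarrow> snd (face_step M h) = snd h"
      using outer_extremal[of "face_step M h"] l o by (auto split: if_splits)
    with c 1 o face_step_eq[OF h] show ?thesis by auto
  qed
qed (use cs ct in \<open>auto split: if_splits\<close>)

lemma face_trace_eq:
  assumes "fst x \<in> edges C" "face_of C x = face_of C y" "fst y \<in> edges C"
  shows "face_trace x = face_trace y"
  by (rule fin_perm_orbit_const[OF C.fin_perm_step, of y x])
    (use assms face_trace_step C.face_self[OF assms(1)] in \<open>auto simp: face_of_def\<close>)

lemma face_of_outer_closure: "face_of C (Ell, False) = {(Ell, False), (Arr, True)}"
proof
  show "face_of C (Ell, False) \<subseteq> {(Ell, False), (Arr, True)}"
  proof
    fix x assume "x \<in> face_of C (Ell, False)"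
    then show "x \<in> {(Ell, False), (Arr, True)}"
      unfolding face_of_def by induct auto
  qed
  have "(Arr, True) \<in> face_of C (Ell, False)"
    unfolding face_of_def using orbit.base[of "face_step C" "(Ell, False)"] by simp
  then show "{(Ell, False), (Arr, True)} \<subseteq> face_of C (Ell, False)"
    using C.face_self[of "(Ell, False)"] by simp
qed

lemma bipolar_closure: "bipolar_orientation C"
proof -
  interpret C: bipolar_rot C
    by unfold_locales (use acyclic_closure closure_source_iff closure_sink_iff in \<open>auto simp: edges_closure\<close>)
  have ext: "x = y" if x: "fst x \<in> edges C" "\<not> snd x" "\<not> lateral C x"
    and y: "fst y \<in> edges C" "\<not> snd y" "\<not> lateral C y" and f: "face_of C x = face_of C y" for x y
  proof -
    define A B where "A = {h \<in> outer M. \<not> snd h}" and "B = {h \<in> outer M. snd h}"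
    have tr: "face_trace x = face_trace y" using x y f face_trace_eq by blast
    have key: "x = (Ell, False) \<and> face_trace x = {} \<or> x = (Arr, False) \<and> face_trace x = B \<or>
        x = old ct \<and> face_trace x = A \<or>
        (\<exists>h. x = old h \<and> fst h \<in> edges M \<and> \<not> snd h \<and> h \<notin> outer M \<and> \<not> lateral M h \<and> face_trace x = face_of M h)"
      if "fst x \<in> edges C" "\<not> snd x" "\<not> lateral C x" for x
      using that
    proof (cases x rule: closure_half_edge_cases)
      case (1 h)
      then show ?thesis using that outer_extremal[of h] by (cases "h \<in> outer M") (auto simp: A_def)
    qed (auto simp: A_def B_def)
    have "ct \<in> A" "cs \<in> B" "cs \<notin> A" using cs(2) ct(2) by (simp_all add: A_def B_def)
    then have neq: "A \<noteq> {}" "B \<noteq> {}" "A \<noteq> B" by blast+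
    have face_neq: "face_of M h \<noteq> {} \<and> face_of M h \<noteq> A \<and> face_of M h \<noteq> B"
      if "fst h \<in> edges M" "h \<notin> outer M" for h
      using face_self[OF that(1)] that(2) by (auto simp: A_def B_def)
    show ?thesis
      using key[OF x] key[OF y]
      by (elim disjE exE conjE; metis tr neq face_neq extremal_unique)
  qed
  show ?thesis
  proof (rule C.bipolar_orientationI)
    show "outer C \<in> faces C"
      unfolding outer_closure face_of_outer_closure[symmetric] C.faces_iff by (rule exI[of _ "(Ell, False)"]) simp
  next
    fix x y assume "x \<in> half_edges C" "y \<in> half_edges C" "vertex_of C x = vertex_of C y" "\<not> snd x" "\<not> snd y"
      "snd (rot C x)" "snd (rot C y)"
    then have x: "fst x \<in> edges C" "lateral C x" and y: "fst y \<in> edges C" "lateral C y"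
      and v: "vertex_of C x = vertex_of C y" "snd x = snd y" by (auto simp: lateral_def)
    obtain h h' where h: "x = old h" "y = old h'"
      using x y by (cases x rule: closure_half_edge_cases; cases y rule: closure_half_edge_cases) auto
    then show "x = y" using lateral_unique[of h h'] x y v vertex_of_old closure_vertex_inj by auto
  next
    fix x y assume "x \<in> half_edges C" "y \<in> half_edges C" "face_of C x = face_of C y" "\<not> snd x" "\<not> snd y"
      "\<not> snd (rot C x)" "\<not> snd (rot C y)"
    then show "x = y" using ext[of x y] by (auto simp: lateral_def)
  qed
qed

end

sublocale plane_map \<subseteq> C: closed_map C
proof -
  interpret C: bipolar_map C by unfold_locales (rule bipolar_closure)
  show "closed_map C"
    by unfold_locales
      (use C.source_eq closure_source_iff C.sink_eq closure_sink_iff in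
        \<open>auto simp: outer_closure vertex_of_closure\<close>)
qed

section \<open>The dual orientation is acyclic\<close>

lemma finite_acyclic_rank:
  assumes "finite r" "acyclic r"
  obtains \<rho> :: "'a \<Rightarrow> nat" where "\<And>x y. (x, y) \<in> r \<Longrightarrow> \<rho> x < \<rho> y"
proof -
  have fin: "finite {x. (x, y) \<in> r\<^sup>+}" for y
  proof (rule finite_subset)
    show "{x. (x, y) \<in> r\<^sup>+} \<subseteq> Domain (r\<^sup>+)" by blast
    show "finite (Domain (r\<^sup>+))" using assms(1) by (simp add: finite_Domain)
  qed
  have "card {z. (z, x) \<in> r\<^sup>+} < card {z. (z, y) \<in> r\<^sup>+}" if xy: "(x, y) \<in> r" for x y
  proof (rule psubset_card_mono[OF fin])
    have "x \<in> {z. (z, y) \<in> r\<^sup>+}" "x \<notin> {z. (z, x) \<in> r\<^sup>+}"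
      using xy assms(2) by (auto simp: acyclic_def)
    moreover have "{z. (z, x) \<in> r\<^sup>+} \<subseteq> {z. (z, y) \<in> r\<^sup>+}"
      using xy by (auto intro: trancl_into_trancl)
    ultimately show "{z. (z, x) \<in> r\<^sup>+} \<subset> {z. (z, y) \<in> r\<^sup>+}" by blast
  qed
  then show ?thesis by (rule that)
qed

context closed_map
begin

abbreviation "right_face a \<equiv> face_of C (a, True)"
abbreviation "left_face a \<equiv> face_of C (a, False)"

lemma right_outer_iff: "a \<in> edges C \<Longrightarrow> right_face a = outer C \<longleftrightarrow> a = Arr"
  using face_self[of "(a, True)"] face_mem[OF outer_in, of "(Arr, True)"] outer_eq by auto

lemma left_outer_iff: "a \<in> edges C \<Longrightarrow> left_face a = outer C \<longleftrightarrow> a = Ell"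
  using face_self[of "(a, False)"] face_mem[OF outer_in, of "(Ell, False)"] outer_eq by auto

lemma source_vertex_Arr: "vertex_of C (Arr, True) = source C"
  using vertex_rot[of "(Arr, True)"] rot_Arr_origin source_Ell by simp

lemma sink_vertex_Arr: "vertex_of C (Arr, False) = sink C"
  using vertex_rot[of "(Ell, False)"] rot_Ell_end sink_Ell by simp

lemma end_not_source: "a \<in> edges C \<Longrightarrow> vertex_of C (a, False) \<noteq> source C"
  and origin_not_sink: "a \<in> edges C \<Longrightarrow> vertex_of C (a, True) \<noteq> sink C"
  using source_snd[of "(a, False)"] sink_snd[of "(a, True)"] vertex_self[of "(a, False)"]
    vertex_self[of "(a, True)"] by auto

lemma source_extremal: "a \<in> edges C \<Longrightarrow> vertex_of C (a, True) = source C \<Longrightarrow> \<not> lateral C (a, True)"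
  using vertex_rot[of "(a, True)"] vertex_self[of "rot C (a, True)"] source_snd by (auto simp: lateral_def)

lemma sink_extremal: "a \<in> edges C \<Longrightarrow> vertex_of C (a, False) = sink C \<Longrightarrow> \<not> lateral C (a, False)"
  using vertex_rot[of "(a, False)"] vertex_self[of "rot C (a, False)"] sink_snd by (auto simp: lateral_def)

lemma sink_step: assumes "a \<in> edges C" "vertex_of C (a, False) = sink C"
  shows "\<not> snd (face_step C (a, True))"
proof -
  have "vertex_of C (face_step C (a, True)) = sink C"
    using vertex_rot[of "face_step C (a, True)"] rot_step[of "(a, True)"] assms by simp
  then show ?thesis using vertex_self[of "face_step C (a, True)"] assms(1) sink_snd by simp
qed

lemma source_step: assumes "a \<in> edges C" "vertex_of C (a, True) = source C"
  shows "snd (face_step C (a, False))"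
proof -
  have "vertex_of C (face_step C (a, False)) = source C"
    using vertex_rot[of "face_step C (a, False)"] rot_step[of "(a, False)"] assms by simp
  then show ?thesis using vertex_self[of "face_step C (a, False)"] assms(1) source_snd by simp
qed

lemma right_face_Ell: "a \<in> edges C \<Longrightarrow> right_face a = right_face Ell \<Longrightarrow> a = Ell"
proof (induction a rule: left_path_induct)
  case (first e)
  then show ?case using extremal_unique[of "(e, True)" "(Ell, True)"] source_extremal source_Ell by simp
next
  case (step e e')
  then show ?case using sink_step[OF Ell_in sink_Ell] by auto
qed

text \<open>
  Let \<open>T\<close> be the set of faces from which one can walk leftwards forever; it is closed under moving
  to the right. Consider the edges with \<open>T\<close> on the right but not on the left. Turning around
  vertices shows that the lowest ones start the left lateral path of the face on their right. If
  \<open>a\<close> is the highest edge of this kind, then the whole left lateral path of its right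
  face consists of such edges, so that one cannot leave this face to the left within \<open>T\<close>.
\<close>

lemma wf_dual:
  defines "D \<equiv> {(left_face a, right_face a) | a. a \<in> edges C \<and> a \<noteq> Ell \<and> a \<noteq> Arr}"
  shows "wf D"
proof (rule ccontr)
  assume "\<not> wf D"
  define T where "T = - Wellfounded.acc D"
  have ne: "T \<noteq> {}" using \<open>\<not> wf D\<close> by (auto simp: T_def wf_iff_acc)
  have T1: "right_face a \<in> T" if "left_face a \<in> T" "a \<in> edges C" "a \<noteq> Ell" "a \<noteq> Arr" for a
    using that by (auto simp: T_def D_def dest: acc_downward)
  have T2: "\<exists>a \<in> edges C. a \<noteq> Ell \<and> a \<noteq> Arr \<and> right_face a = f \<and> left_face a \<in> T" if f: "f \<in> T" for f
  proof (rule ccontr)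
    assume *: "\<not> ?thesis"
    have "f \<in> Wellfounded.acc D"
      by (rule accI) (use * in \<open>auto simp: T_def D_def\<close>)
    with f show False by (simp add: T_def)
  qed
  have outer: "outer C \<notin> T" using T2 right_outer_iff by blast
  then have LEll: "left_face Ell \<notin> T" and RArr: "right_face Arr \<notin> T"
    using left_outer_iff right_outer_iff Ell_in Arr_in by metis+
  have REll: "right_face Ell \<notin> T" using T2 right_face_Ell by blast
  define bnd where "bnd a \<longleftrightarrow> a \<in> edges C \<and> left_face a \<notin> T \<and> right_face a \<in> T" for a
  have face_rot: "face_of C (opposite (rot C h)) = face_of C h" if "fst h \<in> edges C" for h
    using that face_opposite_rot by blast
  have ex_bnd: "\<exists>a. bnd a"
  proof (rule ccontr)
    assume "\<not> ?thesis"
    then have nb: "left_face a \<in> T" if "right_face a \<in> T" "a \<in> edges C" for a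
      using that by (auto simp: bnd_def)
    have round: "face_of C g \<notin> T"
      if h: "fst h \<in> edges C" "face_of C h \<notin> T" "g \<in> vertex_of C h"
        and A: "left_face Arr \<notin> T \<or> vertex_of C h \<noteq> sink C" for h g
      using h(3) unfolding vertex_of_def
    proof (rule fin_perm_orbit_induct[OF fin_perm_rot, rotated])
      fix z assume z: "z \<in> orbit (rot C) h" "face_of C z \<notin> T"
      have zE: "fst z \<in> edges C" "vertex_of C z = vertex_of C h"
        using vertex_in[OF h(1)] vertex_eq[OF h(1)] z(1) by (simp_all add: vertex_of_def)
      obtain e b where e: "rot C z = (e, b)" by force
      have eE: "e \<in> edges C" using rot_in_iff[of z] zE e by (simp del: rot_in_iff)
      have "face_of C (e, \<not> b) \<notin> T" using face_rot[OF zE(1)] z(2) e by simp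
      moreover have "b = False \<Longrightarrow> e = Arr \<Longrightarrow> left_face Arr \<notin> T"
        using A vertex_rot[OF zE(1)] zE(2) e sink_vertex_Arr by auto
      ultimately show "face_of C (rot C z) \<notin> T"
        using e T1[OF _ eE] nb[OF _ eE] LEll by (cases b; cases "e = Ell"; cases "e = Arr") auto
    qed (use h in auto)
    have so: "face_of C g \<notin> T" if "g \<in> source C" for g
      using round[of "(Ell, True)" g] REll that source_Ell source_neq_sink by simp
    have LArr: "left_face Arr \<notin> T"
    proof -
      have "vertex_of C (face_step C (Arr, False)) = source C"
        using vertex_rot[of "face_step C (Arr, False)"] rot_step[of "(Arr, False)"] source_vertex_Arr by simp
      then show ?thesis
        using so[of "face_step C (Arr, False)"] vertex_self[of "face_step C (Arr, False)"]
          face_step_eq[of "(Arr, False)"] by simp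
    qed
    have all: "\<forall>g \<in> v. face_of C g \<notin> T" if "v \<in> vertices C" for v
      using that
    proof (rule vertex_induct)
      show "\<forall>g \<in> source C. face_of C g \<notin> T" using so by blast
      fix e assume e: "e \<in> edges C" "\<forall>g \<in> edge_origin C e. face_of C g \<notin> T"
      then have "right_face e \<notin> T" using vertex_self[of "(e, True)"] by (simp add: edge_origin_def)
      then have "left_face e \<notin> T" using T1[of e] e LEll LArr by blast
      then show "\<forall>g \<in> edge_end C e. face_of C g \<notin> T"
        using round[of "(e, False)"] LArr e(1) by (auto simp: edge_end_def)
    qed
    from ne obtain a where "a \<in> edges C" "right_face a \<in> T" using T2 by blast
    with all[of "vertex_of C (a, True)"] vertex_self[of "(a, True)"] show False by (auto simp: vertices_iff)
  qed
  have ex_first: "\<exists>a. bnd a \<and> \<not> lateral C (a, True)"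
  proof -
    obtain a where a: "bnd a" and min: "\<And>y. (y, a) \<in> precedes C \<Longrightarrow> \<not> bnd y"
      using ex_bnd wf_precedes[OF acyclic_arcs] by (metis mem_Collect_eq wfE_min)
    have aE: "a \<in> edges C" using a by (simp add: bnd_def)
    have "\<not> lateral C (a, True)"
    proof
      assume "lateral C (a, True)"
      then obtain y where y: "rot C (a, True) = (y, False)"
        by (cases "rot C (a, True)") (auto simp: lateral_def)
      have yE: "y \<in> edges C" using rot_in_iff[of "(a, True)"] aE y by (simp del: rot_in_iff)
      have prec: "(i, a) \<in> precedes C" if "i \<in> edges C" "vertex_of C (i, False) = vertex_of C (a, True)" for i
        using that aE by (simp add: precedes_def edge_origin_def edge_end_def)
      have vy: "vertex_of C (y, False) = vertex_of C (a, True)" using vertex_rot[of "(a, True)"] aE y by simp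
      have "right_face y \<in> T" using face_rot[of "(a, True)"] aE y a by (simp add: bnd_def)
      then have Ly: "left_face y \<in> T" using min[OF prec[OF yE vy]] yE by (simp add: bnd_def)
      have all: "face_of C g \<in> T" if "g \<in> vertex_of C (y, False)" for g
        using that unfolding vertex_of_def
      proof (rule fin_perm_orbit_induct[OF fin_perm_rot, rotated])
        fix z assume z: "z \<in> orbit (rot C) (y, False)" "face_of C z \<in> T"
        have zE: "fst z \<in> edges C" "vertex_of C z = vertex_of C (a, True)"
          using z(1) yE vertex_in[of "(y, False)" z] vertex_eq[of "(y, False)" z] vy by (simp_all add: vertex_of_def)
        obtain e b where e: "rot C z = (e, b)" by force
        have eE: "e \<in> edges C" using rot_in_iff[of z] zE e by (simp del: rot_in_iff)
        have ve: "vertex_of C (e, b) = vertex_of C (a, True)" using vertex_rot[OF zE(1)] zE(2) e by simp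
        have f: "face_of C (e, \<not> b) \<in> T" using face_rot[OF zE(1)] z(2) e by simp
        show "face_of C (rot C z) \<in> T"
        proof (cases b)
          case True
          have "e \<noteq> Arr" using True ve vy source_vertex_Arr end_not_source[OF yE] by auto
          moreover have "e \<noteq> Ell" using True f LEll by auto
          ultimately show ?thesis using T1[of e] f True e eE by simp
        next
          case False
          then have "\<not> bnd e" using min[OF prec[OF eE]] ve by simp
          then show ?thesis using f False e eE by (auto simp: bnd_def)
        qed
      qed (use yE Ly in auto)
      have "vertex_of C (face_step C (a, False)) = vertex_of C (a, True)"
        using vertex_rot[of "face_step C (a, False)"] rot_step[of "(a, False)"] aE by simp
      then have "face_step C (a, False) \<in> vertex_of C (y, False)"
        using vertex_iff[of "(y, False)" "face_step C (a, False)"] yE aE vy by simp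
      then have "face_of C (face_step C (a, False)) \<in> T" by (rule all)
      then have "left_face a \<in> T" using face_step_eq[of "(a, False)"] aE by simp
      with a show False by (simp add: bnd_def)
    qed
    with a show ?thesis by blast
  qed
  define X where "X = {a. bnd a \<and> \<not> lateral C (a, True)}"
  have "wf (((precedes C)\<inverse>)\<^sup>+)" using wf_precedes_converse[OF acyclic_arcs] by (rule wf_trancl)
  then obtain a where a: "a \<in> X" and max: "\<And>y. (a, y) \<in> (precedes C)\<^sup>+ \<Longrightarrow> y \<notin> X"
    using ex_first wfE_min[of "((precedes C)\<inverse>)\<^sup>+" _ X] unfolding X_def trancl_converse
    by (metis (no_types, lifting) converse_iff mem_Collect_eq)
  have ab: "bnd a" "\<not> lateral C (a, True)" "a \<in> edges C" using a by (auto simp: X_def bnd_def)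
  have path: "bnd x \<and> (x = a \<or> (a, x) \<in> (precedes C)\<^sup>+)" if "x \<in> edges C" "right_face x = right_face a" for x
    using that
  proof (induction x rule: left_path_induct)
    case (first e)
    then show ?case using extremal_unique[of "(e, True)" "(a, True)"] ab by auto
  next
    case (step y e)
    have ay: "bnd y" "y = a \<or> (a, y) \<in> (precedes C)\<^sup>+" using step by auto
    have ae: "(a, e') \<in> (precedes C)\<^sup>+" if "(y, e') \<in> precedes C" for e'
      using ay(2) that by (auto intro: trancl_into_trancl)
    have rot_e: "rot C (e, True) = (y, False)" using step(5) by (simp add: step_eq_iff)
    have vy: "vertex_of C (y, False) = vertex_of C (e, True)" using vertex_rot[of "(e, True)"] step(2) rot_e by simp
    have "left_face e \<notin> T"
    proof
      assume Le: "left_face e \<in> T"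
      have all: "face_of C (opposite g) \<in> T" if "g \<in> vertex_of C (e, True)" for g
        using that unfolding vertex_of_def
      proof (rule fin_perm_orbit_back_induct[OF fin_perm_rot, rotated])
        fix z assume z: "z \<in> orbit (rot C) (e, True)" "face_of C (opposite (rot C z)) \<in> T"
        have zE: "fst z \<in> edges C" "vertex_of C z = vertex_of C (e, True)"
          using z(1) step(2) vertex_in[of "(e, True)" z] vertex_eq[of "(e, True)" z] by (simp_all add: vertex_of_def)
        have f: "face_of C z \<in> T" using z(2) face_rot[OF zE(1)] by simp
        obtain i b where i: "z = (i, b)" by force
        have iE: "i \<in> edges C" using zE i by simp
        show "face_of C (opposite z) \<in> T"
        proof (cases b)
          case True
          show ?thesis
          proof (rule ccontr)
            assume n: "\<not> ?thesis"
            then have bi: "bnd i" using f i True iE by (simp add: bnd_def)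
            have "(y, i) \<in> precedes C" using vy zE(2) i True iE step(1) by (simp add: precedes_def edge_origin_def edge_end_def)
            then have "lateral C (i, True)" using max[OF ae] bi by (auto simp: X_def)
            moreover have "lateral C (e, True)" using rot_e by (simp add: lateral_def)
            ultimately have "i = e" using lateral_unique[of "(i, True)" "(e, True)"] iE step(2) zE(2) i True by simp
            with n Le i True show False by simp
          qed
        next
          case False
          have "i \<noteq> Arr" using False i zE(2) sink_vertex_Arr origin_not_sink[OF step(2)] by auto
          moreover have "i \<noteq> Ell" using False i zE(2) sink_Ell origin_not_sink[OF step(2)] by auto
          ultimately show ?thesis using T1[of i] f False i iE by simp
        qed
      qed (use step(2) Le in auto)
      have "rot C (y, False) \<in> vertex_of C (e, True)"
        using vertex_iff[of "(e, True)" "rot C (y, False)"] vertex_rot[of "(y, False)"] step(1,2) vy by simp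
      then have "face_of C (opposite (rot C (y, False))) \<in> T" by (rule all)
      then have "left_face y \<in> T" using face_rot[of "(y, False)"] step(1) by simp
      with ay show False by (simp add: bnd_def)
    qed
    then show ?case using step(1,2,4,6) ab(1) ae[of e] step.prems by (auto simp: bnd_def)
  qed
  obtain x where "x \<in> edges C" "right_face x = right_face a" "left_face x \<in> T"
    using T2[of "right_face a"] ab by (auto simp: bnd_def)
  with path show False by (auto simp: bnd_def)
qed

lemma dual_rank:
  obtains \<rho> :: "'e closure_edge half_edge set \<Rightarrow> nat"
  where "\<And>a. a \<in> edges C \<Longrightarrow> a \<noteq> Ell \<Longrightarrow> a \<noteq> Arr \<Longrightarrow> \<rho> (left_face a) < \<rho> (right_face a)"
proof -
  let ?D = "{(left_face a, right_face a) | a. a \<in> edges C \<and> a \<noteq> Ell \<and> a \<noteq> Arr}"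
  have "finite ?D" using finite_edges by simp
  then obtain \<rho> :: "'e closure_edge half_edge set \<Rightarrow> nat" where "\<And>f g. (f, g) \<in> ?D \<Longrightarrow> \<rho> f < \<rho> g"
    using finite_acyclic_rank[OF _ wf_acyclic[OF wf_dual]] by blast
  then have "\<rho> (left_face a) < \<rho> (right_face a)" if "a \<in> edges C" "a \<noteq> Ell" "a \<noteq> Arr" for a
    using that by blast
  then show ?thesis by (rule that)
qed

end

section \<open>The map phi M is an N-avoiding poset\<close>

lemma card_image_cong_kernel:
  assumes "\<And>x y. x \<in> S \<Longrightarrow> y \<in> S \<Longrightarrow> f x = f y \<longleftrightarrow> g x = g y"
  shows "card (f ` S) = card (g ` S)"
proof -
  let ?h = "\<lambda>y. f (inv_into S g y)"
  have h: "?h (g x) = f x" if "x \<in> S" for x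
    using that assms[OF inv_into_into that] f_inv_into_f by (metis image_eqI)
  then have "inj_on ?h (g ` S)" using assms by (auto simp: inj_on_def)
  moreover have "?h ` g ` S = f ` S" unfolding image_image using h by (rule image_cong[OF refl])
  ultimately show ?thesis by (metis card_image)
qed

context closed_map
begin

definition is_top :: "'e closure_edge \<Rightarrow> bool" where
  "is_top a \<longleftrightarrow> \<not> snd (face_step C (a, True))"

definition is_bot :: "'e closure_edge \<Rightarrow> bool" where
  "is_bot b \<longleftrightarrow> snd (face_step C (b, False))"

abbreviation "topleft \<equiv> topleft_edge C"
abbreviation "bottomright \<equiv> bottomright_edge C"

lemma step_extremal: "\<not> lateral C (face_step C h) \<longleftrightarrow> snd (face_step C h) \<noteq> snd h"
  by (auto simp: lateral_def rot_step)

lemma top_unique: "a \<in> edges C \<Longrightarrow> a' \<in> edges C \<Longrightarrow> is_top a \<Longrightarrow> is_top a' \<Longrightarrow> right_face a = right_face a' \<Longrightarrow> a = a'"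
  using extremal_unique[of "face_step C (a, True)" "face_step C (a', True)"]
  by (auto simp: is_top_def step_extremal face_step_eq step_inj)

lemma bot_unique: "a \<in> edges C \<Longrightarrow> a' \<in> edges C \<Longrightarrow> is_bot a \<Longrightarrow> is_bot a' \<Longrightarrow> left_face a = left_face a' \<Longrightarrow> a = a'"
  using extremal_unique[of "face_step C (a, False)" "face_step C (a', False)"]
  by (auto simp: is_bot_def step_extremal face_step_eq step_inj)

lemma topleft:
  assumes "f \<in> faces C"
  shows "topleft f \<in> edges C \<and> right_face (topleft f) = f \<and> is_top (topleft f)"
proof -
  obtain h where h: "fst h \<in> edges C" "\<not> snd h" "\<not> lateral C h" "f = face_of C h"
    using extremal_ex[OF assms, of False] by auto
  let ?a = "fst (rot C h)"
  have o: "opposite (rot C h) = (?a, True)" using h by (cases "rot C h") (auto simp: lateral_def)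
  have a: "?a \<in> edges C" "right_face ?a = f" "is_top ?a"
    using h face_opposite_rot[OF h(1)] step_opposite_rot[of h] o by (auto simp: is_top_def)
  have "topleft f = ?a" unfolding topleft_edge_def left_lateral_path_def
  proof (rule the_equality)
    show "?a \<in> {e \<in> edges C. (e, True) \<in> f} \<and> \<not> snd (face_step C (?a, True))"
      using a face_self[of "(?a, True)"] by (auto simp: is_top_def)
    fix e assume "e \<in> {e \<in> edges C. (e, True) \<in> f} \<and> \<not> snd (face_step C (e, True))"
    then show "e = ?a" using top_unique[of e ?a] a face_mem[OF assms, of "(e, True)"] by (auto simp: is_top_def)
  qed
  with a show ?thesis by simp
qed

lemma bottomright:
  assumes "f \<in> faces C"
  shows "bottomright f \<in> edges C \<and> left_face (bottomright f) = f \<and> is_bot (bottomright f)"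
proof -
  obtain h where h: "fst h \<in> edges C" "snd h" "\<not> lateral C h" "f = face_of C h"
    using extremal_ex[OF assms, of True] by auto
  let ?a = "fst (rot C h)"
  have o: "opposite (rot C h) = (?a, False)" using h by (cases "rot C h") (auto simp: lateral_def)
  have a: "?a \<in> edges C" "left_face ?a = f" "is_bot ?a"
    using h face_opposite_rot[OF h(1)] step_opposite_rot[of h] o by (auto simp: is_bot_def)
  have "bottomright f = ?a" unfolding bottomright_edge_def right_lateral_path_def
  proof (rule the_equality)
    show "?a \<in> {e \<in> edges C. (e, False) \<in> f} \<and> snd (face_step C (?a, False))"
      using a face_self[of "(?a, False)"] by (auto simp: is_bot_def)
    fix e assume "e \<in> {e \<in> edges C. (e, False) \<in> f} \<and> snd (face_step C (e, False))"
    then show "e = ?a" using bot_unique[of e ?a] a face_mem[OF assms, of "(e, False)"] by (auto simp: is_bot_def)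
  qed
  with a show ?thesis by simp
qed

lemma face_in_faces [simp]: "fst h \<in> edges C \<Longrightarrow> face_of C h \<in> faces C"
  by (auto simp: faces_def)

lemma top_iff: "a \<in> edges C \<Longrightarrow> a = topleft (right_face a) \<longleftrightarrow> is_top a"
  using topleft[of "right_face a"] top_unique[of a "topleft (right_face a)"] by auto

lemma bot_iff: "b \<in> edges C \<Longrightarrow> b = bottomright (left_face b) \<longleftrightarrow> is_bot b"
  using bottomright[of "left_face b"] bot_unique[of b "bottomright (left_face b)"] by auto

definition cross :: "('e closure_edge \<times> 'e closure_edge) set" where
  "cross = {(a, b). a \<in> edges C \<and> b \<in> edges C \<and> a \<noteq> Arr \<and> b \<noteq> Ell \<and> right_face a = left_face b \<and> (is_top a \<or> is_bot b)}"

lemma crossD: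
  assumes "(a, b) \<in> cross"
  shows "a \<in> edges C" "b \<in> edges C" "a \<noteq> Arr" "b \<noteq> Ell" "right_face a = left_face b" "is_top a \<or> is_bot b"
  using assms by (auto simp: cross_def)

lemma left_neq_Ell: "a \<in> edges C \<Longrightarrow> b \<in> edges C \<Longrightarrow> a \<noteq> Arr \<Longrightarrow> left_face b = right_face a \<Longrightarrow> b \<noteq> Ell"
  using right_outer_iff left_outer_iff by metis

lemma right_neq_Arr: "a \<in> edges C \<Longrightarrow> b \<in> edges C \<Longrightarrow> b \<noteq> Ell \<Longrightarrow> left_face b = right_face a \<Longrightarrow> a \<noteq> Arr"
  using right_outer_iff left_outer_iff by metis

lemma lower_in_cross: "a \<in> edges C \<Longrightarrow> a \<noteq> Arr \<Longrightarrow> (a, bottomright (right_face a)) \<in> cross"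
  using bottomright[of "right_face a"] left_neq_Ell[of a "bottomright (right_face a)"] by (auto simp: cross_def)

lemma upper_in_cross: "b \<in> edges C \<Longrightarrow> b \<noteq> Ell \<Longrightarrow> (topleft (left_face b), b) \<in> cross"
  using topleft[of "left_face b"] right_neq_Arr[of "topleft (left_face b)" b] by (auto simp: cross_def)

lemma step_top: "is_top a \<Longrightarrow> face_step C (a, True) = (fst (face_step C (a, True)), False)"
  and step_not_top: "\<not> is_top a \<Longrightarrow> face_step C (a, True) = (fst (face_step C (a, True)), True)"
  and step_bot: "is_bot a \<Longrightarrow> face_step C (a, False) = (fst (face_step C (a, False)), True)"
  and step_not_bot: "\<not> is_bot a \<Longrightarrow> face_step C (a, False) = (fst (face_step C (a, False)), False)"
  by (cases "face_step C (a, True)"; cases "face_step C (a, False)"; simp add: is_top_def is_bot_def)+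

definition upper_out :: "'e closure_edge \<Rightarrow> ('e closure_edge \<times> 'e closure_edge) half_edge" where
  "upper_out a = ((a, if is_top a then fst (face_step C (a, True)) else bottomright (right_face a)), True)"

definition lower_in :: "'e closure_edge \<Rightarrow> ('e closure_edge \<times> 'e closure_edge) half_edge" where
  "lower_in b = ((if is_bot b then fst (face_step C (b, False)) else topleft (left_face b), b), False)"

definition lower_out :: "'e closure_edge \<Rightarrow> ('e closure_edge \<times> 'e closure_edge) half_edge" where
  "lower_out a = ((a, bottomright (right_face a)), True)"

definition upper_in :: "'e closure_edge \<Rightarrow> ('e closure_edge \<times> 'e closure_edge) half_edge" where
  "upper_in b = ((topleft (left_face b), b), False)"

definition cross_rot ::
    "('e closure_edge \<times> 'e closure_edge) half_edge \<Rightarrow> ('e closure_edge \<times> 'e closure_edge) half_edge" where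
  "cross_rot h = (case h of ((a, b), out) \<Rightarrow>
     if (a, b) \<notin> cross then h
     else if out then
       (if \<not> is_bot b then ((a, fst (face_step C (b, False))), True)
        else if a = Ell then upper_out a else lower_in a)
     else
       (if \<not> is_top a then ((fst (face_step C (a, True)), b), False)
        else if b = Arr then lower_in b else upper_out b))"

definition cross_pred ::
    "('e closure_edge \<times> 'e closure_edge) half_edge \<Rightarrow> ('e closure_edge \<times> 'e closure_edge) half_edge" where
  "cross_pred h = (case h of ((a, b), out) \<Rightarrow>
     if out then
       (if is_top a \<and> lateral C (b, False) then ((a, fst (rot C (b, False))), True)
        else if a = Ell then lower_out a else upper_in a)
     else
       (if is_bot b \<and> lateral C (a, True) then ((fst (rot C (a, True)), b), False)
        else if b = Arr then upper_in b else lower_out b))"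

definition cross_map :: "('e closure_edge \<times> 'e closure_edge) oriented_map" where
  "cross_map = (let P = \<lparr>edges = cross, rot = cross_rot, outer = {}\<rparr>
     in P\<lparr>outer := face_of P (lower_out Ell)\<rparr>)"

lemma cross_map_simps [simp]: "edges cross_map = cross" "rot cross_map = cross_rot"
  by (simp_all add: cross_map_def Let_def)

lemma outer_cross_map: "outer cross_map = face_of cross_map (lower_out Ell)"
  by (simp add: cross_map_def Let_def face_of_def face_step_def[abs_def])

lemma fst_step_top: "a \<in> edges C \<Longrightarrow> is_top a \<Longrightarrow> fst (face_step C (a, True)) \<in> edges C
    \<and> left_face (fst (face_step C (a, True))) = right_face a"
  and fst_step_not_top: "a \<in> edges C \<Longrightarrow> \<not> is_top a \<Longrightarrow> fst (face_step C (a, True)) \<in> edges C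
    \<and> right_face (fst (face_step C (a, True))) = right_face a"
  using face_step_eq[of "(a, True)"] step_top[of a] step_not_top[of a] by auto

lemma fst_step_bot: "a \<in> edges C \<Longrightarrow> is_bot a \<Longrightarrow> fst (face_step C (a, False)) \<in> edges C
    \<and> right_face (fst (face_step C (a, False))) = left_face a"
  and fst_step_not_bot: "a \<in> edges C \<Longrightarrow> \<not> is_bot a \<Longrightarrow> fst (face_step C (a, False)) \<in> edges C
    \<and> left_face (fst (face_step C (a, False))) = left_face a"
  using face_step_eq[of "(a, False)"] step_bot[of a] step_not_bot[of a] by auto

lemma upper_out_in: "a \<in> edges C \<Longrightarrow> a \<noteq> Arr \<Longrightarrow> fst (upper_out a) \<in> cross"
  using lower_in_cross[of a] fst_step_top[of a] left_neq_Ell[of a "fst (face_step C (a, True))"]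
  by (auto simp: upper_out_def cross_def)

lemma lower_in_in: "b \<in> edges C \<Longrightarrow> b \<noteq> Ell \<Longrightarrow> fst (lower_in b) \<in> cross"
  using upper_in_cross[of b] fst_step_bot[of b] right_neq_Arr[of "fst (face_step C (b, False))" b]
  by (auto simp: lower_in_def cross_def)

lemma cross_rot_in: assumes "fst h \<in> cross" shows "fst (cross_rot h) \<in> cross"
proof -
  obtain a b out where h: "h = ((a, b), out)" by (metis prod.collapse)
  have ab: "(a, b) \<in> cross" using assms h by simp
  note D = crossD[OF ab]
  show ?thesis
  proof (cases out)
    case True
    show ?thesis
    proof (cases "is_bot b")
      case False
      then have "is_top a" using D by blast
      then show ?thesis
        using True h ab False fst_step_not_bot[OF D(2) False] left_neq_Ell[OF D(1) _ D(3), of "fst (face_step C (b, False))"] D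
        by (simp add: cross_rot_def cross_def)
    next
      case ib: True
      then show ?thesis
        using True h ab upper_out_in[of a] lower_in_in[of a] D
          by (cases "a = Ell") (simp_all add: cross_rot_def)
    qed
  next
    case False
    show ?thesis
    proof (cases "is_top a")
      case ntop: False
      then have "is_bot b" using D by blast
      then show ?thesis
        using False h ab ntop fst_step_not_top[OF D(1) ntop] right_neq_Arr[OF _ D(2,4), of "fst (face_step C (a, True))"] D
        by (simp add: cross_rot_def cross_def)
    next
      case True
      then show ?thesis
        using False h ab upper_out_in[of b] lower_in_in[of b] D
          by (cases "b = Arr") (simp_all add: cross_rot_def)
    qed
  qed
qed

lemma lateral_in: assumes "b \<in> edges C" "lateral C (b, False)"
  obtains c where "rot C (b, False) = (c, True)" "c \<in> edges C" "face_step C (c, False) = (b, False)"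
    "left_face c = left_face b" "\<not> is_bot c"
proof -
  obtain c where c: "rot C (b, False) = (c, True)"
    using assms by (cases "rot C (b, False)") (auto simp: lateral_def)
  have cE: "c \<in> edges C" using rot_in_iff[of "(b, False)"] assms c by (simp del: rot_in_iff)
  have s: "face_step C (c, False) = (b, False)" using c by (simp add: step_eq_iff)
  show ?thesis
    by (rule that[OF c cE s]) (use face_step_eq[of "(c, False)"] s cE in \<open>auto simp: is_bot_def\<close>)
qed

lemma lateral_out: assumes "a \<in> edges C" "lateral C (a, True)"
  obtains c where "rot C (a, True) = (c, False)" "c \<in> edges C" "face_step C (c, True) = (a, True)"
    "right_face c = right_face a" "\<not> is_top c"
proof -
  obtain c where c: "rot C (a, True) = (c, False)"
    using assms by (cases "rot C (a, True)") (auto simp: lateral_def)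
  have cE: "c \<in> edges C" using rot_in_iff[of "(a, True)"] assms c by (simp del: rot_in_iff)
  have s: "face_step C (c, True) = (a, True)" using c by (simp add: step_eq_iff)
  show ?thesis
    by (rule that[OF c cE s]) (use face_step_eq[of "(c, True)"] s cE in \<open>auto simp: is_top_def\<close>)
qed

lemma top_step_eq:
  assumes "a \<in> edges C" "b \<in> edges C" "right_face a = left_face b" "is_top a" "\<not> lateral C (b, False)"
  shows "face_step C (a, True) = (b, False)"
  by (rule extremal_unique)
    (use assms face_step_eq[of "(a, True)"] step_extremal[of "(a, True)"] in \<open>auto simp: is_top_def\<close>)

lemma bot_step_eq:
  assumes "a \<in> edges C" "b \<in> edges C" "right_face a = left_face b" "is_bot b" "\<not> lateral C (a, True)"
  shows "face_step C (b, False) = (a, True)"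
  by (rule extremal_unique)
    (use assms face_step_eq[of "(b, False)"] step_extremal[of "(b, False)"] in \<open>auto simp: is_bot_def\<close>)

lemma cross_rot_pred:
  assumes "fst h \<in> cross"
  shows "fst (cross_pred h) \<in> cross \<and> cross_rot (cross_pred h) = h"
proof -
  obtain a b out where h: "h = ((a, b), out)" by (metis prod.collapse)
  have ab: "(a, b) \<in> cross" using assms h by simp
  note D = crossD[OF ab]
  show ?thesis
  proof (cases out)
    case True
    show ?thesis
    proof (cases "is_top a \<and> lateral C (b, False)")
      case tl: True
      then obtain c where c: "rot C (b, False) = (c, True)" "c \<in> edges C" "face_step C (c, False) = (b, False)"
        "left_face c = left_face b" "\<not> is_bot c" using lateral_in[OF D(2)] by blast
      have "(a, c) \<in> cross" using c D tl left_neq_Ell[of a c] by (auto simp: cross_def)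
      then show ?thesis using tl c h True by (simp add: cross_pred_def cross_rot_def)
    next
      case nt: False
      have u: "upper_out a = h"
      proof (cases "is_top a")
        case t: True
        then show ?thesis using top_step_eq[OF D(1,2,5)] nt h True by (simp add: upper_out_def)
      next
        case f: False
        then have "b = bottomright (left_face b)" using D bot_iff by blast
        then show ?thesis using f h True D(5) by (simp add: upper_out_def)
      qed
      show ?thesis
      proof (cases "a = Ell")
        case True
        then have "cross_pred h = lower_out a" using nt h \<open>out\<close> by (auto simp: cross_pred_def)
        then show ?thesis using True u lower_in_cross[OF D(1,3)] bottomright[of "right_face a"] D(1)
          by (simp add: cross_rot_def lower_out_def)
      next
        case False
        then have "cross_pred h = upper_in a" using nt h \<open>out\<close> by (auto simp: cross_pred_def)
        then show ?thesis using False u upper_in_cross[OF D(1) False] topleft[of "left_face a"] D(1,3)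
          by (simp add: cross_rot_def upper_in_def)
      qed
    qed
  next
    case False
    show ?thesis
    proof (cases "is_bot b \<and> lateral C (a, True)")
      case tl: True
      then obtain c where c: "rot C (a, True) = (c, False)" "c \<in> edges C" "face_step C (c, True) = (a, True)"
        "right_face c = right_face a" "\<not> is_top c" using lateral_out[OF D(1)] by blast
      have "(c, b) \<in> cross" using c D tl right_neq_Arr[of c b] by (auto simp: cross_def)
      then show ?thesis using tl c h False by (simp add: cross_pred_def cross_rot_def)
    next
      case nt: False
      have u: "lower_in b = h"
      proof (cases "is_bot b")
        case t: True
        then show ?thesis using bot_step_eq[OF D(1,2,5)] nt h False by (simp add: lower_in_def)
      next
        case f: False
        then have "a = topleft (right_face a)" using D top_iff by blast
        then show ?thesis using f h False D(5) by (simp add: lower_in_def)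
      qed
      show ?thesis
      proof (cases "b = Arr")
        case True
        then have "cross_pred h = upper_in b" using nt h \<open>\<not> out\<close> by (auto simp: cross_pred_def)
        then show ?thesis using True u upper_in_cross[OF D(2,4)] topleft[of "left_face b"] D(2)
          by (simp add: cross_rot_def upper_in_def)
      next
        case False
        then have "cross_pred h = lower_out b" using nt h \<open>\<not> out\<close> by (auto simp: cross_pred_def)
        then show ?thesis using False u lower_in_cross[OF D(2) False] bottomright[of "right_face b"] D(2,4)
          by (simp add: cross_rot_def lower_out_def)
      qed
    qed
  qed
qed

lemma rot_map_cross: "rot_map cross_map"
proof
  show fin: "finite (edges cross_map)"
    by (rule finite_subset[of _ "edges C \<times> edges C"]) (auto simp: cross_def finite_edges)
  have finh: "finite (half_edges cross_map)" using fin by (simp add: half_edges_def)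
  show "rot cross_map permutes half_edges cross_map"
  proof (rule inj_imp_permutes[OF _ finh])
    show "inj_on (rot cross_map) (half_edges cross_map)"
    proof (rule finite_surj_inj[OF finh])
      show "half_edges cross_map \<subseteq> rot cross_map ` half_edges cross_map"
      proof
        fix h assume "h \<in> half_edges cross_map"
        then have "fst (cross_pred h) \<in> cross" "cross_rot (cross_pred h) = h"
          using cross_rot_pred[of h] by auto
        then show "h \<in> rot cross_map ` half_edges cross_map"
          by (metis cross_map_simps half_edges_iff image_eqI)
      qed
    qed
    show "x \<in> half_edges cross_map \<Longrightarrow> rot cross_map x \<in> half_edges cross_map" for x
      using cross_rot_in by simp
    show "x \<notin> half_edges cross_map \<Longrightarrow> rot cross_map x = x" for x
      by (auto simp: cross_rot_def split: prod.splits)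
  qed
qed

end

sublocale closed_map \<subseteq> P: rot_map cross_map
  by (rule rot_map_cross)

context closed_map
begin

lemma cross_step: "fst h \<in> cross \<Longrightarrow> face_step cross_map h = cross_pred (opposite h)"
  using cross_rot_pred[of "opposite h"] by (simp add: P.step_eq_iff)

definition base :: "('e closure_edge \<times> 'e closure_edge) half_edge \<Rightarrow> 'e closure_edge" where
  "base h = (if snd h then fst (fst h) else snd (fst h))"

definition anchor :: "'e closure_edge \<Rightarrow> ('e closure_edge \<times> 'e closure_edge) half_edge" where
  "anchor a = (if a = Arr then upper_in a else lower_out a)"

definition mid :: "'e closure_edge \<Rightarrow> ('e closure_edge \<times> 'e closure_edge) half_edge set" where
  "mid a = vertex_of cross_map (anchor a)"

lemma base_simps [simp]: "base ((a, b), True) = a" "base ((a, b), False) = b"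
  "base (upper_out a) = a" "base (lower_out a) = a" "base (upper_in a) = a" "base (lower_in a) = a"
  "base (anchor a) = a"
  by (auto simp: base_def upper_out_def lower_out_def upper_in_def lower_in_def anchor_def)

lemma base_rot: "base (cross_rot h) = base h"
  by (auto simp: cross_rot_def split: prod.splits)

lemma anchor_in: "a \<in> edges C \<Longrightarrow> fst (anchor a) \<in> cross"
  using lower_in_cross[of a] upper_in_cross[of a] by (auto simp: anchor_def lower_out_def upper_in_def)

lemma base_in: "fst h \<in> cross \<Longrightarrow> base h \<in> edges C"
  by (auto simp: base_def cross_def)

lemma vertex_out: assumes "(a, b) \<in> cross"
  shows "vertex_of cross_map ((a, b), True) = vertex_of cross_map (lower_out a)"
proof (cases "is_top a")
  case True
  note D = crossD[OF assms]
  from D(2) show ?thesis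
  proof (induction b rule: right_path_induct)
    case (first e)
    then show ?case using bot_iff[OF first(1)] D(5) by (simp add: lower_out_def is_bot_def)
  next
    case (step e e')
    have "(a, e') \<in> cross" using D step(2,4) True left_neq_Ell[of a e'] by (auto simp: cross_def)
    then have "cross_rot ((a, e'), True) = ((a, e), True)" using step(5) by (simp add: cross_rot_def is_bot_def)
    then show ?case using P.vertex_rot[of "((a, e'), True)"] step \<open>(a, e') \<in> cross\<close> by simp
  qed
next
  case False
  then show ?thesis using crossD[OF assms] bot_iff[of b] by (auto simp: lower_out_def)
qed

lemma vertex_in_half: assumes "(x, a) \<in> cross"
  shows "vertex_of cross_map ((x, a), False) = vertex_of cross_map (upper_in a)"
proof (cases "is_bot a")
  case True
  note D = crossD[OF assms]
  from D(1) show ?thesis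
  proof (induction x rule: left_path_back_induct)
    case (last e)
    then show ?case using top_iff[OF last(1)] D(5) by (simp add: upper_in_def is_top_def)
  next
    case (step e e')
    have "(e, a) \<in> cross" using D step(1,3) True right_neq_Arr[of e a] by (auto simp: cross_def)
    then have "cross_rot ((e, a), False) = ((e', a), False)" using step(5) by (simp add: cross_rot_def is_top_def)
    then show ?case using P.vertex_rot[of "((e, a), False)"] step \<open>(e, a) \<in> cross\<close> by simp
  qed
next
  case False
  then show ?thesis using crossD[OF assms] top_iff[of x] by (auto simp: upper_in_def)
qed

lemma vertex_of_cross: assumes "fst h \<in> cross" shows "vertex_of cross_map h = mid (base h)"
proof -
  obtain a b out where h: "h = ((a, b), out)" by (metis prod.collapse)
  have ab: "(a, b) \<in> cross" using assms h by simp
  note D = crossD[OF ab]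
  show ?thesis
  proof (cases out)
    case True
    then show ?thesis using vertex_out[OF ab] h D(3) by (simp add: mid_def anchor_def)
  next
    case False
    show ?thesis
    proof (cases "b = Arr")
      case True
      then show ?thesis using vertex_in_half[OF ab] h False by (simp add: mid_def anchor_def)
    next
      case nA: False
      have u: "(topleft (left_face b), b) \<in> cross" using upper_in_cross D by blast
      have "cross_rot (upper_in b) = upper_out b"
        using u topleft[of "left_face b"] D(2) nA by (simp add: cross_rot_def upper_in_def)
      then have "vertex_of cross_map (upper_in b) = vertex_of cross_map (upper_out b)"
        using P.vertex_rot[of "upper_in b"] u by (simp add: upper_in_def)
      also have "\<dots> = mid b"
        using vertex_out[of b] upper_out_in[OF D(2) nA] nA by (simp add: upper_out_def mid_def anchor_def)
      finally show ?thesis using vertex_in_half[OF ab] h False by simp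
    qed
  qed
qed

lemma mid_inj: assumes "a \<in> edges C" "b \<in> edges C" "mid a = mid b" shows "a = b"
proof -
  have "anchor b \<in> vertex_of cross_map (anchor a)"
    using assms anchor_in P.vertex_self[of "anchor b"] by (simp add: mid_def)
  then have "base (anchor b) = base (anchor a)"
    unfolding vertex_of_def
    by (rule fin_perm_orbit_const[OF P.fin_perm_rot, rotated]) (use assms anchor_in base_rot in auto)
  then show ?thesis by simp
qed

lemma vertex_cross_eq_iff: "fst h \<in> cross \<Longrightarrow> fst g \<in> cross \<Longrightarrow>
    vertex_of cross_map h = vertex_of cross_map g \<longleftrightarrow> base h = base g"
  using vertex_of_cross mid_inj base_in by metis

lemma vertices_cross: "vertices cross_map = mid ` edges C"
proof
  show "vertices cross_map \<subseteq> mid ` edges C"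
    using vertex_of_cross base_in by (auto simp: P.vertices_iff)
  show "mid ` edges C \<subseteq> vertices cross_map"
    by (clarsimp simp only: mid_def P.vertices_iff) (metis anchor_in cross_map_simps(1))
qed

lemma mid_iff: "fst h \<in> cross \<Longrightarrow> a \<in> edges C \<Longrightarrow> h \<in> mid a \<longleftrightarrow> base h = a"
  using P.vertex_iff[of "anchor a" h] anchor_in[of a] vertex_cross_eq_iff[of h "anchor a"] by (simp add: mid_def)

lemma mid_mem: "a \<in> edges C \<Longrightarrow> h \<in> mid a \<Longrightarrow> fst h \<in> cross"
  unfolding mid_def using P.vertex_in[of "anchor a" h] anchor_in by simp

lemma edge_origin_cross: "(a, b) \<in> cross \<Longrightarrow> edge_origin cross_map (a, b) = mid a"
  and edge_end_cross: "(a, b) \<in> cross \<Longrightarrow> edge_end cross_map (a, b) = mid b"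
  using vertex_of_cross[of "((a, b), True)"] vertex_of_cross[of "((a, b), False)"]
  by (auto simp: edge_origin_def edge_end_def)

lemma arcs_cross: "arcs cross_map = map_prod mid mid ` cross"
proof -
  have "arcs cross_map = (\<lambda>e. (edge_origin cross_map e, edge_end cross_map e)) ` cross"
    by (auto simp: arcs_def)
  also have "\<dots> = map_prod mid mid ` cross"
    by (rule image_cong) (auto simp: edge_origin_cross edge_end_cross)
  finally show ?thesis .
qed

text \<open>
  The level is the rank of the left face; the second condition excludes transitive edges.
\<close>

definition is_level :: "('e closure_edge \<Rightarrow> nat) \<Rightarrow> bool" where
  "is_level N \<longleftrightarrow> (\<forall>a b. (a, b) \<in> cross \<longrightarrow> N a < N b) \<and>
     (\<forall>a b c. (a, b) \<in> cross \<longrightarrow> (a, c) \<in> cross \<longrightarrow> N b = N c)"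

lemma is_levelD:
  "is_level N \<Longrightarrow> (a, b) \<in> cross \<Longrightarrow> N a < N b"
  "is_level N \<Longrightarrow> (a, b) \<in> cross \<Longrightarrow> (a, c) \<in> cross \<Longrightarrow> N b = N c"
  unfolding is_level_def by blast+

lemma level_ex: "\<exists>N. is_level N"
proof -
  obtain \<rho> :: "'e closure_edge half_edge set \<Rightarrow> nat"
    where r: "\<And>a. a \<in> edges C \<Longrightarrow> a \<noteq> Ell \<Longrightarrow> a \<noteq> Arr \<Longrightarrow> \<rho> (left_face a) < \<rho> (right_face a)"
    using dual_rank by blast
  let ?N = "\<lambda>a. if a = Ell then 0 else Suc (\<rho> (left_face a))"
  have "?N a < ?N b" if "(a, b) \<in> cross" for a b using r[of a] crossD[OF that] by auto
  moreover have "?N b = ?N c" if "(a, b) \<in> cross" "(a, c) \<in> cross" for a b c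
    using crossD[OF that(1)] crossD[OF that(2)] by auto
  ultimately have "is_level ?N" unfolding is_level_def by blast
  then show ?thesis by blast
qed

lemma wf_cross: "wf cross"
proof -
  obtain N where "is_level N" using level_ex by blast
  note N = is_levelD[OF this]
  have "cross \<subseteq> measure N" using N(1) by auto
  then show ?thesis by (rule wf_subset[OF wf_measure])
qed

lemma inj_on_mid: "inj_on mid (edges C)"
  using mid_inj by (auto simp: inj_on_def)

lemma cross_subset: "cross \<subseteq> edges C \<times> edges C"
  by (auto simp: cross_def)

lemma acyclic_arcs_cross: "acyclic (arcs cross_map)"
  unfolding arcs_cross using inj_on_mid cross_subset wf_acyclic[OF wf_cross] by (rule acyclic_map_prod)

lemma cross_source_iff: "is_source cross_map v \<longleftrightarrow> v = mid Ell"
proof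
  assume v: "is_source cross_map v"
  then obtain a where a: "a \<in> edges C" "v = mid a" by (auto simp: is_source_def vertices_cross)
  have "a = Ell"
  proof (rule ccontr)
    assume "a \<noteq> Ell"
    then have "upper_in a \<in> v" using mid_iff[of "upper_in a" a] upper_in_cross[of a] a by (simp add: upper_in_def)
    then show False using v by (auto simp: is_source_def upper_in_def)
  qed
  with a show "v = mid Ell" by simp
next
  assume v: "v = mid Ell"
  have "snd h" if "h \<in> v" for h
    using that v mid_mem[of Ell h] mid_iff[of h Ell] by (cases h) (auto simp: base_def cross_def split: if_splits)
  then show "is_source cross_map v" using v by (auto simp: is_source_def vertices_cross)
qed

lemma cross_sink_iff: "is_sink cross_map v \<longleftrightarrow> v = mid Arr"
proof
  assume v: "is_sink cross_map v"
  then obtain a where a: "a \<in> edges C" "v = mid a" by (auto simp: is_sink_def vertices_cross)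
  have "a = Arr"
  proof (rule ccontr)
    assume "a \<noteq> Arr"
    then have "lower_out a \<in> v" using mid_iff[of "lower_out a" a] lower_in_cross[of a] a by (simp add: lower_out_def)
    then show False using v by (auto simp: is_sink_def lower_out_def)
  qed
  with a show "v = mid Arr" by simp
next
  assume v: "v = mid Arr"
  have "\<not> snd h" if "h \<in> v" for h
    using that v mid_mem[of Arr h] mid_iff[of h Arr] by (cases h) (auto simp: base_def cross_def split: if_splits)
  then show "is_sink cross_map v" using v by (auto simp: is_sink_def vertices_cross)
qed

text \<open>
  The face of \<open>phi M\<close> containing a corner surrounds a vertex of the closure; the outer face
  surrounds both special vertices.
\<close>

definition merge :: "'e closure_edge half_edge set \<Rightarrow> 'e closure_edge half_edge set" where
  "merge v = (if v = sink C then source C else v)"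

definition center :: "('e closure_edge \<times> 'e closure_edge) half_edge \<Rightarrow> 'e closure_edge half_edge set" where
  "center h = (case h of ((a, b), out) \<Rightarrow> merge (vertex_of C
     (if out then (if is_bot b then (a, True) else (b, True)) else (if is_top a then (b, False) else (a, False)))))"

lemma top_Ell: "is_top Ell" using sink_step[OF Ell_in sink_Ell] by (simp add: is_top_def)
lemma bot_Arr: "is_bot Arr" using source_step[OF Arr_in source_vertex_Arr] by (simp add: is_bot_def)

lemma vertex_step: "fst h \<in> edges C \<Longrightarrow> vertex_of C (face_step C h) = vertex_of C (opposite h)"
  using vertex_rot[of "face_step C h"] by (simp add: rot_step)

lemma center_lower_out: "a \<in> edges C \<Longrightarrow> center (lower_out a) = merge (vertex_of C (a, True))"
  using bottomright[of "right_face a"] by (simp add: center_def lower_out_def)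

lemma center_upper_in: "a \<in> edges C \<Longrightarrow> center (upper_in a) = merge (vertex_of C (a, False))"
  using topleft[of "left_face a"] by (simp add: center_def upper_in_def)

lemma merge_special [simp]: "merge (source C) = source C" "merge (sink C) = source C"
  by (auto simp: merge_def)

lemma center_step: assumes "fst h \<in> cross" shows "center (face_step cross_map h) = center h"
proof -
  obtain a b out where h: "h = ((a, b), out)" by (metis prod.collapse)
  have ab: "(a, b) \<in> cross" using assms h by simp
  note D = crossD[OF ab]
  note st = cross_step[OF assms]
  show ?thesis
  proof (cases out)
    case True
    consider "is_bot b" "lateral C (a, True)" | "is_bot b" "\<not> lateral C (a, True)" "b = Arr"
      | "is_bot b" "\<not> lateral C (a, True)" "b \<noteq> Arr" | "\<not> is_bot b" by blast
    then show ?thesis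
    proof cases
      case 1
      then obtain c where c: "rot C (a, True) = (c, False)" "c \<in> edges C" "\<not> is_top c"
        using lateral_out[OF D(1)] by metis
      then show ?thesis using 1 st h True vertex_rot[of "(a, True)"] D(1) by (simp add: cross_pred_def center_def)
    next
      case 2
      have "vertex_of C (a, True) = source C"
        using bot_step_eq[OF D(1,2,5)] 2 vertex_step[of "(b, False)"] source_vertex_Arr D(2) by simp
      then show ?thesis using 2 st h True center_upper_in[of Arr] sink_vertex_Arr
        by (simp add: cross_pred_def center_def[of "((a, Arr), True)"])
    next
      case 3
      have "vertex_of C (a, True) = vertex_of C (b, True)"
        using bot_step_eq[OF D(1,2,5)] 3 vertex_step[of "(b, False)"] D(2) by simp
      then show ?thesis using 3 st h True center_lower_out[OF D(2)]
        by (simp add: cross_pred_def center_def[of "((a, b), True)"])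
    next
      case 4
      then show ?thesis using bot_Arr st h True center_lower_out[OF D(2)]
        by (auto simp: cross_pred_def center_def[of "((a, b), True)"])
    qed
  next
    case False
    consider "is_top a" "lateral C (b, False)" | "is_top a" "\<not> lateral C (b, False)" "a = Ell"
      | "is_top a" "\<not> lateral C (b, False)" "a \<noteq> Ell" | "\<not> is_top a" by blast
    then show ?thesis
    proof cases
      case 1
      then obtain c where c: "rot C (b, False) = (c, True)" "c \<in> edges C" "\<not> is_bot c"
        using lateral_in[OF D(2)] by metis
      then show ?thesis using 1 st h False vertex_rot[of "(b, False)"] D(2) by (simp add: cross_pred_def center_def)
    next
      case 2
      have "vertex_of C (b, False) = sink C"
        using top_step_eq[OF D(1,2,5)] 2 vertex_step[of "(a, True)"] sink_Ell D(1) by simp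
      then show ?thesis using 2 st h False center_lower_out[of Ell] source_Ell
        by (simp add: cross_pred_def center_def[of "((Ell, b), False)"])
    next
      case 3
      have "vertex_of C (b, False) = vertex_of C (a, False)"
        using top_step_eq[OF D(1,2,5)] 3 vertex_step[of "(a, True)"] D(1) by simp
      then show ?thesis using 3 st h False center_upper_in[OF D(1)]
        by (simp add: cross_pred_def center_def[of "((a, b), False)"])
    next
      case 4
      then show ?thesis using top_Ell st h False center_upper_in[OF D(1)]
        by (auto simp: cross_pred_def center_def[of "((a, b), False)"])
    qed
  qed
qed

lemma center_face: assumes "fst h \<in> cross" "fst g \<in> cross" "face_of cross_map h = face_of cross_map g"
  shows "center h = center g"
  by (rule fin_perm_orbit_const[OF P.fin_perm_step, of g h])
    (use assms center_step P.face_self[of h] in \<open>auto simp: face_of_def\<close>)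

lemma sink_corner_center_unique:
  assumes h: "fst h \<in> cross" "\<not> snd h" "\<not> snd (cross_rot h)"
    and g: "fst g \<in> cross" "\<not> snd g" "\<not> snd (cross_rot g)" and eq: "center h = center g"
  shows "h = g"
proof -
  have key: "(\<exists>a a'. h = ((a, bottomright (right_face a)), False) \<and> a \<in> edges C \<and> a' \<in> edges C \<and> rot C (a', True) = (a, False)
      \<and> center h = vertex_of C (a', True) \<and> center h \<noteq> source C) \<or>
      h = upper_in Arr \<and> center h = source C"
    if "fst h \<in> cross" "\<not> snd h" "\<not> snd (cross_rot h)" for h
  proof -
    obtain a b where hab: "h = ((a, b), False)" using \<open>\<not> snd h\<close> by (metis prod.collapse)
    have ab: "(a, b) \<in> cross" using that hab by simp
    note D = crossD[OF ab]
    show ?thesis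
    proof (cases "is_top a")
      case True
      then have "b = Arr" using that hab ab by (auto simp: cross_rot_def upper_out_def split: if_splits)
      moreover have "a = topleft (left_face b)" using True top_iff[OF D(1)] D(5) by simp
      ultimately show ?thesis using hab center_upper_in[of Arr] sink_vertex_Arr by (simp add: upper_in_def)
    next
      case False
      obtain a' where s: "face_step C (a, True) = (a', True)" using step_not_top[OF False] by blast
      have a': "a' \<in> edges C" using step_in_iff[of "(a, True)"] s D(1) by (simp del: step_in_iff)
      have r: "rot C (a', True) = (a, False)" using s by (simp add: step_eq_iff)
      have v: "vertex_of C (a, False) = vertex_of C (a', True)" using vertex_rot[of "(a', True)"] r a' by simp
      have "b = bottomright (right_face a)" using False D bot_iff[OF D(2)] by auto
      moreover have "center h = vertex_of C (a', True)"
        using hab False v origin_not_sink[OF a'] by (simp add: center_def merge_def)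
      ultimately show ?thesis using hab D(1) a' r v end_not_source[OF D(1)] by auto
    qed
  qed
  show ?thesis
    using key[OF h]
  proof
    assume "\<exists>a a'. h = ((a, bottomright (right_face a)), False) \<and> a \<in> edges C \<and> a' \<in> edges C \<and>
      rot C (a', True) = (a, False) \<and> center h = vertex_of C (a', True) \<and> center h \<noteq> source C"
    then obtain a a' where a: "h = ((a, bottomright (right_face a)), False)" "a' \<in> edges C"
      "rot C (a', True) = (a, False)" "center h = vertex_of C (a', True)" "center h \<noteq> source C" by blast
    then obtain c c' where c: "g = ((c, bottomright (right_face c)), False)" "c' \<in> edges C"
      "rot C (c', True) = (c, False)" "center g = vertex_of C (c', True)" using key[OF g] eq by metis
    have "(a', True) = (c', True)"
    proof (rule lateral_unique)
      show "vertex_of C (a', True) = vertex_of C (c', True)" using a(4) c(4) eq by metis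
    qed (simp_all add: lateral_def a(2,3) c(2,3))
    then have "a = c" using a(3) c(3) by simp
    then show ?thesis using a(1) c(1) by metis
  next
    assume "h = upper_in Arr \<and> center h = source C"
    then show ?thesis using key[OF g] eq by metis
  qed
qed

lemma bipolar_cross: "bipolar_orientation cross_map"
proof -
  interpret P: bipolar_rot cross_map
  proof
    show "edges cross_map \<noteq> {}" using lower_in_cross[OF Ell_in] by auto
  qed (use acyclic_arcs_cross cross_source_iff cross_sink_iff in auto)
  show ?thesis
  proof (rule P.bipolar_orientationI)
    show "outer cross_map \<in> faces cross_map"
      unfolding outer_cross_map P.faces_iff
      by (rule exI[of _ "lower_out Ell"]) (use lower_in_cross[OF Ell_in] in \<open>simp add: lower_out_def\<close>)
  next
    fix h g assume hg: "h \<in> half_edges cross_map" "g \<in> half_edges cross_map" "vertex_of cross_map h = vertex_of cross_map g"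
      "\<not> snd h" "\<not> snd g" "snd (rot cross_map h)" "snd (rot cross_map g)"
    have key: "h = upper_in (base h)" if "fst h \<in> cross" "\<not> snd h" "snd (cross_rot h)" for h
    proof -
      obtain a b where hab: "h = ((a, b), False)" using \<open>\<not> snd h\<close> by (metis (full_types) prod.collapse)
      have "is_top a" using that hab by (auto simp: cross_rot_def split: if_splits)
      then show ?thesis using crossD[of a b] that hab top_iff[of a] by (auto simp: upper_in_def)
    qed
    have "base h = base g" using vertex_cross_eq_iff hg by simp
    then show "h = g" using key[of h] key[of g] hg by simp
  next
    fix h g assume hg: "h \<in> half_edges cross_map" "g \<in> half_edges cross_map" "face_of cross_map h = face_of cross_map g"
      "\<not> snd h" "\<not> snd g" "\<not> snd (rot cross_map h)" "\<not> snd (rot cross_map g)"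
    then show "h = g" using sink_corner_center_unique[of h g] center_face[of h g] by simp
  qed
qed

end

sublocale closed_map \<subseteq> P: bipolar_map cross_map
  by unfold_locales (rule bipolar_cross)

context closed_map
begin

lemma source_cross: "source cross_map = mid Ell" and sink_cross: "sink cross_map = mid Arr"
  using P.source P.sink cross_source_iff cross_sink_iff by auto

lemma face_cross_iff: assumes "fst h \<in> cross" "fst g \<in> cross"
  shows "face_of cross_map h = face_of cross_map g \<longleftrightarrow> center h = center g"
proof
  assume eq: "center h = center g"
  have ex: "\<exists>x. fst x \<in> cross \<and> \<not> snd x \<and> \<not> snd (cross_rot x) \<and> face_of cross_map x = face_of cross_map h"
    if "fst h \<in> cross" for h
  proof -
    have "face_of cross_map h \<in> faces cross_map" using that by (simp only: P.faces_iff cross_map_simps) blast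
    then obtain x where "fst x \<in> edges cross_map" "snd x = False" "\<not> lateral cross_map x"
      "face_of cross_map h = face_of cross_map x" by (rule P.extremal_ex)
    then show ?thesis by (intro exI[of _ x]) (auto simp: lateral_def)
  qed
  obtain x y where x: "fst x \<in> cross" "\<not> snd x" "\<not> snd (cross_rot x)" "face_of cross_map x = face_of cross_map h"
    and y: "fst y \<in> cross" "\<not> snd y" "\<not> snd (cross_rot y)" "face_of cross_map y = face_of cross_map g"
    using ex[OF assms(1)] ex[OF assms(2)] by blast
  have "center x = center y" using x y eq center_face assms by metis
  then show "face_of cross_map h = face_of cross_map g" using sink_corner_center_unique[OF x(1-3) y(1-3)] x y by simp
qed (use center_face assms in blast)

lemma lower_out_in: "a \<in> edges C \<Longrightarrow> a \<noteq> Arr \<Longrightarrow> fst (lower_out a) \<in> cross"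
  and upper_in_in: "b \<in> edges C \<Longrightarrow> b \<noteq> Ell \<Longrightarrow> fst (upper_in b) \<in> cross"
  using lower_in_cross upper_in_cross by (auto simp: lower_out_def upper_in_def)

lemma outer_cross_iff: "fst h \<in> cross \<Longrightarrow> h \<in> outer cross_map \<longleftrightarrow> center h = source C"
  unfolding outer_cross_map
  using P.face_iff[of "lower_out Ell" h] face_cross_iff[of h "lower_out Ell"] lower_out_in[OF Ell_in]
    center_lower_out[OF Ell_in] source_Ell by simp

lemma plane_cross: "plane_bipolar_orientation cross_map"
proof -
  have "lower_out Ell \<in> mid Ell \<inter> outer cross_map"
    using mid_iff[of "lower_out Ell" Ell] outer_cross_iff[of "lower_out Ell"] lower_out_in[OF Ell_in]
      center_lower_out[OF Ell_in] source_Ell by simp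
  moreover have "upper_in Arr \<in> mid Arr \<inter> outer cross_map"
    using mid_iff[of "upper_in Arr" Arr] outer_cross_iff[of "upper_in Arr"] upper_in_in[OF Arr_in]
      center_upper_in[OF Arr_in] sink_vertex_Arr by simp
  ultimately show ?thesis
    unfolding plane_bipolar_orientation_def outer_vertex_def source_cross sink_cross
    using bipolar_cross vertices_cross by auto
qed

lemma card_vertices_cross: "card (vertices cross_map) = card (edges C)"
  unfolding vertices_cross using mid_inj by (intro card_image) (auto simp: inj_on_def)

lemma card_inner_cross: "card (inner_faces cross_map) = card (nonspecial_vertices C)"
proof -
  have img: "center ` half_edges cross_map = insert (source C) (nonspecial_vertices C)"
  proof
    have in1: "merge (vertex_of C g) \<in> insert (source C) (nonspecial_vertices C)" if "fst g \<in> edges C" for g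
    proof -
      have "vertex_of C g \<in> vertices C" using that vertices_iff by blast
      then show ?thesis by (simp add: merge_def nonspecial_vertices_def)
    qed
    show "center ` half_edges cross_map \<subseteq> insert (source C) (nonspecial_vertices C)"
    proof
      fix v assume "v \<in> center ` half_edges cross_map"
      then obtain a b out where v: "v = center ((a, b), out)" and ab: "(a, b) \<in> cross" by auto
      show "v \<in> insert (source C) (nonspecial_vertices C)"
        unfolding v center_def using crossD[OF ab] by (simp only: prod.case) (rule in1, simp)
    qed
    have "source C \<in> center ` half_edges cross_map"
      using center_lower_out[OF Ell_in] lower_out_in[OF Ell_in] source_Ell
      by (intro image_eqI[of _ _ "lower_out Ell"]) auto
    moreover have "v \<in> center ` half_edges cross_map" if v: "v \<in> nonspecial_vertices C" for v
    proof -
      obtain h where h: "fst h \<in> edges C" "snd h = True" "lateral C h" "v = vertex_of C h"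
        using lateral_ex[OF v] by metis
      then obtain a' where a': "h = (a', True)" by (cases h) auto
      then obtain c where c: "rot C (a', True) = (c, False)" "c \<in> edges C" "\<not> is_top c"
        using lateral_out[of a'] h by auto
      have cv: "vertex_of C (c, False) = v" using vertex_rot[of h] c a' h by simp
      have "c \<noteq> Arr" using cv v sink_vertex_Arr by (auto simp: nonspecial_vertices_def)
      then have "((c, bottomright (right_face c)), False) \<in> half_edges cross_map" using lower_in_cross[OF c(2)] by simp
      moreover have "center ((c, bottomright (right_face c)), False) = v"
        using c(3) cv v by (simp add: center_def merge_def nonspecial_vertices_def)
      ultimately show ?thesis by (metis image_eqI)
    qed
    ultimately show "insert (source C) (nonspecial_vertices C) \<subseteq> center ` half_edges cross_map" by blast
  qed
  have "card (faces cross_map) = card (center ` half_edges cross_map)"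
    unfolding faces_def by (rule card_image_cong_kernel) (use face_cross_iff in simp)
  also have "\<dots> = Suc (card (nonspecial_vertices C))"
    unfolding img using finite_vertices by (subst card_insert_disjoint) (auto simp: nonspecial_vertices_def)
  finally show ?thesis
    unfolding inner_faces_def using P.outer_in P.finite_faces by simp
qed

lemma not_transitive_cross: assumes "e \<in> cross" shows "\<not> transitive_edge cross_map e"
proof
  obtain a b where e: "e = (a, b)" by force
  have ab: "(a, b) \<in> cross" using assms e by simp
  note D = crossD[OF ab]
  obtain N where "is_level N" using level_ex by blast
  note N = is_levelD[OF this]
  assume "transitive_edge cross_map e"
  then obtain k where k: "k \<ge> 2" "(mid a, mid b) \<in> arcs cross_map ^^ k"
    using ab e by (auto simp: transitive_edge_def edge_origin_cross edge_end_cross)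
  then have "(a, b) \<in> cross ^^ k" using relpow_map_prod[OF inj_on_mid cross_subset D(1)] mid_inj D(2)
    unfolding arcs_cross by metis
  moreover obtain k' where k': "k = Suc k'" "k' > 0" using k(1) by (cases k) auto
  ultimately obtain c where c: "(a, c) \<in> cross" "(c, b) \<in> cross ^^ k'"
    using relpow_Suc_D2 by metis
  then have "(c, b) \<in> cross\<^sup>+" using k'(2) by (auto simp: trancl_power)
  then have "N c < N b" by (induction rule: trancl_induct) (auto dest: N(1))
  with N(2)[OF ab c(1)] show False by simp
qed

lemma Ell_Arr_not_cross: "(Ell, Arr) \<notin> cross"
proof
  assume "(Ell, Arr) \<in> cross"
  note D = crossD[OF this]
  have "face_step C (Ell, True) = (Arr, False)"
    by (rule top_step_eq[OF D(1,2,5) top_Ell]) (rule sink_extremal[OF Arr_in sink_vertex_Arr])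
  with step_Ell_neq show False by simp
qed

lemma N_avoiding_cross: "N_avoiding cross_map"
proof -
  have "snd (cross_rot ((a, b), True)) = False \<or> snd (cross_rot ((a, b), False))" if ab: "(a, b) \<in> cross" for a b
    using crossD[OF ab] ab top_Ell bot_Arr Ell_Arr_not_cross
    by (cases "is_bot b"; cases "is_top a"; cases "a = Ell"; cases "b = Arr")
      (auto simp: cross_rot_def lower_in_def upper_out_def)
  then show ?thesis by (auto simp: P.N_avoiding_iff lateral_def)
qed

lemma poset_cross: "plane_bipolar_poset cross_map"
  unfolding plane_bipolar_poset_def
proof (intro conjI ballI)
  show "plane_bipolar_orientation cross_map" by (rule plane_cross)
  obtain N where "is_level N" using level_ex by blast
  note N = is_levelD[OF this]
  define b where "b = fst (face_step C (Ell, True))"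
  have "fst (upper_out Ell) \<in> cross" using upper_out_in[OF Ell_in] by simp
  then have "(Ell, b) \<in> cross" using top_Ell by (simp add: upper_out_def b_def)
  then have "{Ell, Arr, b} \<subseteq> edges C" "b \<noteq> Ell" "b \<noteq> Arr" using Ell_Arr_not_cross crossD[of Ell b] by auto
  then have "card {Ell, Arr, b} \<le> card (edges C)" "card {Ell, Arr, b} = 3"
    using card_mono[OF finite_edges, of "{Ell, Arr, b}"] by simp_all
  then show "3 \<le> card (vertices cross_map)" by (simp add: card_vertices_cross)
  show "inj_on (\<lambda>e. {edge_origin cross_map e, edge_end cross_map e}) (edges cross_map)"
  proof (rule inj_onI)
    fix e e' assume e: "e \<in> edges cross_map" "e' \<in> edges cross_map"
      and eq: "{edge_origin cross_map e, edge_end cross_map e} = {edge_origin cross_map e', edge_end cross_map e'}"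
    obtain a b c d where ab: "e = (a, b)" "e' = (c, d)" by force
    have cr: "(a, b) \<in> cross" "(c, d) \<in> cross" using e ab by auto
    have "{mid a, mid b} = {mid c, mid d}" using eq cr ab by (simp add: edge_origin_cross edge_end_cross)
    then have "a = c \<and> b = d \<or> a = d \<and> b = c"
      using mid_inj crossD[OF cr(1)] crossD[OF cr(2)] by (metis doubleton_eq_iff)
    then show "e = e'" using N[OF cr(1)] N[OF cr(2)] ab by auto
  qed
  show "\<not> transitive_edge cross_map e" if "e \<in> edges cross_map" for e
    using that not_transitive_cross by simp
qed

end

context plane_map
begin

lemma phi_edges_eq: "phi_edges M = C.cross"
proof -
  have inner: "f \<in> inner_faces C \<longleftrightarrow> f \<in> faces C \<and> f \<noteq> outer C" for f by (auto simp: inner_faces_def)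
  have "(a, b) \<in> phi_edges M \<longleftrightarrow> (a, b) \<in> C.cross" for a b
  proof
    assume "(a, b) \<in> phi_edges M"
    then obtain f where f0: "f \<in> inner_faces C"
      and ab: "a \<in> left_lateral_path C f \<and> b = bottomright_edge C f \<or> a = topleft_edge C f \<and> b \<in> right_lateral_path C f"
      unfolding phi_edges_def Let_def by blast
    have f: "f \<in> faces C" "f \<noteq> outer C" using f0 inner by blast+
    have "a \<in> edges C \<and> C.right_face a = f" if "a \<in> left_lateral_path C f" for a
      using that C.face_mem[OF f(1), of "(a, True)"] by (simp add: left_lateral_path_def)
    moreover have "b \<in> edges C \<and> C.left_face b = f" if "b \<in> right_lateral_path C f" for b
      using that C.face_mem[OF f(1), of "(b, False)"] by (simp add: right_lateral_path_def)
    ultimately have "a \<in> edges C \<and> b \<in> edges C \<and> C.right_face a = f \<and> C.left_face b = f \<and> (C.is_top a \<or> C.is_bot b)"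
      using ab C.topleft[OF f(1)] C.bottomright[OF f(1)] by blast
    then show "(a, b) \<in> C.cross" using f C.right_outer_iff[of a] C.left_outer_iff[of b] by (auto simp: C.cross_def)
  next
    assume ab: "(a, b) \<in> C.cross"
    note D = C.crossD[OF ab]
    let ?f = "C.right_face a"
    have f: "?f \<in> inner_faces C" using D C.right_outer_iff[of a] inner by simp
    have "a \<in> left_lateral_path C ?f" "b \<in> right_lateral_path C ?f"
      using D C.face_self[of "(a, True)"] C.face_self[of "(b, False)"] by (auto simp: left_lateral_path_def right_lateral_path_def)
    moreover have "a = topleft_edge C ?f \<or> b = bottomright_edge C ?f" using D C.top_iff[of a] C.bot_iff[of b] by auto
    ultimately show "(a, b) \<in> phi_edges M" unfolding phi_edges_def Let_def using f by blast
  qed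
  then show ?thesis by auto
qed

lemma phi_rot_eq: "phi_rot M = C.cross_rot"
proof
  fix h :: "('e closure_edge \<times> 'e closure_edge) half_edge"
  obtain a b out where h: "h = ((a, b), out)" by (metis prod.collapse)
  show "phi_rot M h = C.cross_rot h"
  proof (cases "(a, b) \<in> C.cross")
    case True
    note D = C.crossD[OF True]
    have "first_outgoing C x = C.upper_out x" if "x \<in> edges C" for x
      using C.top_iff[OF that] by (simp add: first_outgoing_def C.upper_out_def Let_def)
    moreover have "first_ingoing C x = C.lower_in x" if "x \<in> edges C" for x
      using C.bot_iff[OF that] by (simp add: first_ingoing_def C.lower_in_def Let_def)
    ultimately show ?thesis
      using True h D C.top_iff[OF D(1)] C.bot_iff[OF D(2)]
      by (simp add: phi_rot_def C.cross_rot_def phi_edges_eq Let_def)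
  next
    case False
    then show ?thesis using h by (simp add: phi_rot_def C.cross_rot_def phi_edges_eq Let_def)
  qed
qed

lemma phi_eq: "phi M = C.cross_map"
  by (simp add: phi_def C.cross_map_def phi_edges_eq phi_rot_eq Let_def C.lower_out_def)

lemma phi_poset: "plane_bipolar_poset (phi M)" and phi_N_avoiding: "N_avoiding (phi M)"
  using C.poset_cross C.N_avoiding_cross by (simp_all add: phi_eq)

lemma card_edges_closure: "card (edges C) = card (edges M) + 2"
proof -
  have "card (Old ` edges M \<union> {Ell, Arr}) = card (Old ` edges M) + card {Ell, Arr :: 'e closure_edge}"
    by (rule card_Un_disjoint) (auto simp: finite_edges)
  then show ?thesis by (simp add: edges_closure card_image inj_on_def)
qed

lemma card_vertices_closure: "card (vertices C) = card (vertices M)"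
  unfolding vertices_closure using closure_vertex_inj by (simp add: card_image inj_on_def)

lemma card_nonspecial_phi: "card (nonspecial_vertices (phi M)) = card (edges M)"
  using C.P.card_nonspecial C.card_vertices_cross card_edges_closure by (simp add: phi_eq)

lemma card_inner_phi: "card (inner_faces (phi M)) = card (nonspecial_vertices M)"
  using C.card_inner_cross C.card_nonspecial card_nonspecial card_vertices_closure by (simp add: phi_eq)

end

section \<open>Lateral corners of phi M\<close>

text \<open>
  \<open>lateral_next P h h'\<close>: the lateral corner \<open>h'\<close> follows \<open>h\<close> in its face, where the outer face is
  split into the two special faces and \<open>P\<close> is a poset, so that each side of a face has a lateral
  corner.
\<close>

definition lateral_next :: "'e oriented_map \<Rightarrow> 'e half_edge \<Rightarrow> 'e half_edge \<Rightarrow> bool" where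
  "lateral_next P h h' \<longleftrightarrow> (let x = face_step P h in
     if snd x = snd h then h' = x
     else if x \<notin> outer P then h' = face_step P x
     else \<exists>c \<in> outer P. \<not> lateral P c \<and> snd c = snd h \<and> h' = face_step P c)"

text \<open>
  \<open>M\<close> is the dual of \<open>P\<close> described by \<open>psi\<close>, where \<open>k\<close> sends the half-edges of \<open>M\<close> to the lateral
  corners of \<open>P\<close> in which they end.
\<close>

definition corresponds ::
    "'a oriented_map \<Rightarrow> 'b oriented_map \<Rightarrow> ('a half_edge \<Rightarrow> 'b half_edge) \<Rightarrow> bool" where
  "corresponds M P k \<longleftrightarrow>
     bij_betw k (half_edges M) {h \<in> half_edges P. lateral P h} \<and>
     (\<forall>x \<in> half_edges M. snd (k x) = snd x \<and> vertex_of P (k (opposite x)) = vertex_of P (k x) \<and>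
        lateral_next P (k x) (k (rot M x))) \<and>
     (\<exists>x \<in> outer M. \<not> snd x \<and> k x \<in> outer P \<and> snd (face_step P (k x)))"

context plane_map
begin

definition phi_corner :: "'e half_edge \<Rightarrow> ('e closure_edge \<times> 'e closure_edge) half_edge" where
  "phi_corner x = (if snd x then C.lower_out (Old (fst x)) else C.upper_in (Old (fst x)))"

lemma phi_corner_simps [simp]: "snd (phi_corner x) = snd x" "C.base (phi_corner x) = Old (fst x)"
  by (auto simp: phi_corner_def C.lower_out_def C.upper_in_def)

lemma phi_corner_in: "fst x \<in> edges M \<Longrightarrow> fst (phi_corner x) \<in> C.cross"
  using C.lower_out_in[of "Old (fst x)"] C.upper_in_in[of "Old (fst x)"] by (simp add: phi_corner_def)

lemma lateral_cross: "lateral C.cross_map h \<longleftrightarrow> snd (C.cross_rot h) \<noteq> snd h"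
  by (simp add: lateral_def)

lemma cross_rot_lower_out: "a \<in> edges C \<Longrightarrow> a \<noteq> Arr \<Longrightarrow>
    C.cross_rot (C.lower_out a) = (if a = Ell then C.upper_out a else C.lower_in a)"
  using C.lower_in_cross[of a] C.bottomright[of "C.right_face a"] by (simp add: C.cross_rot_def C.lower_out_def)

lemma cross_rot_upper_in: "b \<in> edges C \<Longrightarrow> b \<noteq> Ell \<Longrightarrow>
    C.cross_rot (C.upper_in b) = (if b = Arr then C.lower_in b else C.upper_out b)"
  using C.upper_in_cross[of b] C.topleft[of "C.left_face b"] by (simp add: C.cross_rot_def C.upper_in_def)

lemma phi_corner_image: "phi_corner ` half_edges M = {h \<in> half_edges C.cross_map. lateral C.cross_map h}"
proof
  show "phi_corner ` half_edges M \<subseteq> {h \<in> half_edges C.cross_map. lateral C.cross_map h}"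
  proof
    fix h assume "h \<in> phi_corner ` half_edges M"
    then obtain x where x: "fst x \<in> edges M" "h = phi_corner x" by auto
    then show "h \<in> {h \<in> half_edges C.cross_map. lateral C.cross_map h}"
      using phi_corner_in[OF x(1)] cross_rot_lower_out[of "Old (fst x)"] cross_rot_upper_in[of "Old (fst x)"]
      by (simp add: lateral_cross phi_corner_def C.lower_in_def C.upper_out_def C.lower_out_def C.upper_in_def split: if_splits)
  qed
  show "{h \<in> half_edges C.cross_map. lateral C.cross_map h} \<subseteq> phi_corner ` half_edges M"
  proof
    fix h assume h: "h \<in> {h \<in> half_edges C.cross_map. lateral C.cross_map h}"
    obtain a b out where hab: "h = ((a, b), out)" by (metis prod.collapse)
    have ab: "(a, b) \<in> C.cross" using h hab by simp
    note D = C.crossD[OF ab]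
    show "h \<in> phi_corner ` half_edges M"
    proof (cases out)
      case True
      then have "C.is_bot b" "a \<noteq> Ell"
        using h hab ab by (auto simp: lateral_cross C.cross_rot_def C.upper_out_def split: if_splits)
      moreover then obtain e where e: "a = Old e" using D(3) by (cases a) auto
      ultimately have "h = phi_corner (e, True)" using hab True D C.bot_iff[of b] by (simp add: phi_corner_def C.lower_out_def)
      with e D(1) show ?thesis by (auto intro!: image_eqI[of _ _ "(e, True)"])
    next
      case False
      then have "C.is_top a" "b \<noteq> Arr"
        using h hab ab by (auto simp: lateral_cross C.cross_rot_def C.lower_in_def split: if_splits)
      moreover then obtain e where e: "b = Old e" using D(4) by (cases b) auto
      ultimately have "h = phi_corner (e, False)" using hab False D C.top_iff[of a] by (simp add: phi_corner_def C.upper_in_def)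
      with e D(2) show ?thesis by (auto intro!: image_eqI[of _ _ "(e, False)"])
    qed
  qed
qed

lemma bij_phi_corner: "bij_betw phi_corner (half_edges M) {h \<in> half_edges C.cross_map. lateral C.cross_map h}"
proof -
  have "inj_on phi_corner (half_edges M)"
  proof (rule inj_onI)
    fix x y assume "phi_corner x = phi_corner y"
    then have "Old (fst x) = Old (fst y)" "snd x = snd y" by (metis phi_corner_simps)+
    then show "x = y" by (simp add: prod_eq_iff)
  qed
  then show ?thesis by (simp add: bij_betw_def phi_corner_image)
qed

lemma rot_old_lateral: "fst x \<in> edges M \<Longrightarrow> lateral C (old x) \<Longrightarrow> rot C (old x) = old (rot M x)"
  by (auto simp: lateral_def)

lemma center_inner: "fst x \<in> edges C \<Longrightarrow> lateral C x \<Longrightarrow> C.merge (vertex_of C (rot C x)) \<noteq> source C"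
  using C.lateral_nonspecial[of x] C.vertex_rot[of x] by (auto simp: C.merge_def nonspecial_vertices_def)

lemma outer_extremal_cross:
  "C.upper_in Arr \<in> outer C.cross_map" "\<not> lateral C.cross_map (C.upper_in Arr)"
  "C.lower_out Ell \<in> outer C.cross_map" "\<not> lateral C.cross_map (C.lower_out Ell)"
  using C.outer_cross_iff[of "C.upper_in Arr"] C.upper_in_in[of Arr] C.center_upper_in[of Arr] C.sink_vertex_Arr
    C.outer_cross_iff[of "C.lower_out Ell"] C.lower_out_in[of Ell] C.center_lower_out[of Ell] C.source_Ell
    cross_rot_lower_out[of Ell] cross_rot_upper_in[of Arr]
  by (auto simp: lateral_cross C.lower_out_def C.upper_out_def C.upper_in_def C.lower_in_def)

lemma lateral_next_phi_out:
  assumes a: "a \<in> edges M"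
  shows "lateral_next C.cross_map (phi_corner (a, True)) (phi_corner (rot M (a, True)))"
proof -
  define b where "b = bottomright_edge C (C.right_face (Old a))"
  have ab: "(Old a, b) \<in> C.cross" using C.lower_in_cross[of "Old a"] a by (simp add: b_def)
  note D = C.crossD[OF ab]
  have bot: "C.is_bot b" using C.bottomright[of "C.right_face (Old a)"] a by (simp add: b_def)
  have k: "phi_corner (a, True) = ((Old a, b), True)" by (simp add: phi_corner_def C.lower_out_def b_def)
  have step: "face_step C.cross_map ((Old a, b), True) = C.cross_pred ((Old a, b), False)"
    using C.cross_step[of "((Old a, b), True)"] ab by simp
  show ?thesis
  proof (cases "lateral C (Old a, True)")
    case True
    then obtain c where c: "rot C (Old a, True) = (c, False)" "c \<in> edges C"
      "C.right_face c = C.right_face (Old a)" "\<not> C.is_top c" using C.lateral_out[OF D(1)] by metis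
    have r: "rot C (Old a, True) = old (rot M (a, True))" using rot_old_lateral[of "(a, True)"] a True by simp
    obtain c' where c': "c = Old c'" "rot M (a, True) = (c', False)"
      using c(1) r by (cases "rot M (a, True)") auto
    have cb: "(c, b) \<in> C.cross" using c D bot C.right_neq_Arr[of c b] by (simp add: C.cross_def)
    have s1: "face_step C.cross_map ((Old a, b), True) = ((c, b), False)"
      using step bot True c(1) by (simp add: C.cross_pred_def)
    have "C.center ((c, b), False) \<noteq> source C"
      using center_inner[OF _ True] c(1,4) D(1) by (simp add: C.center_def)
    then have o: "((c, b), False) \<notin> outer C.cross_map" using C.outer_cross_iff[of "((c, b), False)"] cb by simp
    have s2: "face_step C.cross_map ((c, b), False) = C.upper_in c"
      using C.cross_step[of "((c, b), False)"] cb c(4) c'(1) by (simp add: C.cross_pred_def)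
    show ?thesis using k s1 o s2 c' by (simp add: lateral_next_def Let_def phi_corner_def)
  next
    case False
    have f: "face_step C (b, False) = (Old a, True)" by (rule C.bot_step_eq[OF D(1,2,5) bot False])
    then have r: "rot C (Old a, True) = (b, True)" by (simp add: C.step_eq_iff)
    have r': "rot C (old (a, True)) = (b, True)" using r by simp
    show ?thesis
    proof (cases "b = Arr")
      case False
      then obtain b' where b': "b = Old b'" using D(4) by (cases b) auto
      have "old (rot M (a, True)) = (Old b', True)"
        using r' b' by (simp del: old_simps(1) split: if_splits)
      then have "rot M (a, True) = (b', True)" by (cases "rot M (a, True)") simp
      moreover have "face_step C.cross_map ((Old a, b), True) = C.lower_out b"
        using step \<open>\<not> lateral C (Old a, True)\<close> False by (simp add: C.cross_pred_def)
      ultimately show ?thesis using k b' by (simp add: lateral_next_def Let_def phi_corner_def C.lower_out_def)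
    next
      case True
      then have cs': "(a, True) = cs" using r' by (auto simp del: old_simps(1) split: if_splits)
      have s1: "face_step C.cross_map ((Old a, b), True) = C.upper_in Arr"
        using step \<open>\<not> lateral C (Old a, True)\<close> True by (simp add: C.cross_pred_def)
      define d where "d = bottomright_edge C (C.right_face Ell)"
      have Ed: "(Ell, d) \<in> C.cross" using C.lower_in_cross[of Ell] by (simp add: d_def)
      note Dd = C.crossD[OF Ed]
      have dA: "d \<noteq> Arr" using Ed C.Ell_Arr_not_cross by auto
      have "face_step C (d, False) = (Ell, True)"
        by (rule C.bot_step_eq[OF Dd(1,2,5)]) (use C.bottomright[of "C.right_face Ell"] in \<open>simp_all add: d_def\<close>)
      then have "rot C (Ell, True) = (d, True)" by (simp add: C.step_eq_iff)
      then have rd: "old (rot M cs) = (d, True)" by simp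
      obtain d' where d': "d = Old d'" using dA Dd(4) by (cases d) auto
      have "rot M cs = (d', True)" using rd d' by (cases "rot M cs") auto
      then have "phi_corner (rot M (a, True)) = C.lower_out d" using cs' d' by (simp add: phi_corner_def)
      moreover have "face_step C.cross_map (C.lower_out Ell) = C.lower_out d"
        using C.cross_step[of "C.lower_out Ell"] Ed dA by (simp add: C.cross_pred_def C.lower_out_def d_def)
      ultimately show ?thesis
        using k s1 outer_extremal_cross
        by (auto simp: lateral_next_def Let_def C.upper_in_def C.lower_out_def intro!: bexI[of _ "C.lower_out Ell"])
    qed
  qed
qed

lemma lateral_next_phi_in:
  assumes a: "a \<in> edges M"
  shows "lateral_next C.cross_map (phi_corner (a, False)) (phi_corner (rot M (a, False)))"
proof -
  define t where "t = topleft_edge C (C.left_face (Old a))"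
  have ab: "(t, Old a) \<in> C.cross" using C.upper_in_cross[of "Old a"] a by (simp add: t_def)
  note D = C.crossD[OF ab]
  have top: "C.is_top t" using C.topleft[of "C.left_face (Old a)"] a by (simp add: t_def)
  have k: "phi_corner (a, False) = ((t, Old a), False)" by (simp add: phi_corner_def C.upper_in_def t_def)
  have step: "face_step C.cross_map ((t, Old a), False) = C.cross_pred ((t, Old a), True)"
    using C.cross_step[of "((t, Old a), False)"] ab by simp
  show ?thesis
  proof (cases "lateral C (Old a, False)")
    case True
    then obtain c where c: "rot C (Old a, False) = (c, True)" "c \<in> edges C"
      "C.left_face c = C.left_face (Old a)" "\<not> C.is_bot c" using C.lateral_in[OF D(2)] by metis
    have r: "rot C (Old a, False) = old (rot M (a, False))" using rot_old_lateral[of "(a, False)"] a True by simp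
    obtain c' where c': "c = Old c'" "rot M (a, False) = (c', True)"
      using c(1) r by (cases "rot M (a, False)") auto
    have tc: "(t, c) \<in> C.cross" using c D top C.left_neq_Ell[of t c] by (simp add: C.cross_def)
    have s1: "face_step C.cross_map ((t, Old a), False) = ((t, c), True)"
      using step top True c(1) by (simp add: C.cross_pred_def)
    have "C.center ((t, c), True) \<noteq> source C"
      using center_inner[OF _ True] c(1,4) D(2) by (simp add: C.center_def)
    then have o: "((t, c), True) \<notin> outer C.cross_map" using C.outer_cross_iff[of "((t, c), True)"] tc by simp
    have s2: "face_step C.cross_map ((t, c), True) = C.lower_out c"
      using C.cross_step[of "((t, c), True)"] tc c(4) c'(1) by (simp add: C.cross_pred_def)
    show ?thesis using k s1 o s2 c' by (simp add: lateral_next_def Let_def phi_corner_def)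
  next
    case False
    have f: "face_step C (t, True) = (Old a, False)" by (rule C.top_step_eq[OF D(1,2,5) top False])
    then have r': "rot C (old (a, False)) = (t, False)" by (simp add: C.step_eq_iff)
    show ?thesis
    proof (cases "t = Ell")
      case False
      then obtain t' where t': "t = Old t'" using D(3) by (cases t) auto
      have "old (rot M (a, False)) = (Old t', False)"
        using r' t' by (simp del: old_simps(1) split: if_splits)
      then have "rot M (a, False) = (t', False)" by (cases "rot M (a, False)") simp
      moreover have "face_step C.cross_map ((t, Old a), False) = C.upper_in t"
        using step \<open>\<not> lateral C (Old a, False)\<close> False by (simp add: C.cross_pred_def)
      ultimately show ?thesis using k t' by (simp add: lateral_next_def Let_def phi_corner_def C.upper_in_def)
    next
      case True
      then have ct': "(a, False) = ct" using r' by (auto simp del: old_simps(1) split: if_splits)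
      have s1: "face_step C.cross_map ((t, Old a), False) = C.lower_out Ell"
        using step \<open>\<not> lateral C (Old a, False)\<close> True by (simp add: C.cross_pred_def)
      define d where "d = topleft_edge C (C.left_face Arr)"
      have Ed: "(d, Arr) \<in> C.cross" using C.upper_in_cross[of Arr] by (simp add: d_def)
      note Dd = C.crossD[OF Ed]
      have dA: "d \<noteq> Ell" using Ed C.Ell_Arr_not_cross by auto
      have lA: "\<not> lateral C (Arr, False)" by simp
      have "face_step C (d, True) = (Arr, False)"
        by (rule C.top_step_eq[OF Dd(1,2,5)]) (use C.topleft[of "C.left_face Arr"] in \<open>simp_all add: d_def\<close>)
      then have "rot C (Arr, False) = (d, False)" by (simp add: C.step_eq_iff)
      then have rd: "old (rot M ct) = (d, False)" by simp
      obtain d' where d': "d = Old d'" using dA Dd(3) by (cases d) auto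
      have "rot M ct = (d', False)" using rd d' by (cases "rot M ct") auto
      then have "phi_corner (rot M (a, False)) = C.upper_in d" using ct' d' by (simp add: phi_corner_def)
      moreover have "face_step C.cross_map (C.upper_in Arr) = C.upper_in d"
        using C.cross_step[of "C.upper_in Arr"] Ed dA by (simp add: C.cross_pred_def C.upper_in_def d_def)
      ultimately show ?thesis
        using k s1 outer_extremal_cross
        by (auto simp: lateral_next_def Let_def C.upper_in_def C.lower_out_def intro!: bexI[of _ "C.upper_in Arr"])
    qed
  qed
qed

lemma corresponds_phi: "corresponds M (phi M) phi_corner"
  unfolding corresponds_def phi_eq
proof (intro conjI ballI)
  show "bij_betw phi_corner (half_edges M) {h \<in> half_edges C.cross_map. lateral C.cross_map h}"
    by (rule bij_phi_corner)
next
  fix x assume x: "x \<in> half_edges M"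
  show "snd (phi_corner x) = snd x" by simp
  show "vertex_of C.cross_map (phi_corner (opposite x)) = vertex_of C.cross_map (phi_corner x)"
    using C.vertex_cross_eq_iff[of "phi_corner (opposite x)" "phi_corner x"] phi_corner_in[of x]
      phi_corner_in[of "opposite x"] x by simp
  show "lateral_next C.cross_map (phi_corner x) (phi_corner (rot M x))"
    using lateral_next_phi_out[of "fst x"] lateral_next_phi_in[of "fst x"] x by (cases x; cases "snd x") auto
next
  obtain e where e: "ct = (e, False)" using ct_snd(1) by (cases ct) auto
  have eE: "e \<in> edges M" using ct_edge e by simp
  have f: "face_step C (Ell, True) = (Old e, False)" using step_closure(1) e by simp
  have lf: "C.left_face (Old e) = C.right_face Ell" using C.face_step_eq[of "(Ell, True)"] f by simp
  have t: "topleft_edge C (C.left_face (Old e)) = Ell" using C.top_iff[of Ell] C.top_Ell lf by simp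
  have k: "phi_corner ct = ((Ell, Old e), False)" using e t by (simp add: phi_corner_def C.upper_in_def)
  have cr: "(Ell, Old e) \<in> C.cross" using C.upper_in_cross[of "Old e"] eE t by simp
  have "C.center (C.upper_in (Old e)) = source C"
    using C.center_upper_in[of "Old e"] eE vertex_of_old[OF ct_edge] ct_vertex e vertex_of_closure(3) C.sink_Ell C.merge_special(2) by simp
  then have "phi_corner ct \<in> outer C.cross_map"
    using C.outer_cross_iff[of "phi_corner ct"] k cr e by (simp add: phi_corner_def)
  moreover have "\<not> lateral C (Old e, False)"
    using lateral_closure(1)[of ct] e by (simp add: lateral_def ct_snd[unfolded e])
  then have "snd (face_step C.cross_map (phi_corner ct))"
    using C.cross_step[of "phi_corner ct"] k cr by (simp add: C.cross_pred_def C.lower_out_def)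
  ultimately show "\<exists>x\<in>outer M. \<not> snd x \<and> phi_corner x \<in> outer C.cross_map \<and> snd (face_step C.cross_map (phi_corner x))"
    using ct(2) ct_snd(1) by blast
qed

end

section \<open>Lateral corners of plane bipolar posets and psi\<close>

locale plane_poset = plane_map P for P :: "'e oriented_map" +
  assumes poset: "plane_bipolar_poset P"
begin

lemma rot_fixed_vertex: "rot P h = h \<Longrightarrow> vertex_of P h = {h}"
proof -
  assume r: "rot P h = h"
  have "x = h" if "x \<in> orbit (rot P) h" for x using that by induct (simp_all add: r)
  moreover have "h \<in> orbit (rot P) h" using orbit.base[of "rot P" h] r by simp
  ultimately show ?thesis unfolding vertex_of_def by blast
qed

lemma nonspecial_nonempty: "nonspecial_vertices P \<noteq> {}"
  using poset card_nonspecial unfolding plane_bipolar_poset_def by fastforce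

lemma no_digon:
  assumes g: "g \<in> edges P" and "face_step P (g, True) = (g, False)" "face_step P (g, False) = (g, True)"
  shows False
proof -
  have r: "rot P (g, True) = (g, True)" "rot P (g, False) = (g, False)" using assms(2,3) by (simp_all add: step_eq_iff)
  then have v: "vertex_of P (g, True) = {(g, True)}" "vertex_of P (g, False) = {(g, False)}"
    by (simp_all add: rot_fixed_vertex)
  have "is_source P (vertex_of P (g, True))"
    unfolding is_source_def using v(1) g vertices_iff[of "vertex_of P (g, True)"] by (metis fst_conv singletonD snd_conv)
  moreover have "is_sink P (vertex_of P (g, False))"
    unfolding is_sink_def using v(2) g vertices_iff[of "vertex_of P (g, False)"] by (metis fst_conv singletonD snd_conv)
  ultimately have sv: "source P = {(g, True)}" "sink P = vertex_of P (g, False)" using source_eq sink_eq v by metis+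
  obtain w where w: "w \<in> vertices P" "w \<noteq> source P" "w \<noteq> sink P"
    using nonspecial_nonempty by (auto simp: nonspecial_vertices_def)
  obtain u where u: "(source P, u) \<in> arcs P" "(u, w) \<in> (arcs P)\<^sup>*"
    using reachable_from_source[OF w(1)] w(2) by (metis converse_rtranclE)
  obtain e where e: "e \<in> edges P" "source P = vertex_of P (e, True)" "u = vertex_of P (e, False)"
    using u(1) arcs_iff by blast
  have "e = g" using vertex_self[of "(e, True)"] e(1,2) sv(1) by (metis fst_conv prod.inject singletonD)
  then have "u = sink P" using e sv by simp
  then obtain u' where "(sink P, u') \<in> arcs P" using u(2) w(3) by (metis converse_rtranclE)
  then obtain e where "e \<in> edges P" "sink P = vertex_of P (e, True)" using arcs_iff by blast
  then show False using vertex_self[of "(e, True)"] sink_snd by force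
qed

lemma parallel_path:
  assumes e: "e \<in> edges P" "p \<in> edges P" and "edge_origin P p = edge_origin P e" "edge_end P q = edge_end P e"
    and j: "(edge_origin P p, edge_end P q) \<in> arcs P ^^ j" "j \<ge> 1" "j = 1 \<Longrightarrow> q = p"
  shows "p = e \<and> q = e"
proof -
  have "\<not> transitive_edge P e" using poset e by (simp add: plane_bipolar_poset_def)
  then have "j = 1" using j assms(3,4) unfolding transitive_edge_def by (metis One_nat_def Suc_1 le_antisym not_less_eq_eq)
  then have qp: "q = p" using j by simp
  have "inj_on (\<lambda>e. {edge_origin P e, edge_end P e}) (edges P)" using poset by (simp add: plane_bipolar_poset_def)
  then have "p = e" by (rule inj_onD) (use assms qp in simp_all)
  with qp show ?thesis by simp
qed

lemma left_path_relpow: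
  assumes "x \<in> edges P"
  shows "\<exists>y j. y \<in> edges P \<and> face_of P (y, True) = face_of P (x, True) \<and> \<not> lateral P (y, True) \<and>
    (edge_origin P y, edge_end P x) \<in> arcs P ^^ j \<and> j \<ge> 1 \<and> (j = 1 \<longrightarrow> x = y)"
  using assms
proof (induction x rule: left_path_induct)
  case (first e)
  then show ?case by (intro exI[of _ e] exI[of _ 1]) (auto simp: arcs_def)
next
  case (step e e')
  then obtain y j where y: "y \<in> edges P" "face_of P (y, True) = face_of P (x, True)" "\<not> lateral P (y, True)"
    "(edge_origin P y, edge_end P e) \<in> arcs P ^^ j" "j \<ge> 1" by metis
  moreover have "(edge_end P e, edge_end P e') \<in> arcs P"
    using step(2,6) by (auto simp: precedes_def arcs_def)
  ultimately show ?case using step(4) by (intro exI[of _ y] exI[of _ "Suc j"]) auto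
qed

lemma right_path_relpow:
  assumes "x \<in> edges P"
  shows "\<exists>y j. y \<in> edges P \<and> face_of P (y, False) = face_of P (x, False) \<and> snd (face_step P (y, False)) \<and>
    (edge_origin P y, edge_end P x) \<in> arcs P ^^ j \<and> j \<ge> 1 \<and> (j = 1 \<longrightarrow> x = y)"
  using assms
proof (induction x rule: right_path_induct)
  case (first e)
  then show ?case by (intro exI[of _ e] exI[of _ 1]) (auto simp: arcs_def)
next
  case (step e e')
  then obtain y j where y: "y \<in> edges P" "face_of P (y, False) = face_of P (x, False)" "snd (face_step P (y, False))"
    "(edge_origin P y, edge_end P e) \<in> arcs P ^^ j" "j \<ge> 1" by metis
  moreover have "(edge_end P e, edge_end P e') \<in> arcs P"
    using step(2,6) by (auto simp: precedes_def arcs_def)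
  ultimately show ?case using step(4) by (intro exI[of _ y] exI[of _ "Suc j"]) auto
qed

lemma lateral_step_iff: "lateral P (face_step P h) \<longleftrightarrow> snd (face_step P h) = snd h"
  by (auto simp: lateral_def rot_step)

text \<open>Otherwise one side of the face would be a single edge, which would be a transitive or multiple edge.\<close>

lemma extremal_step:
  assumes h: "fst h \<in> edges P" "\<not> lateral P h"
  shows "snd (face_step P h) = snd h"
proof (rule ccontr)
  assume n: "snd (face_step P h) \<noteq> snd h"
  define y where "y = fst (face_step P h)"
  define k where "k = fst (rot P h)"
  define g where "g = fst h"
  have gE: "g \<in> edges P" "y \<in> edges P" "k \<in> edges P" using h by (simp_all add: g_def y_def k_def)
  have next_ext: "\<not> lateral P (face_step P h)" using n lateral_step_iff by simp
  show False
  proof (cases "snd h")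
    case False
    have hg: "h = (g, False)" and s: "face_step P h = (y, True)" and r: "rot P h = (k, False)"
      using False n h(2) by (auto simp: g_def y_def k_def prod_eq_iff lateral_def)
    have fk: "face_step P (k, True) = (g, False)" using r hg by (simp add: step_eq_iff)
    have face_k: "face_of P (k, True) = face_of P (y, True)"
      using face_step_eq[of "(k, True)"] face_step_eq[of h] fk s hg gE by simp
    obtain y' j where y': "y' \<in> edges P" "face_of P (y', True) = face_of P (k, True)" "\<not> lateral P (y', True)"
      "(edge_origin P y', edge_end P k) \<in> arcs P ^^ j" "j \<ge> 1" "j = 1 \<longrightarrow> k = y'"
      using left_path_relpow[OF gE(3)] by blast
    have "(y', True) = (y, True)" by (rule extremal_unique) (use y' gE face_k next_ext s in auto)
    then have yy: "y' = y" by simp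
    have o: "edge_origin P y = edge_origin P g"
      using vertex_rot[of "(y, True)"] s hg gE by (simp add: edge_origin_def step_eq_iff)
    have t: "edge_end P k = edge_end P g"
      using vertex_rot[of "(g, False)"] r hg gE by (simp add: edge_end_def)
    have "y = g \<and> k = g" by (rule parallel_path[OF gE(1,2) o t]) (use y' yy in auto)
    then show False using no_digon[OF gE(1)] fk s hg by simp
  next
    case True
    have hg: "h = (g, True)" and s: "face_step P h = (y, False)" and r: "rot P h = (k, True)"
      using True n h(2) by (auto simp: g_def y_def k_def prod_eq_iff lateral_def)
    have fk: "face_step P (k, False) = (g, True)" using r hg by (simp add: step_eq_iff)
    have face_k: "face_of P (k, False) = face_of P (y, False)"
      using face_step_eq[of "(k, False)"] face_step_eq[of h] fk s hg gE by simp
    obtain k' j where k': "k' \<in> edges P" "face_of P (k', False) = face_of P (y, False)" "snd (face_step P (k', False))"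
      "(edge_origin P k', edge_end P y) \<in> arcs P ^^ j" "j \<ge> 1" "j = 1 \<longrightarrow> y = k'"
      using right_path_relpow[OF gE(2)] by blast
    have "face_step P (k', False) = face_step P (k, False)"
    proof (rule extremal_unique)
      show "face_of P (face_step P (k', False)) = face_of P (face_step P (k, False))"
        using face_step_eq[of "(k', False)"] face_step_eq[of "(k, False)"] k' gE face_k by simp
      show "\<not> lateral P (face_step P (k', False))" "\<not> lateral P (face_step P (k, False))"
        using lateral_step_iff[of "(k', False)"] lateral_step_iff[of "(k, False)"] k'(3) fk by auto
    qed (use k' gE fk in auto)
    then have kk: "k' = k" by (simp add: step_inj)
    have o: "edge_origin P k = edge_origin P g"
      using vertex_rot[of "(g, True)"] r hg gE by (simp add: edge_origin_def)
    have t: "edge_end P y = edge_end P g"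
      using vertex_rot[of "(y, False)"] s hg gE by (simp add: edge_end_def step_eq_iff)
    have "k = g \<and> y = g" by (rule parallel_path[OF gE(1,3) o t]) (use k' kk in auto)
    then show False using no_digon[OF gE(1)] fk s hg by simp
  qed
qed

lemma extremal_step_lateral: "fst h \<in> edges P \<Longrightarrow> \<not> lateral P h \<Longrightarrow> lateral P (face_step P h)"
  using extremal_step lateral_step_iff by simp

lemma before_extremal_lateral: "fst h \<in> edges P \<Longrightarrow> \<not> lateral P h \<Longrightarrow> lateral P (opposite (rot P h))"
  using extremal_step[of "opposite (rot P h)"] by (auto simp: step_opposite_rot lateral_def)

definition other_corner :: "bool \<Rightarrow> 'e half_edge" where
  "other_corner b = (if b then ct else cs)"

lemma other_corner: "other_corner b \<in> outer P" "\<not> lateral P (other_corner b)" "snd (other_corner b) = (\<not> b)"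
    "fst (other_corner b) \<in> edges P"
  using cs(2) ct(2) cs_edge ct_edge by (auto simp: other_corner_def lateral_def)

lemma other_corner_eq: "x \<in> outer P \<Longrightarrow> \<not> lateral P x \<Longrightarrow> x = other_corner (\<not> snd x)"
  using outer_extremal[of x] by (auto simp: other_corner_def)

definition lateral_prev :: "'e half_edge \<Rightarrow> 'e half_edge" where
  "lateral_prev h = (let g = opposite (rot P h) in
     if lateral P g then g
     else if g \<notin> outer P then opposite (rot P g)
     else opposite (rot P (other_corner (snd g))))"

lemma lateral_next_iff_prev:
  assumes "lateral P h" "lateral P h'"
  shows "lateral_next P h h' \<longleftrightarrow> h = lateral_prev h'"
proof -
  define g where "g = opposite (rot P h')"
  have g: "face_step P g = h'" "snd g = snd h'"
    using assms(2) by (auto simp: g_def step_opposite_rot lateral_def)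
  define x where "x = face_step P h"
  have x: "opposite (rot P x) = h" by (simp add: x_def rot_step)
  show ?thesis
  proof
    assume n: "lateral_next P h h'"
    consider "snd x = snd h" "h' = x" | "snd x \<noteq> snd h" "x \<notin> outer P" "h' = face_step P x"
      | c where "snd x \<noteq> snd h" "x \<in> outer P" "c \<in> outer P" "\<not> lateral P c" "snd c = snd h" "h' = face_step P c"
      using n unfolding lateral_next_def Let_def x_def[symmetric] by (metis (full_types))
    then show "h = lateral_prev h'"
    proof cases
      case 1
      then have "g = h" using g x_def step_inj by simp
      then show ?thesis using assms by (simp add: lateral_prev_def g_def[symmetric] Let_def)
    next
      case 2
      then have "g = x" using g step_inj by simp
      then show ?thesis using 2(1,2) x lateral_step_iff[of h, folded x_def] by (simp add: lateral_prev_def g_def[symmetric] Let_def)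
    next
      case 3
      then have "g = c" using g step_inj by simp
      moreover have "x = other_corner (snd c)"
        using other_corner_eq[of x] 3 lateral_step_iff[of h] by (simp add: x_def)
      ultimately show ?thesis using 3(3,4) x by (simp add: lateral_prev_def g_def[symmetric] Let_def)
    qed
  next
    assume h: "h = lateral_prev h'"
    consider "lateral P g" "h = g" | "\<not> lateral P g" "g \<notin> outer P" "h = opposite (rot P g)"
      | "\<not> lateral P g" "g \<in> outer P" "h = opposite (rot P (other_corner (snd g)))"
      using h unfolding lateral_prev_def g_def[symmetric] Let_def by (auto split: if_splits)
    then show "lateral_next P h h'"
    proof cases
      case 1
      then show ?thesis using g by (simp add: lateral_next_def Let_def)
    next
      case 2
      then have "x = g" "snd x \<noteq> snd h" by (auto simp: x_def step_opposite_rot lateral_def)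
      then show ?thesis using g(1) 2(2) by (simp add: lateral_next_def Let_def x_def[symmetric])
    next
      case 3
      then have "x = other_corner (snd g)" by (simp add: x_def step_opposite_rot)
      then have "x \<in> outer P" "snd x = (\<not> snd g)" using other_corner by simp_all
      moreover have sh: "snd h = snd g" using 3(3) other_corner(2,3)[of "snd g"] by (simp add: lateral_def)
      ultimately show ?thesis unfolding lateral_next_def Let_def x_def[symmetric]
        using g(1) 3(1,2) by (auto intro!: bexI[of _ g])
    qed
  qed
qed

lemma lateral_next_unique:
  assumes "lateral_next P h x" "lateral_next P h y"
  shows "x = y"
proof -
  have "c = c'" if "c \<in> outer P" "\<not> lateral P c" "c' \<in> outer P" "\<not> lateral P c'" "snd c = snd c'" for c c'
    using other_corner_eq[OF that(1,2)] other_corner_eq[OF that(3,4)] that(5) by simp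
  then show ?thesis using assms unfolding lateral_next_def Let_def by (auto split: if_splits)
qed

lemma lateral_next_ex:
  assumes h: "fst h \<in> edges P" "lateral P h"
  obtains h' where "lateral_next P h h'" "lateral P h'" "fst h' \<in> edges P"
    "first_hit (face_step C) (old ` {h \<in> half_edges P. lateral P h}) (old h) = old h'"
proof -
  let ?A = "old ` {h \<in> half_edges P. lateral P h}"
  have hit: "first_hit f A x = (f ^^ n) x" if "n > 0" "(f ^^ n) x \<in> A" "\<And>k. 0 < k \<Longrightarrow> k < n \<Longrightarrow> (f ^^ k) x \<notin> A"
    for f :: "'x \<Rightarrow> 'x" and A x n
  proof -
    have "(LEAST k. k > 0 \<and> (f ^^ k) x \<in> A) = n"
      by (rule Least_equality) (use that in \<open>auto simp: not_less[symmetric]\<close>)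
    then show ?thesis by (simp add: first_hit_def)
  qed
  define x where "x = face_step P h"
  have xE: "fst x \<in> edges P" using h by (simp add: x_def)
  have A: "old z \<in> ?A \<longleftrightarrow> lateral P z" if "fst z \<in> edges P" for z using that by (simp only: in_old_image) simp
  have nsc: "z \<noteq> cs \<and> z \<noteq> ct" if "lateral P z" for z using that by (auto simp: lateral_def)
  show ?thesis
  proof (cases "snd x = snd h")
    case True
    then have l: "lateral P x" using lateral_step_iff[of h] by (simp add: x_def)
    then have "face_step C (old h) = old x" using nsc[of x] by (simp add: x_def)
    then show ?thesis
      using that[of x] hit[of 1 "face_step C" "old h" ?A] True xE l A[OF xE] by (simp add: lateral_next_def x_def)
  next
    case False
    then have l: "\<not> lateral P x" using lateral_step_iff[of h] by (simp add: x_def)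
    show ?thesis
    proof (cases "x \<in> outer P")
      case out: False
      define h' where "h' = face_step P x"
      have l': "lateral P h'" "fst h' \<in> edges P" using extremal_step_lateral[OF xE l] xE by (simp_all add: h'_def)
      have "face_step C (old h) = old x" using out cs(2) ct(2) by (auto simp: x_def)
      moreover have "face_step C (old x) = old h'" using nsc[OF l'(1)] by (simp add: h'_def)
      ultimately have "first_hit (face_step C) ?A (old h) = old h'"
        using hit[of 2 "face_step C" "old h" ?A] A[OF xE] A[OF l'(2)] l l'(1)
        by (simp add: numeral_2_eq_2 less_Suc_eq)
      moreover have "lateral_next P h h'" using False out by (simp add: lateral_next_def x_def h'_def)
      ultimately show ?thesis using that l' by blast
    next
      case out: True
      have xo: "x = other_corner (\<not> snd x)" using other_corner_eq[OF out l] .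
      define c where "c = other_corner (\<not> snd h)"
      have c: "c \<in> outer P" "\<not> lateral P c" "snd c = snd h" "fst c \<in> edges P" using other_corner by (auto simp: c_def)
      define h' where "h' = face_step P c"
      have l': "lateral P h'" "fst h' \<in> edges P" using extremal_step_lateral[OF c(4,2)] c(4) by (simp_all add: h'_def)
      define m where "m = (if snd h then (Arr, False) else (Ell, True) :: 'e closure_edge half_edge)"
      have s1: "face_step C (old h) = m" using xo False by (auto simp: x_def m_def other_corner_def)
      have s2: "face_step C m = old c" by (simp add: m_def c_def other_corner_def)
      have s3: "face_step C (old c) = old h'" using nsc[OF l'(1)] by (simp add: h'_def)
      have mA: "m \<notin> ?A" by (simp add: m_def)
      have "(face_step C ^^ 3) (old h) = old h'" by (simp add: numeral_3_eq_3 s1 s2 s3 del: step_closure)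
      moreover have "(face_step C ^^ k) (old h) \<notin> ?A" if "0 < k" "k < 3" for k
      proof -
        from that have "k = 1 \<or> k = 2" by auto
        then show ?thesis using s1 s2 mA A[OF c(4)] c(2) by (elim disjE) (simp_all add: numeral_2_eq_2 del: step_closure)
      qed
      ultimately have "first_hit (face_step C) ?A (old h) = old h'"
        using hit[of 3 "face_step C" "old h" ?A] A[OF l'(2)] l'(1) by simp
      moreover have "lateral_next P h h'" using False out c by (auto simp: lateral_next_def x_def h'_def)
      ultimately show ?thesis using that l' by blast
    qed
  qed
qed

lemma lateral_corner_eq:
  assumes h: "fst h \<in> edges P" "lateral P h"
  shows "lateral_corner P (vertex_of P h, snd h) = h"
proof -
  have u: "g = h" if "g \<in> vertex_of P h" "snd g = snd h" "lateral P g" for g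
    using that h lateral_unique[of g h] vertex_in[OF h(1) that(1)] vertex_eq[OF h(1) that(1)] by simp
  show ?thesis
  proof (cases "snd h")
    case True
    have "right_lateral_corner P (vertex_of P h) = h"
      unfolding right_lateral_corner_def
      by (rule the_equality) (use u True h vertex_self in \<open>auto simp: lateral_def\<close>)
    then show ?thesis using True by (simp add: lateral_corner_def)
  next
    case False
    have "left_lateral_corner P (vertex_of P h) = h"
      unfolding left_lateral_corner_def
      by (rule the_equality) (use u False h vertex_self in \<open>auto simp: lateral_def\<close>)
    then show ?thesis using False by (simp add: lateral_corner_def)
  qed
qed

lemma lateral_corner_nonspecial:
  assumes "v \<in> nonspecial_vertices P"
  shows "fst (lateral_corner P (v, b)) \<in> edges P \<and> snd (lateral_corner P (v, b)) = b \<and>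
    lateral P (lateral_corner P (v, b)) \<and> vertex_of P (lateral_corner P (v, b)) = v"
proof -
  obtain h where h: "fst h \<in> edges P" "snd h = b" "lateral P h" "v = vertex_of P h" using lateral_ex[OF assms] .
  then have "lateral_corner P (v, b) = h" using lateral_corner_eq[OF h(1,3)] by simp
  with h show ?thesis by simp
qed

lemma bij_lateral_corner:
  "bij_betw (lateral_corner P) (nonspecial_vertices P \<times> UNIV) {h \<in> half_edges P. lateral P h}"
proof (rule bij_betw_byWitness[of _ "\<lambda>h. (vertex_of P h, snd h)"])
  show "\<forall>x\<in>nonspecial_vertices P \<times> UNIV. (vertex_of P (lateral_corner P x), snd (lateral_corner P x)) = x"
    using lateral_corner_nonspecial by auto
  show "\<forall>h\<in>{h \<in> half_edges P. lateral P h}. lateral_corner P (vertex_of P h, snd h) = h"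
    using lateral_corner_eq by auto
  show "lateral_corner P ` (nonspecial_vertices P \<times> UNIV) \<subseteq> {h \<in> half_edges P. lateral P h}"
    using lateral_corner_nonspecial by auto
  show "(\<lambda>h. (vertex_of P h, snd h)) ` {h \<in> half_edges P. lateral P h} \<subseteq> nonspecial_vertices P \<times> UNIV"
    using lateral_nonspecial by auto
qed

lemma lateral_corners_eq: "lateral_corners P = {h \<in> half_edges P. lateral P h}"
  using bij_lateral_corner unfolding bij_betw_def lateral_corners_def by blast

lemma psi_half_edge_old:
  assumes h: "fst h \<in> edges P" "lateral P h"
  shows "psi_half_edge P (old h) = (vertex_of P h, snd h)"
  unfolding psi_half_edge_def
proof (rule the_equality)
  show "(vertex_of P h, snd h) \<in> nonspecial_vertices P \<times> UNIV \<and>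
      old (lateral_corner P (vertex_of P h, snd h)) = old h"
    using lateral_nonspecial[OF h] lateral_corner_eq[OF h] by simp
  fix x assume x: "x \<in> nonspecial_vertices P \<times> UNIV \<and> old (lateral_corner P x) = old h"
  then show "x = (vertex_of P h, snd h)" using lateral_corner_nonspecial[of "fst x" "snd x"] by auto
qed

lemma psi_simps: "edges (psi P) = nonspecial_vertices P" "rot (psi P) = psi_rot P"
  by (simp_all add: psi_def Let_def)

lemma psi_rot_next:
  assumes x: "fst x \<in> nonspecial_vertices P"
  shows "fst (psi_rot P x) \<in> nonspecial_vertices P \<and>
    lateral_next P (lateral_corner P x) (lateral_corner P (psi_rot P x))"
proof -
  have lx: "fst (lateral_corner P x) \<in> edges P" "lateral P (lateral_corner P x)"
    using lateral_corner_nonspecial[OF x, of "snd x"] by simp_all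
  obtain h' where h': "lateral_next P (lateral_corner P x) h'" "lateral P h'" "fst h' \<in> edges P"
    "first_hit (face_step C) (old ` {h \<in> half_edges P. lateral P h}) (old (lateral_corner P x)) = old h'"
    by (rule lateral_next_ex[OF lx])
  then have "psi_rot P x = (vertex_of P h', snd h')" using x psi_half_edge_old[OF h'(3,2)] by (simp add: psi_rot_def lateral_corners_eq)
  then show ?thesis using h' lateral_corner_eq lateral_nonspecial by simp
qed

lemma rot_map_psi: "rot_map (psi P)"
proof
  show fin: "finite (edges (psi P))" using finite_vertices by (simp add: psi_simps nonspecial_vertices_def)
  show "rot (psi P) permutes half_edges (psi P)"
  proof (rule inj_imp_permutes)
    show "finite (half_edges (psi P))" using fin by (simp add: half_edges_def)
    show "x \<in> half_edges (psi P) \<Longrightarrow> rot (psi P) x \<in> half_edges (psi P)" for x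
      using psi_rot_next[of x] by (simp add: psi_simps)
    show "x \<notin> half_edges (psi P) \<Longrightarrow> rot (psi P) x = x" for x
      by (simp add: psi_simps psi_rot_def)
    show "inj_on (rot (psi P)) (half_edges (psi P))"
    proof (rule inj_onI)
      fix x y assume xy: "x \<in> half_edges (psi P)" "y \<in> half_edges (psi P)" "rot (psi P) x = rot (psi P) y"
      then have x: "fst x \<in> nonspecial_vertices P" and y: "fst y \<in> nonspecial_vertices P" by (simp_all add: psi_simps)
      have lat: "lateral P (lateral_corner P z)" if "fst z \<in> nonspecial_vertices P" for z
        using lateral_corner_nonspecial[OF that, of "snd z"] by simp
      have "lateral_corner P x = lateral_corner P y"
        using psi_rot_next[OF x] psi_rot_next[OF y] xy(3) lateral_next_iff_prev[OF lat[OF x] lat[of "psi_rot P x"]]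
          lateral_next_iff_prev[OF lat[OF y] lat[of "psi_rot P y"]] by (simp add: psi_simps)
      then show "x = y"
        by (rule inj_onD[OF bij_betw_imp_inj_on[OF bij_lateral_corner]]) (use x y in \<open>simp_all add: mem_Times_iff\<close>)
    qed
  qed
qed

lemma outer_psi:
  defines "z \<equiv> opposite (rot P cs)"
  shows "fst z \<in> edges P" "lateral P z" "\<not> snd z" "face_step P z = cs"
    "outer (psi P) = face_of (psi P) (vertex_of P z, False)"
proof -
  show z: "fst z \<in> edges P" "lateral P z" "\<not> snd z" "face_step P z = cs"
    using cs_edge before_extremal_lateral[of cs] by (auto simp: z_def step_opposite_rot lateral_def)
  have i: "inv (face_step C) (Ell, True) = old z"
  proof (rule inv_f_eq)
    show "inj (face_step C)" by (simp only: inj_def C.step_inj) simp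
    show "face_step C (old z) = (Ell, True)" using z(4) by simp
  qed
  have "(LEAST k. k > 0 \<and> (inv (face_step C) ^^ k) (Ell, True) \<in> old ` lateral_corners P) = 1"
    by (rule Least_equality) (use i z in \<open>simp_all add: lateral_corners_eq\<close>)
  then have "first_hit (inv (face_step C)) (old ` lateral_corners P) (Ell, True) = old z"
    using i by (simp add: first_hit_def)
  then show "outer (psi P) = face_of (psi P) (vertex_of P z, False)"
    using psi_half_edge_old[OF z(1,2)] z(3)
    by (simp add: psi_def Let_def face_of_def face_step_def[abs_def])
qed

lemma outer_psi_face: "outer (psi P) \<in> faces (psi P)"
proof -
  interpret Q: rot_map "psi P" by (rule rot_map_psi)
  show ?thesis
    unfolding outer_psi(5) Q.faces_iff
    by (rule exI[of _ "(vertex_of P (opposite (rot P cs)), False)"])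
      (use lateral_nonspecial[OF outer_psi(1,2)] in \<open>simp add: psi_simps\<close>)
qed

lemma corresponds_psi: "corresponds (psi P) P (lateral_corner P)"
  unfolding corresponds_def
proof (intro conjI ballI)
  show "bij_betw (lateral_corner P) (half_edges (psi P)) {h \<in> half_edges P. lateral P h}"
    using bij_lateral_corner by (simp add: half_edges_def[of "psi P"] psi_simps)
next
  fix x assume "x \<in> half_edges (psi P)"
  then have x: "fst x \<in> nonspecial_vertices P" by (simp add: psi_simps)
  show "snd (lateral_corner P x) = snd x" "vertex_of P (lateral_corner P (opposite x)) = vertex_of P (lateral_corner P x)"
    using lateral_corner_nonspecial[OF x] by (cases x; simp)+
  show "lateral_next P (lateral_corner P x) (lateral_corner P (rot (psi P) x))"
    using psi_rot_next[OF x] by (simp add: psi_simps)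
next
  define z where "z = opposite (rot P cs)"
  note z = outer_psi[folded z_def]
  have zo: "z \<in> outer P" using outer_step_iff[OF z(1)] z(4) cs(2) by simp
  interpret Q: rot_map "psi P" by (rule rot_map_psi)
  have "(vertex_of P z, False) \<in> outer (psi P)"
    unfolding z(5) by (rule Q.face_self) (use lateral_nonspecial[OF z(1,2)] in \<open>simp add: psi_simps\<close>)
  moreover have "lateral_corner P (vertex_of P z, False) = z" using lateral_corner_eq[OF z(1,2)] z(3) by simp
  ultimately show "\<exists>x\<in>outer (psi P). \<not> snd x \<and> lateral_corner P x \<in> outer P \<and> snd (face_step P (lateral_corner P x))"
    using z(4) zo by (intro bexI[of _ "(vertex_of P z, False)"]) auto
qed

end

section \<open>Recovering both maps from the lateral corners\<close>

locale dual_pair = P: plane_poset P + M: rot_map M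
  for P :: "'b oriented_map" and M :: "'a oriented_map" +
  fixes k :: "'a half_edge \<Rightarrow> 'b half_edge"
  assumes corresponds: "corresponds M P k"
    and avoiding: "N_avoiding P"
    and outer_face: "outer M \<in> faces M"
begin

lemma k_bij: "bij_betw k (half_edges M) {h \<in> half_edges P. lateral P h}"
  using corresponds unfolding corresponds_def by blast

lemma k_in: "fst x \<in> edges M \<Longrightarrow> fst (k x) \<in> edges P"
  and k_lateral: "fst x \<in> edges M \<Longrightarrow> lateral P (k x)"
  using bij_betwE[OF k_bij] by auto

lemma k_snd: "fst x \<in> edges M \<Longrightarrow> snd (k x) = snd x"
  and k_vertex: "fst x \<in> edges M \<Longrightarrow> vertex_of P (k (opposite x)) = vertex_of P (k x)"
  and k_next: "fst x \<in> edges M \<Longrightarrow> lateral_next P (k x) (k (rot M x))"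
  using corresponds unfolding corresponds_def by auto

lemma k_eq_iff: "fst x \<in> edges M \<Longrightarrow> fst y \<in> edges M \<Longrightarrow> k x = k y \<longleftrightarrow> x = y"
  using inj_on_eq_iff[OF bij_betw_imp_inj_on[OF k_bij], of x y] by simp

lemma k_ex: assumes "fst h \<in> edges P" "lateral P h"
  obtains x where "fst x \<in> edges M" "k x = h"
proof -
  have "h \<in> k ` half_edges M" using bij_betw_imp_surj_on[OF k_bij] assms by auto
  then show ?thesis using that by auto
qed

lemma k_prev: "fst x \<in> edges M \<Longrightarrow> k x = P.lateral_prev (k (rot M x))"
  using k_next[of x] P.lateral_next_iff_prev[OF k_lateral[of x] k_lateral[of "rot M x"]] by simp

lemma k_step: "fst x \<in> edges M \<Longrightarrow> k (face_step M x) = P.lateral_prev (k (opposite x))"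
  using k_prev[of "face_step M x"] by (simp add: M.rot_step)

lemma k_unique: "fst x \<in> edges M \<Longrightarrow> fst h \<in> edges P \<Longrightarrow> lateral P h \<Longrightarrow> snd h = snd x \<Longrightarrow>
    vertex_of P h = vertex_of P (k x) \<Longrightarrow> h = k x"
  using P.lateral_unique[of h "k x"] k_in k_lateral k_snd by simp

lemma avoiding_lateral: "fst h \<in> edges P \<Longrightarrow> lateral P h \<or> lateral P (opposite h)"
  using avoiding unfolding P.N_avoiding_iff by (cases h; cases "snd h") auto

text \<open>
  If the edge through the lateral corner \<open>k x\<close> is not lateral at its other end, then it is the only
  edge of its direction at the vertex of \<open>k x\<close>.
\<close>

lemma rot_k_opposite_alone:
  assumes x: "fst x \<in> edges M" and n: "\<not> lateral P (opposite (k x))"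
  shows "rot P (k (opposite x)) = k x"
proof -
  let ?o = "opposite (k x)"
  have oE: "fst ?o \<in> edges P" using k_in x by simp
  have s: "snd (face_step P ?o) = snd ?o" using P.extremal_step[OF oE n] .
  have "face_step P ?o = k (opposite x)"
  proof (rule k_unique)
    show "lateral P (face_step P ?o)" using s P.lateral_step_iff by simp
    show "snd (face_step P ?o) = snd (opposite x)" using s k_snd x by simp
    show "vertex_of P (face_step P ?o) = vertex_of P (k (opposite x))"
      using P.vertex_rot[of "face_step P ?o"] P.rot_step[of ?o] oE k_vertex[OF x] by simp
  qed (use x oE in simp_all)
  then show ?thesis using P.rot_step[of ?o] by simp
qed

lemma rot_k_opposite_in: assumes x: "fst x \<in> edges M"
  shows "fst (rot P (k (opposite x))) \<in> edges P" "snd (rot P (k (opposite x))) = snd x"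
    "vertex_of P (rot P (k (opposite x))) = vertex_of P (k x)"
  using x k_in[of "opposite x"] k_lateral[of "opposite x"] k_snd[of "opposite x"] k_vertex[of x]
    P.vertex_rot[of "k (opposite x)"]
  by (auto simp: lateral_def)

lemma rot_k_opposite:
  assumes x: "fst x \<in> edges M"
  shows "lateral P (opposite (rot P (k (opposite x)))) \<longleftrightarrow> lateral P (opposite (k x))"
    and "\<not> lateral P (opposite (k x)) \<Longrightarrow> rot P (k (opposite x)) = k x"
proof -
  show a: "rot P (k (opposite x)) = k x" if "\<not> lateral P (opposite (k x))"
    using rot_k_opposite_alone[OF x that] .
  have "rot P (k (opposite x)) = k x" if n: "\<not> lateral P (opposite (rot P (k (opposite x))))"
  proof -
    have "lateral P (rot P (k (opposite x)))"
      using avoiding_lateral[of "rot P (k (opposite x))"] n rot_k_opposite_in[OF x] by blast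
    then show ?thesis using k_unique[OF x] rot_k_opposite_in[OF x] by blast
  qed
  then show "lateral P (opposite (rot P (k (opposite x)))) \<longleftrightarrow> lateral P (opposite (k x))"
    using a by metis
qed

definition end_corner :: "bool \<Rightarrow> 'a half_edge" where
  "end_corner b = (SOME x. fst x \<in> edges M \<and> k x = opposite (rot P (P.other_corner b)))"

lemma end_corner: "fst (end_corner b) \<in> edges M" "k (end_corner b) = opposite (rot P (P.other_corner b))"
proof -
  have "fst (opposite (rot P (P.other_corner b))) \<in> edges P" "lateral P (opposite (rot P (P.other_corner b)))"
    using P.other_corner P.before_extremal_lateral by simp_all
  then obtain x where "fst x \<in> edges M" "k x = opposite (rot P (P.other_corner b))" by (rule k_ex)
  then have "fst (end_corner b) \<in> edges M \<and> k (end_corner b) = opposite (rot P (P.other_corner b))"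
    unfolding end_corner_def
    by (intro someI[of "\<lambda>x. fst x \<in> edges M \<and> k x = opposite (rot P (P.other_corner b))" x] conjI)
  then show "fst (end_corner b) \<in> edges M" "k (end_corner b) = opposite (rot P (P.other_corner b))" by auto
qed

lemma end_corner_snd: "snd (end_corner b) = b"
  using k_snd[OF end_corner(1), of b] end_corner(2)[of b] P.other_corner(2,3)[of b] by (simp add: lateral_def)

lemma k_end_corner_outer: "k (end_corner b) \<in> outer P"
  using P.outer_step_iff[of "k (end_corner b)"] k_in[OF end_corner(1)] P.other_corner(1)
  by (simp add: end_corner(2) P.step_opposite_rot)

lemma step_cases:
  assumes x: "fst x \<in> edges M"
  obtains (turn) "lateral P (opposite (k x))" "k (face_step M x) = opposite (rot P (k (opposite x)))"
      "snd (face_step M x) = (\<not> snd x)"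
  | (straight) "\<not> lateral P (opposite (k x))" "opposite (k x) \<notin> outer P"
      "k (face_step M x) = opposite (rot P (opposite (k x)))" "snd (face_step M x) = snd x"
  | (outer) "\<not> lateral P (opposite (k x))" "opposite (k x) = P.other_corner (snd x)"
      "face_step M x = end_corner (\<not> snd x)" "snd (face_step M x) = (\<not> snd x)"
proof -
  have s: "snd (face_step M x) = snd (k (face_step M x))" using k_snd[of "face_step M x"] x by simp
  show ?thesis
  proof (cases "lateral P (opposite (k x))")
    case True
    then have "k (face_step M x) = opposite (rot P (k (opposite x)))"
      using k_step[OF x] rot_k_opposite(1)[OF x] by (simp add: P.lateral_prev_def Let_def)
    moreover from this have "snd (face_step M x) = (\<not> snd x)" using s rot_k_opposite_in[OF x] by simp
    ultimately show ?thesis using turn True by blast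
  next
    case False
    note r = rot_k_opposite(2)[OF x False]
    show ?thesis
    proof (cases "opposite (k x) \<in> outer P")
      case o: False
      have "k (face_step M x) = opposite (rot P (opposite (k x)))"
        using k_step[OF x] r False o by (simp add: P.lateral_prev_def Let_def)
      moreover from this have "snd (face_step M x) = snd x"
        using s False k_snd[OF x] by (simp add: lateral_def)
      ultimately show ?thesis using straight False o by blast
    next
      case o: True
      have oc: "opposite (k x) = P.other_corner (snd x)" using P.other_corner_eq[OF o False] k_snd[OF x] by simp
      have "k (face_step M x) = k (end_corner (\<not> snd x))"
        using k_step[OF x] r False o k_snd[OF x] by (simp add: P.lateral_prev_def Let_def end_corner)
      then have "face_step M x = end_corner (\<not> snd x)" using k_eq_iff end_corner(1) x by simp
      then show ?thesis using outer False oc end_corner_snd by simp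
    qed
  qed
qed

text \<open>
  The faces of \<open>M\<close> correspond to the edges of \<open>P\<close> that are lateral at both ends; the outer face of
  \<open>M\<close> is tagged by \<open>None\<close>.
\<close>

definition tag :: "'a half_edge \<Rightarrow> 'b option" where
  "tag x = (let v = vertex_of P (opposite (k x)) in
     if v \<in> nonspecial_vertices P then Some (fst (lateral_corner P (v, \<not> snd x))) else None)"

lemma other_corner_special: "vertex_of P (P.other_corner b) \<notin> nonspecial_vertices P"
  using P.cs_vertex P.ct_vertex by (simp add: P.other_corner_def nonspecial_vertices_def)

lemma tag_turn: "fst x \<in> edges M \<Longrightarrow> lateral P (opposite (k x)) \<Longrightarrow> tag x = Some (fst (k x))"
  using P.lateral_corner_eq[of "opposite (k x)"] P.lateral_nonspecial[of "opposite (k x)"] k_in[of x] k_snd[of x]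
  by (simp add: tag_def)

lemma tag_end_corner: "tag (end_corner b) = None"
  using other_corner_special[of b] P.vertex_rot[of "P.other_corner b"] P.other_corner(4)
  by (simp add: tag_def end_corner(2))

lemma tag_step: assumes x: "fst x \<in> edges M" shows "tag (face_step M x) = tag x"
  using x
proof (cases rule: step_cases)
  case turn
  have v: "vertex_of P (opposite (k (face_step M x))) = vertex_of P (k x)"
    using turn rot_k_opposite_in(3)[OF x] by simp
  have "vertex_of P (k x) \<in> nonspecial_vertices P" using P.lateral_nonspecial k_in k_lateral x by blast
  moreover have "lateral_corner P (vertex_of P (k x), snd x) = k x"
    using P.lateral_corner_eq[of "k x"] k_in k_lateral k_snd x by simp
  ultimately show ?thesis using v turn(3) tag_turn[OF x turn(1)] by (simp add: tag_def[of "face_step M x"])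
next
  case straight
  have "vertex_of P (opposite (k (face_step M x))) = vertex_of P (opposite (k x))"
    using straight(3) P.vertex_rot[of "opposite (k x)"] k_in[OF x] by simp
  then show ?thesis using straight(4) by (simp add: tag_def Let_def)
next
  case outer
  then have "tag x = None" using other_corner_special by (simp add: tag_def)
  then show ?thesis using outer tag_end_corner by simp
qed

lemma tag_face_const: assumes "fst x \<in> edges M" "fst y \<in> edges M" "face_of M x = face_of M y"
  shows "tag x = tag y"
  by (rule fin_perm_orbit_const[OF M.fin_perm_step, of y x])
    (use assms tag_step M.face_self[of x] in \<open>auto simp: face_of_def\<close>)

lemma turn_tag_unique:
  assumes x: "fst x \<in> edges M" "snd (face_step M x) \<noteq> snd x" and y: "fst y \<in> edges M" "snd (face_step M y) \<noteq> snd y"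
    and eq: "snd x = snd y" "tag x = tag y"
  shows "x = y"
proof -
  have key: "tag x = Some (fst (k x)) \<or> tag x = None \<and> k x = opposite (P.other_corner (snd x))"
    if "fst x \<in> edges M" "snd (face_step M x) \<noteq> snd x" for x
    using that(1)
  proof (cases rule: step_cases)
    case turn
    then show ?thesis using tag_turn that by blast
  next
    case outer
    then have "tag x = None" using other_corner_special by (simp add: tag_def)
    moreover have "k x = opposite (P.other_corner (snd x))" using outer(2) by (metis opposite_simps(2))
    ultimately show ?thesis by blast
  qed (use that in simp)
  have "k x = k y" using key[OF x] key[OF y] eq k_snd[OF x(1)] k_snd[OF y(1)] by (auto simp: prod_eq_iff)
  then show ?thesis using k_eq_iff x y by blast
qed

definition dual_face :: "'a half_edge \<Rightarrow> 'b closure_edge half_edge set" where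
  "dual_face x = face_of P.C (old (k x))"

lemma face_of_old_step: assumes "fst h \<in> edges P" "face_step P h \<noteq> P.cs" "face_step P h \<noteq> P.ct"
  shows "face_of P.C (old (face_step P h)) = face_of P.C (old h)"
  using P.C.face_step_eq[of "old h"] assms by simp

lemma lateral_not_special: "lateral P h \<Longrightarrow> h \<noteq> P.cs \<and> h \<noteq> P.ct"
  by (auto simp: lateral_def)

lemma next_cases:
  assumes x: "fst x \<in> edges M"
  obtains (same) "k (rot M x) = face_step P (k x)" "snd (rot M x) = snd x"
  | (switch) "face_step P (k x) \<notin> outer P" "\<not> lateral P (face_step P (k x))" "snd (face_step P (k x)) \<noteq> snd x"
      "k (rot M x) = face_step P (face_step P (k x))" "snd (rot M x) \<noteq> snd x"
  | (last) "x = end_corner (snd x)" "k (rot M x) = face_step P (P.other_corner (\<not> snd x))" "snd (rot M x) = snd x"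
proof -
  let ?x = "face_step P (k x)"
  have E: "fst ?x \<in> edges P" using k_in x by simp
  have s: "snd (rot M x) = snd (k (rot M x))" "snd x = snd (k x)" using k_snd[of "rot M x"] k_snd[OF x] x by simp_all
  consider "snd ?x = snd (k x)" "k (rot M x) = ?x"
    | "snd ?x \<noteq> snd (k x)" "?x \<notin> outer P" "k (rot M x) = face_step P ?x"
    | c where "snd ?x \<noteq> snd (k x)" "?x \<in> outer P" "c \<in> outer P" "\<not> lateral P c" "snd c = snd (k x)"
      "k (rot M x) = face_step P c"
    using k_next[OF x] unfolding lateral_next_def Let_def by (metis (full_types))
  then show ?thesis
  proof cases
    case 1
    then show ?thesis using same s by simp
  next
    case 2
    then have "\<not> lateral P ?x" using P.lateral_step_iff by simp
    moreover from this have "snd (face_step P ?x) = snd ?x" using P.extremal_step E by blast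
    ultimately show ?thesis using switch 2 s by simp
  next
    case 3
    then have "\<not> lateral P ?x" using P.lateral_step_iff by simp
    then have "?x = P.other_corner (snd x)" using P.other_corner_eq[of ?x] 3 s by simp
    then have "k x = k (end_corner (snd x))" using P.rot_step[of "k x"] by (simp add: end_corner(2))
    then have "x = end_corner (snd x)" using k_eq_iff x end_corner(1) by blast
    moreover have c: "c = P.other_corner (\<not> snd x)" using P.other_corner_eq[of c] 3 s by simp
    moreover have "snd (rot M x) = snd x"
      using 3 s P.extremal_step[of c] P.other_corner(4) c by simp
    ultimately show ?thesis using last 3 by simp
  qed
qed

lemma dual_face_rot: assumes x: "fst x \<in> edges M" shows "dual_face (rot M x) = dual_face x"
proof -
  have l: "k (rot M x) \<noteq> P.cs \<and> k (rot M x) \<noteq> P.ct" using lateral_not_special k_lateral x by simp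
  have E: "fst (k x) \<in> edges P" using k_in x by simp
  show ?thesis using x
  proof (cases rule: next_cases)
    case same
    then show ?thesis using face_of_old_step[OF E] l by (simp add: dual_face_def)
  next
    case switch
    have "face_of P.C (old (face_step P (k x))) = face_of P.C (old (k x))"
      using face_of_old_step[OF E] switch(1) P.cs(2) P.ct(2) by metis
    then show ?thesis using face_of_old_step[of "face_step P (k x)"] E l switch(4) by (simp add: dual_face_def)
  next
    case last
    let ?c = "P.other_corner (\<not> snd x)"
    have "face_step P (k x) = P.other_corner (snd x)"
      using last(1) end_corner(2)[of "snd x"] P.step_opposite_rot by metis
    then have "face_step P.C (face_step P.C (old (k x))) = old ?c"
      by (cases "snd x") (simp_all add: P.other_corner_def)
    then have "face_of P.C (old ?c) = face_of P.C (old (k x))"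
      using P.C.face_step_eq[of "old (k x)"] P.C.face_step_eq[of "face_step P.C (old (k x))"] E
      by (simp del: P.step_closure)
    then show ?thesis using face_of_old_step[of ?c] P.other_corner(4) l last(2) by (simp add: dual_face_def)
  qed
qed

lemma dual_face_vertex: assumes "fst x \<in> edges M" "y \<in> vertex_of M x" shows "dual_face y = dual_face x"
  using assms(2) unfolding vertex_of_def
  by (rule fin_perm_orbit_const[OF M.fin_perm_rot, rotated]) (use assms dual_face_rot in auto)

lemma rank_decreasing:
  fixes \<rho> :: "'b closure_edge half_edge set \<Rightarrow> nat"
  assumes rank: "\<And>a. a \<in> edges P.C \<Longrightarrow> a \<noteq> Ell \<Longrightarrow> a \<noteq> Arr \<Longrightarrow> \<rho> (P.C.left_face a) < \<rho> (P.C.right_face a)"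
    and a: "a \<in> edges M"
  shows "\<rho> (dual_face (a, False)) < \<rho> (dual_face (a, True))"
proof -
  let ?h = "k (a, False)"
  have h: "fst ?h \<in> edges P" "lateral P ?h" "\<not> snd ?h" using a k_in k_lateral k_snd by simp_all
  have ns: "vertex_of P ?h \<in> nonspecial_vertices P" using P.lateral_nonspecial h by blast
  have "k (a, True) \<in> vertex_of P ?h"
    using P.vertex_iff[of ?h "k (a, True)"] h(1) k_in[of "(a, True)"] k_vertex[of "(a, False)"] a by simp
  then have "snd (k (a, True)) \<longrightarrow> \<rho> (dual_face (a, False)) < \<rho> (face_of P.C (old (k (a, True))))"
    unfolding vertex_of_def
  proof (rule fin_perm_orbit_induct[OF P.fin_perm_rot, rotated])
    fix z assume z: "z \<in> orbit (rot P) ?h" and IH: "snd z \<longrightarrow> \<rho> (dual_face (a, False)) < \<rho> (face_of P.C (old z))"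
    have zE: "fst z \<in> edges P" "vertex_of P z = vertex_of P ?h"
      using P.vertex_in[OF h(1), of z] P.vertex_eq[OF h(1), of z] z by (simp_all add: vertex_of_def)
    have nz: "z \<noteq> P.cs" "z \<noteq> P.ct" using zE(2) ns P.cs_vertex P.ct_vertex by (auto simp: nonspecial_vertices_def)
    show "snd (rot P z) \<longrightarrow> \<rho> (dual_face (a, False)) < \<rho> (face_of P.C (old (rot P z)))"
    proof
      assume s: "snd (rot P z)"
      have le: "\<rho> (dual_face (a, False)) \<le> \<rho> (face_of P.C (old z))"
      proof (cases "snd z")
        case False
        then have "z = ?h" using P.lateral_unique[of z ?h] zE h s by (simp add: lateral_def)
        then show ?thesis by (simp add: dual_face_def)
      qed (use IH in simp)
      obtain e where e: "rot P z = (e, True)" using s by (cases "rot P z") auto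
      have eE: "e \<in> edges P" using P.rot_in_iff[of z] zE e by (simp del: P.rot_in_iff)
      have "face_of P.C (Old e, False) = face_of P.C (old z)"
        using P.C.face_opposite_rot[of "old z"] zE nz e by simp
      then show "\<rho> (dual_face (a, False)) < \<rho> (face_of P.C (old (rot P z)))"
        using rank[of "Old e"] le e eE by simp
    qed
  qed (use h in auto)
  then show ?thesis using k_snd[of "(a, True)"] a by (simp add: dual_face_def)
qed

lemma acyclic_arcs: "acyclic (arcs M)"
proof -
  obtain \<rho> :: "'b closure_edge half_edge set \<Rightarrow> nat"
    where r: "\<And>a. a \<in> edges P.C \<Longrightarrow> a \<noteq> Ell \<Longrightarrow> a \<noteq> Arr \<Longrightarrow> \<rho> (P.C.left_face a) < \<rho> (P.C.right_face a)"
    using P.C.dual_rank by blast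
  define W where "W u = \<rho> (dual_face (SOME x. x \<in> u))" for u
  have W: "W (vertex_of M x) = \<rho> (dual_face x)" if "fst x \<in> edges M" for x
  proof -
    have "(SOME y. y \<in> vertex_of M x) \<in> vertex_of M x" using M.vertex_self[OF that] by (rule someI)
    then show ?thesis using dual_face_vertex[OF that] by (simp add: W_def)
  qed
  have "W v < W u" if "(u, v) \<in> arcs M" for u v
    using that W rank_decreasing[of \<rho>, OF r] by (auto simp: M.arcs_iff)
  then have "arcs M \<subseteq> (measure W)\<inverse>" by auto
  then show ?thesis using wf_acyclic[OF wf_measure, of W] by (meson acyclic_converse acyclic_subset)
qed

lemma vertex_const_iff:
  assumes x: "fst x \<in> edges M"
  shows "(\<forall>y \<in> vertex_of M x. snd y = b) \<longleftrightarrow> vertex_of M x = vertex_of M (end_corner b)"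
proof
  assume all: "\<forall>y \<in> vertex_of M x. snd y = b"
  show "vertex_of M x = vertex_of M (end_corner b)"
  proof (rule ccontr)
    assume "vertex_of M x \<noteq> vertex_of M (end_corner b)"
    then have ne: "end_corner b \<notin> vertex_of M x" using M.vertex_eq[OF x] by metis
    have "\<exists>y \<in> vertex_of M x. k y = g" if "g \<in> face_of P (k x)" for g
      using that unfolding face_of_def
    proof (rule fin_perm_orbit_induct[OF P.fin_perm_step, rotated])
      fix z assume "\<exists>y \<in> vertex_of M x. k y = z"
      then obtain y where y: "y \<in> vertex_of M x" "k y = z" by blast
      have yE: "fst y \<in> edges M" using M.vertex_in[OF x y(1)] .
      have ry: "rot M y \<in> vertex_of M x" using y(1) by (simp add: vertex_of_def orbit.step)
      show "\<exists>y \<in> vertex_of M x. k y = face_step P z"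
        using yE
      proof (cases rule: next_cases)
        case same
        then show ?thesis using ry y by blast
      next
        case switch
        then show ?thesis using all ry y by auto
      next
        case last
        then show ?thesis using ne y all by auto
      qed
    qed (use x k_in M.vertex_self[OF x] in \<open>simp_all, blast\<close>)
    then have "snd g = b" if "g \<in> face_of P (k x)" for g
      using that all k_snd M.vertex_in[OF x] by metis
    then show False using P.face_not_const[of "k x" "\<not> b"] k_in[OF x] by blast
  qed
next
  assume v: "vertex_of M x = vertex_of M (end_corner b)"
  have "k y \<in> outer P \<and> snd y = b" if "y \<in> vertex_of M (end_corner b)" for y
    using that unfolding vertex_of_def
  proof (rule fin_perm_orbit_induct[OF M.fin_perm_rot, rotated])
    fix z assume z: "z \<in> orbit (rot M) (end_corner b)" "k z \<in> outer P \<and> snd z = b"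
    have zE: "fst z \<in> edges M" using M.vertex_in[OF end_corner(1), of z b] z by (simp add: vertex_of_def)
    show "k (rot M z) \<in> outer P \<and> snd (rot M z) = b"
      using zE
    proof (cases rule: next_cases)
      case same
      then show ?thesis using z P.outer_step_iff[OF k_in[OF zE]] by simp
    next
      case switch
      then show ?thesis using z P.outer_step_iff[OF k_in[OF zE]] by simp
    next
      case last
      then show ?thesis using z P.outer_step_iff[OF P.other_corner(4)] P.other_corner(1) by simp
    qed
  qed (use end_corner k_end_corner_outer end_corner_snd in auto)
  with v show "\<forall>y \<in> vertex_of M x. snd y = b" by simp
qed

lemma source_iff: "is_source M u \<longleftrightarrow> u = vertex_of M (end_corner True)"
  and sink_iff: "is_sink M u \<longleftrightarrow> u = vertex_of M (end_corner False)"
proof -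
  have "is_source M u \<longleftrightarrow> (\<exists>x. fst x \<in> edges M \<and> u = vertex_of M x \<and> (\<forall>y \<in> vertex_of M x. snd y = True))"
    unfolding is_source_def M.vertices_iff by auto
  then show "is_source M u \<longleftrightarrow> u = vertex_of M (end_corner True)"
    using vertex_const_iff[of _ True] end_corner(1)[of True] by metis
  have "is_sink M u \<longleftrightarrow> (\<exists>x. fst x \<in> edges M \<and> u = vertex_of M x \<and> (\<forall>y \<in> vertex_of M x. snd y = False))"
    unfolding is_sink_def M.vertices_iff by auto
  then show "is_sink M u \<longleftrightarrow> u = vertex_of M (end_corner False)"
    using vertex_const_iff[of _ False] end_corner(1)[of False] by metis
qed

lemma bipolar_M: "bipolar_orientation M"
proof -
  interpret M: bipolar_rot M
    by unfold_locales (use end_corner(1) acyclic_arcs source_iff sink_iff in auto)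
  show ?thesis
  proof (rule M.bipolar_orientationI)
    show "outer M \<in> faces M" by (rule outer_face)
  next
    fix x y assume xy: "x \<in> half_edges M" "y \<in> half_edges M" "vertex_of M x = vertex_of M y" "\<not> snd x" "\<not> snd y"
      "snd (rot M x)" "snd (rot M y)"
    have key: "\<not> lateral P (face_step P (k z)) \<and> snd (face_step P (k z)) \<and>
        face_of P.C (old (face_step P (k z))) = dual_face z"
      if z: "z \<in> half_edges M" "\<not> snd z" "snd (rot M z)" for z
    proof -
      have zE: "fst z \<in> edges M" using z by simp
      then show ?thesis
      proof (cases rule: next_cases)
        case switch
        then have "face_step P (k z) \<noteq> P.cs" "face_step P (k z) \<noteq> P.ct" using P.cs(2) P.ct(2) by metis+
        then show ?thesis using z switch face_of_old_step[OF k_in[OF zE]] by (simp add: dual_face_def)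
      qed (use z in auto)
    qed
    have "dual_face x = dual_face y"
      using dual_face_vertex[of y x] xy M.vertex_self[of x] by simp
    then have "old (face_step P (k x)) = old (face_step P (k y))"
      using P.C.extremal_unique[of "old (face_step P (k x))" "old (face_step P (k y))"]
        key[OF xy(1,4,6)] key[OF xy(2,5,7)] k_in[of x] k_in[of y] xy(1,2) by simp
    then show "x = y" using k_eq_iff xy(1,2) by (simp add: P.step_inj)
  next
    fix x y assume xy: "x \<in> half_edges M" "y \<in> half_edges M" "face_of M x = face_of M y" "\<not> snd x" "\<not> snd y"
      "\<not> snd (rot M x)" "\<not> snd (rot M y)"
    let ?x = "opposite (rot M x)" and ?y = "opposite (rot M y)"
    have "tag ?x = tag ?y"
      by (rule tag_face_const) (use xy M.face_opposite_rot in simp_all)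
    then have "?x = ?y" by (intro turn_tag_unique) (use xy in \<open>simp_all add: M.step_opposite_rot\<close>)
    then show "x = y" by (metis M.step_opposite_rot)
  qed
qed

end

sublocale dual_pair \<subseteq> M: bipolar_map M
  by unfold_locales (rule bipolar_M)

context dual_pair
begin

lemma tag_face_iff: assumes "fst x \<in> edges M" "fst y \<in> edges M"
  shows "face_of M x = face_of M y \<longleftrightarrow> tag x = tag y"
proof
  assume eq: "tag x = tag y"
  have ex: "\<exists>z. fst z \<in> edges M \<and> snd (face_step M z) \<noteq> snd z \<and> snd z \<and> face_of M z = face_of M x"
    if "fst x \<in> edges M" for x
  proof -
    have "face_of M x \<in> faces M" using that M.faces_iff by blast
    then obtain h where h: "fst h \<in> edges M" "snd h = False" "\<not> lateral M h" "face_of M x = face_of M h"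
      by (rule M.extremal_ex)
    then show ?thesis
      using M.face_opposite_rot[OF h(1)]
      by (intro exI[of _ "opposite (rot M h)"]) (auto simp: M.step_opposite_rot lateral_def)
  qed
  obtain z w where z: "fst z \<in> edges M" "snd (face_step M z) \<noteq> snd z" "snd z" "face_of M z = face_of M x"
    and w: "fst w \<in> edges M" "snd (face_step M w) \<noteq> snd w" "snd w" "face_of M w = face_of M y"
    using ex[OF assms(1)] ex[OF assms(2)] by blast
  have "tag z = tag w" using tag_face_const z w assms eq by metis
  then have "z = w" using turn_tag_unique z w by blast
  then show "face_of M x = face_of M y" using z w by simp
qed (use tag_face_const assms in blast)

lemma end_corner_outer: "end_corner b \<in> outer M"
proof -
  obtain x where x: "x \<in> outer M" "\<not> snd x" "k x \<in> outer P" "snd (face_step P (k x))"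
    using corresponds unfolding corresponds_def by blast
  have xE: "fst x \<in> edges M" "outer M = face_of M x" using M.face_mem[OF outer_face x(1)] by auto
  have "face_step P (k x) \<in> outer P" using P.outer_step_iff x(3) k_in xE by blast
  moreover have "\<not> lateral P (face_step P (k x))" using P.lateral_step_iff x(2,4) k_snd[OF xE(1)] by simp
  ultimately have "face_step P (k x) = P.other_corner False" using P.other_corner_eq[of "face_step P (k x)"] x(4) by simp
  then have "k x = k (end_corner False)" using P.rot_step[of "k x"] by (simp add: end_corner(2))
  then have "x = end_corner False" using k_eq_iff xE(1) end_corner(1) by blast
  then have "face_of M (end_corner b) = outer M"
    using tag_face_iff[OF end_corner(1) end_corner(1), of b False] xE(2) by (simp add: tag_end_corner)
  then show ?thesis using M.face_self[OF end_corner(1), of b] by simp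
qed

lemma end_corner_extremal: "\<not> lateral M (end_corner b)"
proof -
  have "rot M (end_corner b) \<in> vertex_of M (end_corner b)" by (simp add: vertex_of_def orbit.base)
  then show ?thesis
    using vertex_const_iff[OF end_corner(1), of b b] end_corner_snd by (simp add: lateral_def)
qed

lemma plane_M: "plane_bipolar_orientation M"
proof -
  have v: "source M = vertex_of M (end_corner True)" "sink M = vertex_of M (end_corner False)"
    using source_iff sink_iff M.source M.sink by auto
  then show ?thesis
    unfolding plane_bipolar_orientation_def outer_vertex_def
    using bipolar_M M.source_in M.sink_in end_corner_outer M.vertex_self[OF end_corner(1)] by blast
qed

lemma outer_iff_tag: assumes "fst x \<in> edges M" shows "x \<in> outer M \<longleftrightarrow> tag x = None"
proof -
  have "outer M = face_of M (end_corner True)" using M.face_mem[OF outer_face end_corner_outer] by blast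
  then show ?thesis
    using M.face_iff[OF end_corner(1) assms, of True] tag_face_iff[OF assms end_corner(1), of True]
    by (simp add: tag_end_corner)
qed

lemma lateral_opposite_k: assumes x: "fst x \<in> edges M"
  shows "lateral P (opposite (k x)) \<longleftrightarrow> snd (face_step M x) \<noteq> snd x \<and> x \<notin> outer M"
  using x
proof (cases rule: step_cases)
  case turn
  then show ?thesis using outer_iff_tag[OF x] tag_turn[OF x turn(1)] by simp
next
  case straight
  then show ?thesis by simp
next
  case outer
  then have "tag x = None" using other_corner_special by (simp add: tag_def)
  then show ?thesis using outer outer_iff_tag[OF x] by simp
qed

lemma opposite_k_iff:
  assumes x: "fst x \<in> edges M" and y: "fst y \<in> edges M" and s: "snd x \<noteq> snd y"
  shows "opposite (k x) = k y \<longleftrightarrow> face_of M x = face_of M y \<and> x \<notin> outer M \<and>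
    snd (face_step M x) \<noteq> snd x \<and> snd (face_step M y) \<noteq> snd y"
proof
  assume e: "opposite (k x) = k y"
  then have e': "opposite (k y) = k x" by (metis opposite_simps(2))
  have l: "lateral P (opposite (k x))" "lateral P (opposite (k y))" using e e' k_lateral x y by simp_all
  have "fst (k x) = fst (k y)" using e by (metis opposite_simps(3))
  then have "tag x = tag y" using tag_turn x y l by simp
  then show "face_of M x = face_of M y \<and> x \<notin> outer M \<and> snd (face_step M x) \<noteq> snd x \<and> snd (face_step M y) \<noteq> snd y"
    using tag_face_iff x y l lateral_opposite_k by blast
next
  assume *: "face_of M x = face_of M y \<and> x \<notin> outer M \<and> snd (face_step M x) \<noteq> snd x \<and> snd (face_step M y) \<noteq> snd y"
  then have t: "tag x = tag y" "tag x \<noteq> None" using tag_face_iff[OF x y] outer_iff_tag[OF x] by blast+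
  have l: "lateral P (opposite (k x))" "lateral P (opposite (k y))"
    using * t outer_iff_tag x y lateral_opposite_k by auto
  then have "fst (k x) = fst (k y)" using tag_turn x y t by simp
  then show "opposite (k x) = k y" using s k_snd x y by (simp add: prod_eq_iff)
qed

lemma rot_k: assumes x: "fst x \<in> edges M"
  shows "rot P (k (opposite x)) =
    (if snd (face_step M x) \<noteq> snd x \<and> x \<notin> outer M then opposite (k (face_step M x)) else k x)"
  using x
proof (cases rule: step_cases)
  case turn
  then show ?thesis using lateral_opposite_k[OF x] by simp
next
  case straight
  then show ?thesis using lateral_opposite_k[OF x] rot_k_opposite(2)[OF x] by simp
next
  case outer
  then show ?thesis using lateral_opposite_k[OF x] rot_k_opposite(2)[OF x] by auto
qed

lemma rot_opposite_k: assumes x: "fst x \<in> edges M" "\<not> lateral P (opposite (k x))"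
  shows "rot P (opposite (k x)) =
    opposite (k (if snd (face_step M x) = snd x then face_step M x else end_corner (snd x)))"
  using x(1)
proof (cases rule: step_cases)
  case outer
  then show ?thesis by (simp add: end_corner(2))
qed (use x in simp_all)

lemma end_corner_unique: assumes "x \<in> outer M" "snd x = b" "\<not> lateral M x" shows "x = end_corner b"
proof -
  have "fst x \<in> edges M" "face_of M x = face_of M (end_corner b)"
    using M.face_mem[OF outer_face assms(1)] M.face_mem[OF outer_face end_corner_outer[of b]] by auto
  then show ?thesis using M.extremal_unique[of x "end_corner b"] assms end_corner(1) end_corner_snd end_corner_extremal by simp
qed

lemma outer_P: "outer P = face_of P (k (end_corner False))"
  using P.face_mem[OF P.outer_in k_end_corner_outer] by blast

definition k_inv :: "'b half_edge \<Rightarrow> 'a half_edge" where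
  "k_inv h = (SOME x. fst x \<in> edges M \<and> k x = h)"

lemma k_inv: assumes "fst x \<in> edges M" shows "k_inv (k x) = x"
  unfolding k_inv_def by (rule some_equality) (use assms k_eq_iff in blast)+

lemma half_edge_cases: assumes "fst h \<in> edges P"
  obtains x where "fst x \<in> edges M" "h = k x"
  | x where "fst x \<in> edges M" "h = opposite (k x)" "\<not> lateral P h"
proof (cases "lateral P h")
  case True
  then show ?thesis using k_ex[OF assms] that(1) by metis
next
  case False
  then have "lateral P (opposite h)" using avoiding_lateral[OF assms] by blast
  then obtain x where "fst x \<in> edges M" "k x = opposite h" using k_ex[of "opposite h"] assms by auto
  then show ?thesis using that(2)[of x] False by simp
qed

end

locale dual_pairs = D: dual_pair P M k + D': dual_pair P' M k'
  for P :: "'b oriented_map" and P' :: "'c oriented_map" and M :: "'a oriented_map" and k k'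
begin

definition transfer :: "'b half_edge \<Rightarrow> 'c half_edge" where
  "transfer h = (if lateral P h then k' (D.k_inv h) else opposite (k' (D.k_inv (opposite h))))"

lemma transfer_k: "fst x \<in> edges M \<Longrightarrow> transfer (k x) = k' x"
  by (simp add: transfer_def D.k_lateral D.k_inv)

lemma transfer_opposite_k: assumes x: "fst x \<in> edges M" shows "transfer (opposite (k x)) = opposite (k' x)"
proof (cases "lateral P (opposite (k x))")
  case True
  then obtain y where y: "fst y \<in> edges M" "k y = opposite (k x)"
    using D.k_ex[of "opposite (k x)"] D.k_in[OF x] by auto
  have s: "snd x \<noteq> snd y" using D.k_snd[OF x] D.k_snd[OF y(1)] y(2) by auto
  have "opposite (k' x) = k' y"
    using D.opposite_k_iff[OF x y(1) s] D'.opposite_k_iff[OF x y(1) s] y(2) by simp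
  then show ?thesis using transfer_k[OF y(1)] y(2) by simp
next
  case False
  then show ?thesis by (simp add: transfer_def D.k_inv[OF x])
qed

lemma transfer_opposite: assumes "fst h \<in> edges P" shows "transfer (opposite h) = opposite (transfer h)"
  using assms by (cases rule: D.half_edge_cases) (simp_all add: transfer_k transfer_opposite_k)

lemma transfer_in: assumes "fst h \<in> edges P" shows "fst (transfer h) \<in> edges P'" "snd (transfer h) = snd h"
  using assms
  by (cases rule: D.half_edge_cases; simp add: transfer_k transfer_opposite_k D'.k_in D.k_snd D'.k_snd)+

lemma end_corner_eq: "D.end_corner b = D'.end_corner b"
  by (rule D'.end_corner_unique[OF D.end_corner_outer D.end_corner_snd D.end_corner_extremal])

lemma transfer_rot: assumes h: "fst h \<in> edges P" shows "rot P' (transfer h) = transfer (rot P h)"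
  using h
proof (cases rule: D.half_edge_cases)
  case (1 x)
  define z where "z = opposite x"
  have z: "fst z \<in> edges M" "x = opposite z" using 1(1) by (simp_all add: z_def)
  show ?thesis
    using D.rot_k[OF z(1)] D'.rot_k[OF z(1)] z 1 transfer_k transfer_opposite_k by auto
next
  case (2 x)
  then have l: "\<not> lateral P (opposite (k x))" by simp
  then have l': "\<not> lateral P' (opposite (k' x))"
    using D.lateral_opposite_k D'.lateral_opposite_k 2(1) by blast
  show ?thesis
    using D.rot_opposite_k[OF 2(1) l] D'.rot_opposite_k[OF 2(1) l'] 2 end_corner_eq
      transfer_opposite_k[of "face_step M x"] transfer_opposite_k[of "D'.end_corner (snd x)"]
      transfer_opposite_k[OF 2(1)] D'.end_corner(1) by auto
qed

definition edge_map :: "'b \<Rightarrow> 'c" where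
  "edge_map e = fst (transfer (e, True))"

lemma transfer_eq: assumes "fst h \<in> edges P" shows "transfer h = map_prod edge_map id h"
proof -
  obtain e b where h: "h = (e, b)" by force
  have "transfer (e, True) = (edge_map e, True)"
    using transfer_in(2)[of "(e, True)"] assms h by (simp add: edge_map_def prod_eq_iff)
  moreover have "transfer (e, False) = opposite (transfer (e, True))"
    using transfer_opposite[of "(e, True)"] assms h by simp
  ultimately show ?thesis using h by (cases b) auto
qed

lemma edge_map_in: "e \<in> edges P \<Longrightarrow> edge_map e \<in> edges P'"
  using transfer_in(1)[of "(e, True)"] by (simp add: edge_map_def)

lemma transfer_step: assumes h: "fst h \<in> edges P" shows "transfer (face_step P h) = face_step P' (transfer h)"
  using transfer_rot[of "face_step P h"] h
  by (simp add: D.P.rot_step transfer_opposite D'.P.step_eq_iff eq_commute)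

lemma transfer_outer: "outer P' = map_prod edge_map id ` outer P"
proof -
  let ?h = "k (D.end_corner False)"
  have h: "fst ?h \<in> edges P" using D.k_in D.end_corner(1) by simp
  have "transfer ` orbit (face_step P) ?h = orbit (face_step P') (transfer ?h)"
  proof (rule orbit_inverse)
    show "?h \<in> orbit (face_step P) ?h" using D.P.face_self[OF h] by (simp add: face_of_def)
    fix x assume "x \<in> orbit (face_step P) ?h"
    then have "fst x \<in> edges P" using D.P.face_in[OF h] by (simp add: face_of_def)
    then show "face_step P' (transfer x) = transfer (face_step P x)" by (simp add: transfer_step)
  qed
  moreover have "transfer ?h = k' (D'.end_corner False)"
    using transfer_k[OF D.end_corner(1)] end_corner_eq by simp
  ultimately have "outer P' = transfer ` outer P"
    unfolding D.outer_P D'.outer_P by (simp add: face_of_def)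
  also have "\<dots> = map_prod edge_map id ` outer P"
    by (rule image_cong[OF refl transfer_eq]) (use D.P.face_mem[OF D.P.outer_in] in blast)
  finally show ?thesis .
qed

end

sublocale dual_pairs \<subseteq> S: dual_pairs P' P M k' k
  by unfold_locales

context dual_pairs
begin

lemma transfer_inverse: assumes "fst h \<in> edges P" shows "S.transfer (transfer h) = h"
  using assms
  by (cases rule: D.half_edge_cases)
    (simp_all add: transfer_k transfer_opposite_k S.transfer_k S.transfer_opposite_k)

lemma edge_map_inverse: assumes "e \<in> edges P" shows "S.edge_map (edge_map e) = e"
proof -
  have "transfer (e, True) = (edge_map e, True)" using transfer_eq[of "(e, True)"] assms by simp
  then show ?thesis using transfer_inverse[of "(e, True)"] assms by (simp add: S.edge_map_def)
qed

end

context dual_pairs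
begin

lemma iso: "map_iso P P'"
  unfolding map_iso_def
proof (intro conjI exI[of _ edge_map] ballI)
  show "planar_map P" "planar_map P'"
    using D.P.bipolar D'.P.bipolar by (simp_all add: bipolar_orientation_def)
  show "bij_betw edge_map (edges P) (edges P')"
    by (rule bij_betw_byWitness[of _ S.edge_map])
      (use edge_map_inverse S.edge_map_inverse edge_map_in S.edge_map_in in auto)
  show "rot P' (map_prod edge_map id h) = map_prod edge_map id (rot P h)" if "h \<in> half_edges P" for h
    using that transfer_rot[of h] transfer_eq[of h] transfer_eq[of "rot P h"] by simp
  show "outer P' = map_prod edge_map id ` outer P" by (rule transfer_outer)
qed

end

section \<open>Isomorphisms and the bijection\<close>

locale map_isomorphism = M: rot_map M + N: rot_map N
  for M :: "'a oriented_map" and N :: "'b oriented_map" +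
  fixes g :: "'a \<Rightarrow> 'b"
  assumes bij: "bij_betw g (edges M) (edges N)"
    and rot_map: "fst h \<in> edges M \<Longrightarrow> rot N (map_prod g id h) = map_prod g id (rot M h)"
    and outer_map: "outer N = map_prod g id ` outer M"
    and outer_face: "outer M \<in> faces M"
begin

abbreviation "G \<equiv> map_prod g id"

lemma map_simps [simp]: "fst (G h) = g (fst h)" "snd (G h) = snd h" "opposite (G h) = G (opposite h)"
  by (cases h; simp)+

lemma g_in: "e \<in> edges M \<Longrightarrow> g e \<in> edges N"
  using bij bij_betwE by blast

lemma inj_on_map: "inj_on G (half_edges M)"
  using bij_betw_imp_inj_on[OF bij] by (auto simp: inj_on_def prod_eq_iff)

lemma map_eq_iff: "fst (h :: 'a half_edge) \<in> edges M \<Longrightarrow> fst h' \<in> edges M \<Longrightarrow> G h = G h' \<longleftrightarrow> h = h'"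
  using inj_on_eq_iff[OF inj_on_map, of h h'] by simp

lemma map_ex: assumes "fst h \<in> edges N"
  obtains h' where "fst h' \<in> edges M" "h = G h'"
proof -
  obtain e where "e \<in> edges M" "fst h = g e" using assms bij_betw_imp_surj_on[OF bij] by auto
  then show ?thesis using that[of "(e, snd h)"] by (simp add: prod_eq_iff)
qed

lemma step_map: "fst h \<in> edges M \<Longrightarrow> face_step N (G h) = G (face_step M h)"
  by (simp add: N.step_eq_iff rot_map M.rot_step)

lemma vertex_map: assumes "fst h \<in> edges M" shows "vertex_of N (G h) = G ` vertex_of M h"
  unfolding vertex_of_def
  by (rule orbit_inverse[symmetric])
    (use assms rot_map M.vertex_self M.vertex_in in \<open>auto simp: vertex_of_def\<close>)

lemma face_map: assumes "fst h \<in> edges M" shows "face_of N (G h) = G ` face_of M h"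
  unfolding face_of_def
  by (rule orbit_inverse[symmetric])
    (use assms step_map M.face_self M.face_in in \<open>auto simp: face_of_def\<close>)

lemma half_edges_map: "half_edges N = G ` half_edges M"
proof (intro subset_antisym subsetI)
  fix h assume "h \<in> half_edges N"
  then have "fst h \<in> edges N" by simp
  then obtain h' where "fst h' \<in> edges M" "h = G h'" by (rule map_ex)
  then show "h \<in> G ` half_edges M" by simp
qed (use g_in in auto)

lemma vertices_map: "vertices N = image G ` vertices M"
  unfolding vertices_def half_edges_map image_image by (rule image_cong) (simp_all add: vertex_map)

lemma faces_map: "faces N = image G ` faces M"
  unfolding faces_def half_edges_map image_image by (rule image_cong) (simp_all add: face_map)

lemma vertices_Pow: "vertices M \<subseteq> Pow (half_edges M)" and faces_Pow: "faces M \<subseteq> Pow (half_edges M)"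
  using M.vertex_mem M.face_mem by auto

lemma inj_on_image_map: "inj_on (image G) (Pow (half_edges M))"
  using inj_on_map by (rule inj_on_image_Pow)

lemma inj_on_vertices: "inj_on (image G) (vertices M)" and inj_on_faces: "inj_on (image G) (faces M)"
  using inj_on_image_map vertices_Pow faces_Pow inj_on_subset by blast+

lemma arcs_map: "arcs N = map_prod (image G) (image G) ` arcs M"
proof -
  have "arcs N = (\<lambda>e. (vertex_of N (G (e, True)), vertex_of N (G (e, False)))) ` edges M"
    unfolding arcs_def edge_origin_def edge_end_def bij_betw_imp_surj_on[OF bij, symmetric] by auto
  also have "\<dots> = (\<lambda>e. (G ` vertex_of M (e, True), G ` vertex_of M (e, False))) ` edges M"
    by (rule image_cong[OF refl]) (simp only: vertex_map fst_conv)
  also have "\<dots> = map_prod (image G) (image G) ` arcs M"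
    by (auto simp: arcs_def edge_origin_def edge_end_def image_iff; force)
  finally show ?thesis .
qed

lemma arcs_subset: "arcs M \<subseteq> vertices M \<times> vertices M"
  by (auto simp: arcs_def edge_origin_def edge_end_def vertices_def)

lemma source_map: "is_source N u \<longleftrightarrow> (\<exists>v. is_source M v \<and> u = G ` v)"
  and sink_map: "is_sink N u \<longleftrightarrow> (\<exists>v. is_sink M v \<and> u = G ` v)"
  unfolding is_source_def is_sink_def vertices_map by auto

lemma lateral_map: "fst h \<in> edges M \<Longrightarrow> lateral N (G h) \<longleftrightarrow> lateral M h"
  by (simp add: lateral_def rot_map)

lemma card_edges_map: "card (edges N) = card (edges M)"
  using bij by (simp add: bij_betw_same_card)

lemma card_vertices_map: "card (vertices N) = card (vertices M)"
  unfolding vertices_map using inj_on_vertices by (rule card_image)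

lemma card_inner_map: "card (inner_faces N) = card (inner_faces M)"
proof -
  have "card (faces N) = card (faces M)" unfolding faces_map using inj_on_faces by (rule card_image)
  moreover have "outer N \<in> faces N" using outer_face outer_map faces_map by blast
  ultimately show ?thesis using outer_face M.finite_faces N.finite_faces by (simp add: inner_faces_def)
qed

lemma plane_map:
  assumes "plane_bipolar_orientation M" "planar_map N"
  shows "plane_bipolar_orientation N"
proof -
  interpret PM: plane_map M by unfold_locales (rule assms(1))
  have s: "is_source N u \<longleftrightarrow> u = G ` source M" "is_sink N u \<longleftrightarrow> u = G ` sink M" for u
    unfolding source_map sink_map using PM.source PM.sink PM.source_eq PM.sink_eq by blast+
  have "acyclic (arcs N)"
    unfolding arcs_map using inj_on_vertices arcs_subset PM.acyclic_arcs by (rule acyclic_map_prod)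
  then have b: "bipolar_orientation N" using assms(2) s by (auto simp: bipolar_orientation_def)
  then interpret PN: bipolar_map N by unfold_locales
  have sn: "source N = G ` source M" "sink N = G ` sink M" using s PN.source PN.sink by blast+
  have "outer_vertex N (source N)" "outer_vertex N (sink N)"
    unfolding outer_vertex_def sn outer_map vertices_map
    using PM.cs PM.ct PM.source_in PM.sink_in by blast+
  with b show ?thesis by (simp add: plane_bipolar_orientation_def)
qed

lemma card_nonspecial_map:
  assumes "plane_bipolar_orientation M" "planar_map N"
  shows "card (nonspecial_vertices N) = card (nonspecial_vertices M)"
proof -
  interpret PM: plane_map M by unfold_locales (rule assms(1))
  interpret PN: plane_map N by unfold_locales (rule plane_map[OF assms])
  show ?thesis using PM.card_nonspecial PN.card_nonspecial card_vertices_map by simp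
qed

lemma edge_origin_map: "e \<in> edges M \<Longrightarrow> edge_origin N (g e) = G ` edge_origin M e"
  and edge_end_map: "e \<in> edges M \<Longrightarrow> edge_end N (g e) = G ` edge_end M e"
  using vertex_map[of "(e, True)"] vertex_map[of "(e, False)"] by (simp_all add: edge_origin_def edge_end_def)

lemma poset_map:
  assumes "plane_bipolar_poset M" "planar_map N"
  shows "plane_bipolar_poset N"
  unfolding plane_bipolar_poset_def
proof (intro conjI ballI)
  show "plane_bipolar_orientation N" using plane_map assms by (simp add: plane_bipolar_poset_def)
  show "3 \<le> card (vertices N)" using assms card_vertices_map by (simp add: plane_bipolar_poset_def)
  have v: "edge_origin M e \<in> vertices M" "edge_end M e \<in> vertices M" if "e \<in> edges M" for e
    using that by (auto simp: edge_origin_def edge_end_def vertices_def)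
  show "inj_on (\<lambda>e. {edge_origin N e, edge_end N e}) (edges N)"
  proof (rule inj_onI)
    fix x y assume xy: "x \<in> edges N" "y \<in> edges N" "{edge_origin N x, edge_end N x} = {edge_origin N y, edge_end N y}"
    obtain a b where ab: "a \<in> edges M" "b \<in> edges M" "x = g a" "y = g b"
      using xy(1,2) bij_betw_imp_surj_on[OF bij] by blast
    have "image G ` {edge_origin M a, edge_end M a} = image G ` {edge_origin M b, edge_end M b}"
      using xy(3) ab by (simp add: edge_origin_map edge_end_map)
    then have "{edge_origin M a, edge_end M a} = {edge_origin M b, edge_end M b}"
      by (subst (asm) inj_on_image_eq_iff[OF inj_on_vertices]) (use v ab in simp_all)
    then have "a = b" using assms(1) ab unfolding plane_bipolar_poset_def inj_on_def by blast
    with ab show "x = y" by simp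
  qed
  fix x assume "x \<in> edges N"
  then obtain a where a: "a \<in> edges M" "x = g a" using bij_betw_imp_surj_on[OF bij] by blast
  have "transitive_edge M a" if "transitive_edge N x"
  proof -
    obtain n where n: "n \<ge> 2" "(G ` edge_origin M a, G ` edge_end M a) \<in> arcs N ^^ n"
      using \<open>transitive_edge N x\<close> a by (auto simp: transitive_edge_def edge_origin_map edge_end_map)
    obtain w where w: "w \<in> vertices M" "G ` edge_end M a = G ` w" "(edge_origin M a, w) \<in> arcs M ^^ n"
      using relpow_map_prod[OF inj_on_vertices arcs_subset v(1)[OF a(1)]] n(2) unfolding arcs_map by blast
    have "edge_end M a = w" using inj_onD[OF inj_on_vertices w(2) v(2)[OF a(1)] w(1)] .
    then show ?thesis using n(1) w(3) by (auto simp: transitive_edge_def)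
  qed
  then show "\<not> transitive_edge N x" using assms(1) a by (auto simp: plane_bipolar_poset_def)
qed

lemma N_avoiding_map: "N_avoiding M \<Longrightarrow> N_avoiding N"
  unfolding M.N_avoiding_iff N.N_avoiding_iff bij_betw_imp_surj_on[OF bij, symmetric]
  using lateral_map[of "(_, True)"] lateral_map[of "(_, False)"] by simp

lemma outer_map_iff: assumes "fst h \<in> edges M" shows "G h \<in> outer N \<longleftrightarrow> h \<in> outer M"
proof -
  have "h = x" if "x \<in> outer M" "G h = G x" for x
    using map_eq_iff[OF assms, of x] M.face_mem[OF outer_face that(1)] that(2) by simp
  then show ?thesis unfolding outer_map image_iff by blast
qed

lemma lateral_next_map:
  assumes h: "fst h \<in> edges M" and n: "lateral_next M h h'"
  shows "lateral_next N (G h) (G h')"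
proof -
  have o: "fst c \<in> edges M" if "c \<in> outer M" for c using M.face_mem[OF outer_face that] by blast
  have s: "face_step N (G h) = G (face_step M h)" using step_map h by simp
  consider "snd (face_step M h) = snd h" "h' = face_step M h"
    | "snd (face_step M h) \<noteq> snd h" "face_step M h \<notin> outer M" "h' = face_step M (face_step M h)"
    | c where "snd (face_step M h) \<noteq> snd h" "face_step M h \<in> outer M" "c \<in> outer M" "\<not> lateral M c"
        "snd c = snd h" "h' = face_step M c"
    using n unfolding lateral_next_def Let_def by (metis (full_types))
  then show ?thesis
  proof cases
    case 1
    then show ?thesis using s by (simp add: lateral_next_def)
  next
    case 2
    then show ?thesis using s outer_map_iff[of "face_step M h"] step_map[of "face_step M h"] h
      by (simp add: lateral_next_def)
  next
    case 3
    then have "G c \<in> outer N" "\<not> lateral N (G c)" "face_step N (G c) = G h'" "snd (G c) = snd (G h)"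
      using outer_map_iff lateral_map step_map o by simp_all
    moreover have "G (face_step M h) \<in> outer N" using outer_map_iff 3(2) h by simp
    ultimately show ?thesis using s 3(1) unfolding lateral_next_def Let_def by auto
  qed
qed

lemma corresponds_map_right:
  assumes c: "corresponds A M k"
  shows "corresponds A N (\<lambda>x. G (k x))"
proof -
  have kb: "bij_betw k (half_edges A) {h \<in> half_edges M. lateral M h}" using c by (simp add: corresponds_def)
  have k: "fst (k x) \<in> edges M" if "x \<in> half_edges A" for x using bij_betwE[OF kb] that by auto
  show ?thesis
    unfolding corresponds_def
  proof (intro conjI ballI)
    have "bij_betw G {h \<in> half_edges M. lateral M h} {h \<in> half_edges N. lateral N h}"
    proof (rule bij_betw_imageI)
      show "inj_on G {h \<in> half_edges M. lateral M h}" using inj_on_map by (rule inj_on_subset) auto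
      show "G ` {h \<in> half_edges M. lateral M h} = {h \<in> half_edges N. lateral N h}"
      proof (intro subset_antisym subsetI)
        fix x assume "x \<in> G ` {h \<in> half_edges M. lateral M h}"
        then obtain h where "fst h \<in> edges M" "lateral M h" "x = G h" by auto
        then show "x \<in> {h \<in> half_edges N. lateral N h}" using lateral_map g_in by simp
      next
        fix x assume x: "x \<in> {h \<in> half_edges N. lateral N h}"
        then have "fst x \<in> edges N" by simp
        then obtain h where "fst h \<in> edges M" "x = G h" by (rule map_ex)
        then show "x \<in> G ` {h \<in> half_edges M. lateral M h}" using x lateral_map by auto
      qed
    qed
    with kb have "bij_betw (G \<circ> k) (half_edges A) {h \<in> half_edges N. lateral N h}" by (rule bij_betw_trans)
    then show "bij_betw (\<lambda>x. G (k x)) (half_edges A) {h \<in> half_edges N. lateral N h}" by (simp only: comp_def)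
  next
    fix x assume x: "x \<in> half_edges A"
    have cx: "snd (k x) = snd x" "vertex_of M (k (opposite x)) = vertex_of M (k x)" "lateral_next M (k x) (k (rot A x))"
      using c x by (simp_all add: corresponds_def)
    show "snd (G (k x)) = snd x" using cx by simp
    show "vertex_of N (G (k (opposite x))) = vertex_of N (G (k x))"
      using cx(2) vertex_map k x k[of "opposite x"] by simp
    show "lateral_next N (G (k x)) (G (k (rot A x)))" using lateral_next_map k x cx(3) by blast
  next
    obtain x where x: "x \<in> outer A" "\<not> snd x" "k x \<in> outer M" "snd (face_step M (k x))"
      using c unfolding corresponds_def by blast
    have "fst (k x) \<in> edges M" using M.face_mem[OF outer_face x(3)] by blast
    then show "\<exists>x\<in>outer A. \<not> snd x \<and> G (k x) \<in> outer N \<and> snd (face_step N (G (k x)))"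
      using x outer_map_iff step_map by (intro bexI[of _ x]) auto
  qed
qed

lemma corresponds_map_left:
  assumes c: "corresponds N P k"
  shows "corresponds M P (\<lambda>x. k (G x))"
  unfolding corresponds_def
proof (intro conjI ballI)
  have "bij_betw G (half_edges M) (half_edges N)"
    using inj_on_map half_edges_map by (simp add: bij_betw_def)
  moreover have "bij_betw k (half_edges N) {h \<in> half_edges P. lateral P h}" using c by (simp add: corresponds_def)
  ultimately have "bij_betw (k \<circ> G) (half_edges M) {h \<in> half_edges P. lateral P h}" by (rule bij_betw_trans)
  then show "bij_betw (\<lambda>x. k (G x)) (half_edges M) {h \<in> half_edges P. lateral P h}" by (simp only: comp_def)
next
  fix x assume "x \<in> half_edges M"
  then have x: "fst x \<in> edges M" "G x \<in> half_edges N" using g_in by simp_all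
  have cx: "snd (k (G x)) = snd (G x)" "vertex_of P (k (opposite (G x))) = vertex_of P (k (G x))"
    "lateral_next P (k (G x)) (k (rot N (G x)))"
    using c x(2) unfolding corresponds_def by blast+
  show "snd (k (G x)) = snd x" using cx by simp
  show "vertex_of P (k (G (opposite x))) = vertex_of P (k (G x))" using cx by simp
  show "lateral_next P (k (G x)) (k (G (rot M x)))" using cx rot_map x by simp
next
  obtain y where y: "y \<in> outer N" "\<not> snd y" "k y \<in> outer P" "snd (face_step P (k y))"
    using c unfolding corresponds_def by blast
  then obtain x where "x \<in> outer M" "y = G x" unfolding outer_map by (elim imageE)
  then show "\<exists>x\<in>outer M. \<not> snd x \<and> k (G x) \<in> outer P \<and> snd (face_step P (k (G x)))"
    using y by (intro bexI[of _ x]) simp_all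
qed

end

lemma map_iso_planar: "map_iso M N \<Longrightarrow> planar_map M" "map_iso M N \<Longrightarrow> planar_map N"
  by (auto simp: map_iso_def)

lemma planar_rot_map: "planar_map M \<Longrightarrow> rot_map M"
  unfolding planar_map_def by unfold_locales auto

lemma map_isoE:
  assumes "map_iso M N"
  obtains g where "map_isomorphism M N g"
proof -
  obtain g where g: "bij_betw g (edges M) (edges N)" "\<forall>h \<in> half_edges M. rot N (map_prod g id h) = map_prod g id (rot M h)"
    "outer N = map_prod g id ` outer M" using assms by (auto simp: map_iso_def)
  interpret M: rot_map M using assms map_iso_planar planar_rot_map by blast
  interpret N: rot_map N using assms map_iso_planar planar_rot_map by blast
  have "outer M \<in> faces M" using assms by (simp add: map_iso_def planar_map_def)
  then have "map_isomorphism M N g" by unfold_locales (use g in auto)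
  then show ?thesis by (rule that)
qed

lemma (in map_isomorphism) map_isoI: "planar_map M \<Longrightarrow> planar_map N \<Longrightarrow> map_iso M N"
  unfolding map_iso_def using bij rot_map outer_map by (intro conjI exI[of _ g]) auto

lemma map_iso_refl: "planar_map M \<Longrightarrow> map_iso M M"
  unfolding map_iso_def by (intro conjI exI[of _ id]) (auto simp: prod.map_id0)

lemma map_iso_sym: assumes "map_iso M N" shows "map_iso N M"
proof -
  obtain g where "map_isomorphism M N g" using assms by (rule map_isoE)
  then interpret map_isomorphism M N g .
  let ?g = "inv_into (edges M) g"
  have inv: "map_prod ?g id (G h) = h" if "fst h \<in> edges M" for h
    using bij_betw_inv_into_left[OF bij that] by (cases h) simp
  show ?thesis unfolding map_iso_def
  proof (intro conjI exI[of _ ?g] ballI)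
    show "bij_betw ?g (edges N) (edges M)" using bij by (rule bij_betw_inv_into)
    fix h assume "h \<in> half_edges N"
    then have "fst h \<in> edges N" by simp
    then obtain x where x: "fst x \<in> edges M" "h = G x" by (rule map_ex)
    then have r: "fst (rot M x) \<in> edges M" by simp
    show "rot M (map_prod ?g id h) = map_prod ?g id (rot N h)"
      unfolding x(2) rot_map[OF x(1)] inv[OF x(1)] inv[OF r] ..
  next
    have "map_prod ?g id ` outer N = (\<lambda>h. h) ` outer M"
      unfolding outer_map image_image
      by (rule image_cong[OF refl]) (use inv M.face_mem[OF outer_face] in blast)
    then show "outer M = map_prod ?g id ` outer N" by simp
  qed (use map_iso_planar assms in blast)+
qed

lemma map_iso_trans: assumes "map_iso L M" "map_iso M N" shows "map_iso L N"
proof -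
  obtain f where "map_isomorphism L M f" using assms(1) by (rule map_isoE)
  then interpret f: map_isomorphism L M f .
  obtain g where "map_isomorphism M N g" using assms(2) by (rule map_isoE)
  then interpret g: map_isomorphism M N g .
  have comp: "map_prod (g \<circ> f) id h = map_prod g id (map_prod f id h)" for h by (cases h) simp
  show ?thesis unfolding map_iso_def
  proof (intro conjI exI[of _ "g \<circ> f"] ballI)
    show "bij_betw (g \<circ> f) (edges L) (edges N)" using f.bij g.bij by (rule bij_betw_trans)
    show "rot N (map_prod (g \<circ> f) id h) = map_prod (g \<circ> f) id (rot L h)" if "h \<in> half_edges L" for h
      using that f.rot_map g.rot_map f.g_in by (simp add: comp)
    show "outer N = map_prod (g \<circ> f) id ` outer L"
      unfolding g.outer_map f.outer_map image_image comp ..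
  qed (use map_iso_planar assms in blast)+
qed

lemma map_iso_nat:
  assumes "planar_map M"
  obtains N :: "nat oriented_map" where "map_iso M N"
proof -
  interpret M: rot_map M using assms by (rule planar_rot_map)
  obtain g :: "'a \<Rightarrow> nat" where inj: "inj_on g (edges M)"
    using finite_imp_inj_to_nat_seg[OF M.finite_edges] by blast
  let ?G = "map_prod g id"
  define r where "r h = (if fst h \<in> g ` edges M then ?G (rot M (map_prod (inv_into (edges M) g) id h)) else h)" for h
  define N where "N = \<lparr>edges = g ` edges M, rot = r, outer = ?G ` outer M\<rparr>"
  have N: "edges N = g ` edges M" "rot N = r" "outer N = ?G ` outer M" by (simp_all add: N_def)
  have injG: "inj_on ?G (half_edges M)" using inj by (auto simp: inj_on_def prod_eq_iff)
  have rG: "r (?G h) = ?G (rot M h)" if "fst h \<in> edges M" for h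
    using that inv_into_f_f[OF inj that] by (cases h) (simp add: r_def)
  have HN: "half_edges N = ?G ` half_edges M" by (auto simp: half_edges_def N image_iff)
  have fin: "finite (half_edges N)" unfolding HN using M.finite_half_edges by simp
  have "inj_on r (half_edges N)"
    unfolding HN
  proof (rule inj_on_imageI)
    have "inj_on (?G \<circ> rot M) (half_edges M)"
      using injG M.fin_perm_rot fin_perm_surj[OF M.fin_perm_rot]
      by (intro comp_inj_on) (auto simp: fin_perm_def)
    then show "inj_on (r \<circ> ?G) (half_edges M)"
      by (rule inj_on_cong[THEN iffD1, rotated]) (simp add: rG)
  qed
  then have "r permutes half_edges N"
    using fin
  proof (rule inj_imp_permutes)
    show "x \<in> half_edges N \<Longrightarrow> r x \<in> half_edges N" for x
      unfolding HN using rG by auto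
    show "x \<notin> half_edges N \<Longrightarrow> r x = x" for x by (simp add: N r_def)
  qed
  then interpret N: rot_map N by unfold_locales (simp_all add: N M.finite_edges)
  have of: "outer M \<in> faces M" using assms by (simp add: planar_map_def)
  interpret map_isomorphism M N g
    by unfold_locales (use inj rG of in \<open>auto simp: N bij_betw_def\<close>)
  have "connected_map N"
    unfolding connected_map_def
  proof (intro ballI)
    fix u v assume "u \<in> vertices N" "v \<in> vertices N"
    then obtain x y where xy: "x \<in> vertices M" "y \<in> vertices M" "u = G ` x" "v = G ` y"
      unfolding vertices_map by blast
    have "(x, y) \<in> (arcs M \<union> (arcs M)\<inverse>)\<^sup>*" using assms xy by (simp add: planar_map_def connected_map_def)
    then have "(G ` x, G ` y) \<in> (arcs N \<union> (arcs N)\<inverse>)\<^sup>*"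
    proof (induction rule: rtrancl_induct)
      case (step y z)
      then have "(G ` y, G ` z) \<in> arcs N \<union> (arcs N)\<inverse>" unfolding arcs_map by auto
      with step.IH show ?case by (rule rtrancl_into_rtrancl)
    qed simp
    then show "(u, v) \<in> (arcs N \<union> (arcs N)\<inverse>)\<^sup>*" using xy by simp
  qed
  moreover have "card (faces N) = card (faces M)" unfolding faces_map using inj_on_faces by (rule card_image)
  moreover have "outer N \<in> faces N" using of outer_map faces_map by blast
  ultimately have "planar_map N"
    using assms card_vertices_map card_edges_map N.finite_edges N.rot_permutes
    by (auto simp: planar_map_def N(1))
  then show ?thesis using that map_isoI[OF assms] by blast
qed

text \<open>The isomorphism is \<open>k'\<inverse> \<circ> k\<close>.\<close>

lemma dual_pair_unique:
  assumes "dual_pair P M k" "dual_pair P N k'"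
  shows "map_iso M N"
proof -
  interpret D: dual_pair P M k by (rule assms(1))
  interpret D': dual_pair P N k' by (rule assms(2))
  define f where "f x = D'.k_inv (k x)" for x
  have f: "fst (f x) \<in> edges N \<and> k' (f x) = k x" if x: "fst x \<in> edges M" for x
  proof -
    obtain y where "fst y \<in> edges N" "k' y = k x" using D'.k_ex[OF D.k_in[OF x] D.k_lateral[OF x]] by blast
    then show ?thesis using D'.k_inv[of y] by (simp add: f_def)
  qed
  have f_eq: "f x = y" if "fst x \<in> edges M" "fst y \<in> edges N" "k' y = k x" for x y
    using that D'.k_inv[of y] by (simp add: f_def)
  have f_snd: "snd (f x) = snd x" if "fst x \<in> edges M" for x
    using f[OF that] D.k_snd[OF that] D'.k_snd[of "f x"] by simp
  have f_opp: "f (opposite x) = opposite (f x)" if x: "fst x \<in> edges M" for x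
  proof (rule f_eq)
    have fx: "fst (opposite (f x)) \<in> edges N" using f x by simp
    show "k' (opposite (f x)) = k (opposite x)"
      by (rule D.k_unique) (use x fx f[OF x] D'.k_in[OF fx] D'.k_lateral[OF fx] D'.k_snd[OF fx] f_snd[OF x]
        D'.k_vertex[of "f x"] D.k_vertex[OF x] in simp_all)
  qed (use x f in simp_all)
  have f_rot: "rot N (f x) = f (rot M x)" if x: "fst x \<in> edges M" for x
  proof (rule f_eq[symmetric])
    have fx: "fst (f x) \<in> edges N" using f x by blast
    have "lateral_next P (k x) (k' (rot N (f x)))" using D'.k_next[OF fx] f x by simp
    then show "k' (rot N (f x)) = k (rot M x)"
      using D.k_next[OF x] D.P.lateral_next_unique by blast
  qed (use x f in simp_all)
  define g where "g e = fst (f (e, True))" for e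
  have fg: "f x = map_prod g id x" if x: "fst x \<in> edges M" for x
  proof -
    obtain e b where e: "x = (e, b)" by force
    have "f (e, True) = (g e, True)" using f_snd[of "(e, True)"] x e by (simp add: g_def prod_eq_iff)
    moreover have "f (e, False) = opposite (f (e, True))" using f_opp[of "(e, True)"] x e by simp
    ultimately show ?thesis using e by (cases b) auto
  qed
  have bij: "bij_betw g (edges M) (edges N)"
  proof (rule bij_betw_imageI)
    show "inj_on g (edges M)"
    proof (rule inj_onI)
      fix a b assume ab: "a \<in> edges M" "b \<in> edges M" "g a = g b"
      then have "f (a, True) = f (b, True)" using fg by simp
      then have "k (a, True) = k (b, True)" using f ab by (metis fst_conv)
      then show "a = b" using D.k_eq_iff ab by simp
    qed
    show "g ` edges M = edges N"
    proof
      show "g ` edges M \<subseteq> edges N" using f by (auto simp: g_def)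
      show "edges N \<subseteq> g ` edges M"
      proof
        fix e assume e: "e \<in> edges N"
        obtain x where x: "fst x \<in> edges M" "k x = k' (e, True)"
          using D.k_ex[of "k' (e, True)"] D'.k_in[of "(e, True)"] D'.k_lateral[of "(e, True)"] e by auto
        then have "f x = (e, True)" using f_eq e by simp
        then show "e \<in> g ` edges M" using fg[OF x(1)] x(1) by (cases x) auto
      qed
    qed
  qed
  have planar: "planar_map M" "planar_map N"
    using D.bipolar_M D'.bipolar_M by (simp_all add: bipolar_orientation_def)
  interpret map_isomorphism M N g
  proof
    show "bij_betw g (edges M) (edges N)" by (rule bij)
    show r: "rot N (map_prod g id h) = map_prod g id (rot M h)" if "fst h \<in> edges M" for h
      using f_rot[OF that] fg that by simp
    show "outer M \<in> faces M" by (rule D.outer_face)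
    have st: "face_step N (map_prod g id h) = map_prod g id (face_step M h)" if "fst h \<in> edges M" for h
      using r[of "face_step M h"] that D.M.rot_step[of h] by (cases h) (simp add: D'.M.step_eq_iff)
    have "f (D.end_corner False) = D'.end_corner False"
      using f_eq D.end_corner D'.end_corner by simp
    then have e: "map_prod g id (D.end_corner False) = D'.end_corner False"
      using fg[OF D.end_corner(1)] by simp
    have "outer N = face_of N (D'.end_corner False)" "outer M = face_of M (D.end_corner False)"
      using D'.M.face_mem[OF D'.outer_face D'.end_corner_outer] D.M.face_mem[OF D.outer_face D.end_corner_outer] by blast+
    moreover have "map_prod g id ` orbit (face_step M) (D.end_corner False) =
        orbit (face_step N) (map_prod g id (D.end_corner False))"
    proof (rule orbit_inverse)
      show "D.end_corner False \<in> orbit (face_step M) (D.end_corner False)"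
        using D.M.face_self[OF D.end_corner(1)] by (simp add: face_of_def)
      show "face_step N (map_prod g id x) = map_prod g id (face_step M x)"
        if "x \<in> orbit (face_step M) (D.end_corner False)" for x
        using that st D.M.face_in[OF D.end_corner(1)] by (simp add: face_of_def)
    qed
    ultimately show "outer N = map_prod g id ` outer M" using e by (simp add: face_of_def)
  qed
  show ?thesis using planar by (rule map_isoI)
qed

definition orientation_with :: "nat \<Rightarrow> nat \<Rightarrow> 'e oriented_map \<Rightarrow> bool" where
  "orientation_with n i M \<longleftrightarrow> plane_bipolar_orientation M \<and> card (edges M) = n \<and>
     card (nonspecial_vertices M) = i"

definition avoiding_poset_with :: "nat \<Rightarrow> nat \<Rightarrow> 'e oriented_map \<Rightarrow> bool" where
  "avoiding_poset_with n i P \<longleftrightarrow> plane_bipolar_poset P \<and> N_avoiding P \<and>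
     card (nonspecial_vertices P) = n \<and> card (inner_faces P) = i"

definition dual_maps :: "'a oriented_map \<Rightarrow> 'b oriented_map \<Rightarrow> bool" where
  "dual_maps M P \<longleftrightarrow> (\<exists>k. corresponds M P k)"

lemma plane_planar: "plane_bipolar_orientation M \<Longrightarrow> planar_map M"
  by (simp add: plane_bipolar_orientation_def bipolar_orientation_def)

lemma poset_planar: "plane_bipolar_poset P \<Longrightarrow> planar_map P"
  by (simp add: plane_bipolar_poset_def plane_planar)

lemma orientation_with_iso:
  assumes "orientation_with n i M" "map_iso M N"
  shows "orientation_with n i N"
proof -
  obtain g where "map_isomorphism M N g" using assms(2) by (rule map_isoE)
  then interpret map_isomorphism M N g .
  show ?thesis
    using assms plane_map card_nonspecial_map card_edges_map map_iso_planar(2)[OF assms(2)]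
    by (simp add: orientation_with_def)
qed

lemma avoiding_poset_with_iso:
  assumes "avoiding_poset_with n i P" "map_iso P Q"
  shows "avoiding_poset_with n i Q"
proof -
  obtain g where "map_isomorphism P Q g" using assms(2) by (rule map_isoE)
  then interpret map_isomorphism P Q g .
  have "plane_bipolar_orientation P" using assms(1) by (simp add: avoiding_poset_with_def plane_bipolar_poset_def)
  then show ?thesis
    using assms poset_map N_avoiding_map card_nonspecial_map card_inner_map map_iso_planar(2)[OF assms(2)]
    by (simp add: avoiding_poset_with_def)
qed

lemma dual_maps_iso:
  assumes "dual_maps M P" "map_iso M N" "map_iso P Q"
  shows "dual_maps N Q"
proof -
  obtain g where "map_isomorphism N M g" using map_iso_sym[OF assms(2)] by (rule map_isoE)
  then interpret g: map_isomorphism N M g .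
  obtain f where "map_isomorphism P Q f" using assms(3) by (rule map_isoE)
  then interpret f: map_isomorphism P Q f .
  show ?thesis
    using assms(1) f.corresponds_map_right g.corresponds_map_left unfolding dual_maps_def by blast
qed

lemma dual_pairI:
  assumes "avoiding_poset_with n i P" "rot_map M" "outer M \<in> faces M" "corresponds M P k"
  shows "dual_pair P M k"
proof -
  interpret M: rot_map M by (rule assms(2))
  interpret P: plane_poset P
    using assms(1) by unfold_locales (simp_all add: avoiding_poset_with_def plane_bipolar_poset_def)
  show ?thesis by unfold_locales (use assms in \<open>simp_all add: avoiding_poset_with_def\<close>)
qed

lemma dual_pair_orientation:
  assumes "avoiding_poset_with n i P" "orientation_with n' i' M" "corresponds M P k"
  shows "dual_pair P M k"
proof (rule dual_pairI[OF assms(1) _ _ assms(3)])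
  have "planar_map M" using assms(2) by (simp add: orientation_with_def plane_planar)
  then show "rot_map M" by (rule planar_rot_map)
  show "outer M \<in> faces M" using \<open>planar_map M\<close> by (simp add: planar_map_def)
qed

lemma phi_with:
  assumes "orientation_with n i M"
  shows "avoiding_poset_with n i (phi M) \<and> dual_maps M (phi M)"
proof -
  interpret plane_map M using assms by unfold_locales (simp add: orientation_with_def)
  show ?thesis
    using assms phi_poset phi_N_avoiding card_nonspecial_phi card_inner_phi corresponds_phi
    by (auto simp: avoiding_poset_with_def orientation_with_def dual_maps_def)
qed

lemma dual_maps_unique_right:
  assumes M: "orientation_with n i M" and P: "avoiding_poset_with n' i' P" "dual_maps M P"
    and Q: "avoiding_poset_with n'' i'' Q" "dual_maps M Q"
  shows "map_iso P Q"
proof -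
  obtain k k' where "corresponds M P k" "corresponds M Q k'" using P Q by (auto simp: dual_maps_def)
  then interpret dual_pairs P Q M k k'
    using dual_pair_orientation[OF P(1) M] dual_pair_orientation[OF Q(1) M] by (simp add: dual_pairs_def)
  show ?thesis by (rule iso)
qed

lemma dual_maps_unique_left:
  assumes P: "avoiding_poset_with n i P" and M: "orientation_with n' i' M" "dual_maps M P"
    and N: "orientation_with n'' i'' N" "dual_maps N P"
  shows "map_iso M N"
  using dual_pair_unique dual_pair_orientation[OF P M(1)] dual_pair_orientation[OF P N(1)] M(2) N(2)
  unfolding dual_maps_def by blast

lemma psi_with:
  assumes P: "avoiding_poset_with n i P"
  shows "orientation_with n i (psi P) \<and> dual_maps (psi P) P"
proof -
  interpret plane_poset P
    using P by unfold_locales (simp_all add: avoiding_poset_with_def plane_bipolar_poset_def)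
  have c: "corresponds (psi P) P (lateral_corner P)" by (rule corresponds_psi)
  have "dual_pair P (psi P) (lateral_corner P)" using P rot_map_psi outer_psi_face c by (rule dual_pairI)
  then interpret D: dual_pair P "psi P" "lateral_corner P" .
  have M: "orientation_with (card (edges (psi P))) (card (nonspecial_vertices (psi P))) (psi P)"
    using D.plane_M by (simp add: orientation_with_def)
  have d: "dual_maps (psi P) P" using c by (auto simp: dual_maps_def)
  have "map_iso (phi (psi P)) P" using dual_maps_unique_right[OF M] phi_with[OF M] P d by blast
  then have "avoiding_poset_with (card (edges (psi P))) (card (nonspecial_vertices (psi P))) P"
    using avoiding_poset_with_iso phi_with[OF M] by blast
  then have "card (edges (psi P)) = n" "card (nonspecial_vertices (psi P)) = i"
    using P by (simp_all add: avoiding_poset_with_def)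
  with M d show ?thesis by simp
qed

lemma iso_class: "iso_rel `` {M} = {N. map_iso M N}"
  by (auto simp: iso_rel_def)

lemma phi_class_eq:
  fixes M :: "nat oriented_map" and P :: "nat oriented_map"
  assumes M: "orientation_with n i M" and P: "avoiding_poset_with n i P" "dual_maps M P"
  shows "phi_class (iso_rel `` {M}) = iso_rel `` {P}"
proof -
  have pM: "planar_map M" using M by (simp add: orientation_with_def plane_planar)
  have "map_iso P Q" if MN: "map_iso M N" and NQ: "map_iso (phi N) Q" for N Q :: "nat oriented_map"
  proof -
    have N: "orientation_with n i N" using orientation_with_iso M MN by blast
    have "map_iso N N" "map_iso (phi N) (phi N)" using map_iso_planar[OF MN] map_iso_planar[OF NQ] map_iso_refl by blast+
    then have "dual_maps M (phi N)" using dual_maps_iso phi_with[OF N] map_iso_sym[OF MN] by blast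
    then have "map_iso P (phi N)" using dual_maps_unique_right[OF M P] phi_with[OF N] by blast
    then show ?thesis using NQ by (rule map_iso_trans)
  qed
  moreover have "map_iso (phi M) Q" if "map_iso P Q" for Q
    using map_iso_trans[OF dual_maps_unique_right[OF M _ _ P] that] phi_with[OF M] by blast
  ultimately show ?thesis
    using map_iso_refl[OF pM] unfolding phi_class_def iso_class by auto
qed

lemma psi_class_eq:
  fixes M :: "nat oriented_map" and P :: "nat oriented_map"
  assumes P: "avoiding_poset_with n i P" and M: "orientation_with n i M" "dual_maps M P"
  shows "psi_class (iso_rel `` {P}) = iso_rel `` {M}"
proof -
  have pP: "planar_map P" using P by (simp add: avoiding_poset_with_def poset_planar)
  have "map_iso M N" if PQ: "map_iso P Q" and QN: "map_iso (psi Q) N" for Q N :: "nat oriented_map"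
  proof -
    have Q: "avoiding_poset_with n i Q" using avoiding_poset_with_iso P PQ by blast
    have "map_iso (psi Q) (psi Q)" using map_iso_planar[OF QN] map_iso_refl by blast
    then have "dual_maps (psi Q) P" using dual_maps_iso psi_with[OF Q] map_iso_sym[OF PQ] by blast
    then have "map_iso M (psi Q)" using dual_maps_unique_left[OF P M] psi_with[OF Q] by blast
    then show ?thesis using QN by (rule map_iso_trans)
  qed
  moreover have "map_iso (psi P) N" if "map_iso M N" for N
    using map_iso_trans[OF dual_maps_unique_left[OF P _ _ M] that] psi_with[OF P] by blast
  ultimately show ?thesis
    using map_iso_refl[OF pP] unfolding psi_class_def iso_class by auto
qed

lemma bipolar_classes_eq:
  "bipolar_orientation_classes n i = (\<lambda>M. iso_rel `` {M}) ` {M. orientation_with n i M}"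
  by (auto simp: bipolar_orientation_classes_def quotient_def orientation_with_def)

lemma poset_classes_eq:
  "N_avoiding_poset_classes n i = (\<lambda>P. iso_rel `` {P}) ` {P. avoiding_poset_with n i P}"
  by (auto simp: N_avoiding_poset_classes_def quotient_def avoiding_poset_with_def)

lemma dual_poset_ex:
  fixes M :: "nat oriented_map"
  assumes "orientation_with n i M"
  obtains P :: "nat oriented_map" where "avoiding_poset_with n i P" "dual_maps M P"
proof -
  have p: "avoiding_poset_with n i (phi M)" "dual_maps M (phi M)" using phi_with[OF assms] by auto
  then have "planar_map (phi M)" by (simp add: avoiding_poset_with_def poset_planar)
  then obtain P :: "nat oriented_map" where P: "map_iso (phi M) P" by (rule map_iso_nat)
  have "map_iso M M" using assms by (simp add: orientation_with_def plane_planar map_iso_refl)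
  then show ?thesis using that avoiding_poset_with_iso[OF p(1) P] dual_maps_iso[OF p(2) _ P] by blast
qed

lemma dual_orientation_ex:
  fixes P :: "nat oriented_map"
  assumes "avoiding_poset_with n i P"
  obtains M :: "nat oriented_map" where "orientation_with n i M" "dual_maps M P"
proof -
  have p: "orientation_with n i (psi P)" "dual_maps (psi P) P" using psi_with[OF assms] by auto
  then have "planar_map (psi P)" by (simp add: orientation_with_def plane_planar)
  then obtain M :: "nat oriented_map" where M: "map_iso (psi P) M" by (rule map_iso_nat)
  have "map_iso P P" using assms by (simp add: avoiding_poset_with_def poset_planar map_iso_refl)
  then show ?thesis using that orientation_with_iso[OF p(1) M] dual_maps_iso[OF p(2) M] by blast
qed

theorem proposition6:
  fixes n i :: nat
  assumes "n \<ge> 1"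
  shows "bij_betw phi_class (bipolar_orientation_classes n i) (N_avoiding_poset_classes n i) \<and>
    (\<forall>X \<in> bipolar_orientation_classes n i. psi_class (phi_class X) = X) \<and>
    (\<forall>Y \<in> N_avoiding_poset_classes n i. phi_class (psi_class Y) = Y)"
proof -
  have phi: "phi_class X \<in> N_avoiding_poset_classes n i \<and> psi_class (phi_class X) = X"
    if "X \<in> bipolar_orientation_classes n i" for X
  proof -
    obtain M where M: "orientation_with n i M" "X = iso_rel `` {M}" using \<open>X \<in> _\<close> unfolding bipolar_classes_eq by blast
    obtain P :: "nat oriented_map" where P: "avoiding_poset_with n i P" "dual_maps M P" using M(1) by (rule dual_poset_ex)
    show ?thesis
      unfolding M(2) phi_class_eq[OF M(1) P] psi_class_eq[OF P(1) M(1) P(2)] poset_classes_eq using P(1) by blast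
  qed
  have psi: "psi_class Y \<in> bipolar_orientation_classes n i \<and> phi_class (psi_class Y) = Y"
    if "Y \<in> N_avoiding_poset_classes n i" for Y
  proof -
    obtain P where P: "avoiding_poset_with n i P" "Y = iso_rel `` {P}" using \<open>Y \<in> _\<close> unfolding poset_classes_eq by blast
    obtain M :: "nat oriented_map" where M: "orientation_with n i M" "dual_maps M P" using P(1) by (rule dual_orientation_ex)
    show ?thesis
      unfolding P(2) psi_class_eq[OF P(1) M] phi_class_eq[OF M(1) P(1) M(2)] bipolar_classes_eq using M(1) by blast
  qed
  have "bij_betw phi_class (bipolar_orientation_classes n i) (N_avoiding_poset_classes n i)"
    by (rule bij_betw_byWitness[of _ psi_class]) (use phi psi in auto)
  with phi psi show ?thesis by blast
qed

end
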